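(* Let $m\ge 1$, $N\ge 0$, and let $K$ be a finite abstract simplicial complex with vertex set $\langle N\rangle=\{0,1,\dots,N\}$. Suppose $K$ has a geometric realization in $\mathbb{R}^m$. Then there exists an integral cochain $\lambda\in C^{m-1}(S^2_\Delta;\mathbb{Z})$ satisfying all of the following conditions. 1. For every $(m-1)$-cell $\tau_1\times\tau_2$ of $S^2_\Delta$: $\lambda(\tau_1\times\tau_2)=(-1)^{(\dim\tau_1+1)(\dim\tau_2+1)}\lambda(\tau_2\times\tau_1)$. 2. For every subset $J\subset\langle N\rangle$ with $|J|=m+1$: (a) $\displaystyle\sum_{\tau_+\times\tau_-\in\mathcal{P}_J}|\lambda(\tau_+\times\tau_-)|\le m-\ell_J^m$; (b) $\displaystyle -1\le\sum_{\tau_+\times\tau_-\in\mathcal{P}_J}\operatorname{sgn}(\tau_+,\tau_-)\,\lambda(\tau_+\times\tau_-)\le 0$; (c) for every $\tau_+\times\tau_-\in\mathcal{P}_J$: $\displaystyle -\left\lceil\frac{m-\ell_J^m}{2}\right\rceil\le\operatorname{sgn}(\tau_+,\tau_-)\,\lambda(\tau_+\times\tau_-)\le\left\lfloor\frac{m-\ell_J^m}{2}\right\rfloor$. 3. (a) For all cells $\sigma\times\tau$ of $S^2_\Delta$ with $\dim\sigma+\dim\tau=m$: $-1-\varphi_c(\sigma\times\tau)\le\delta\lambda(\sigma\times\tau)\le 1-\varphi_c(\sigma\times\tau)$; (b) for all cells $\sigma\times\tau$ of $S^2_\Delta$ with $\dim\sigma=m-1$ and $\dim\tau=2$: $-1-\varphi_c(\sigma\times\partial\tau)\le\lambda(\partial\sigma\times\partial\tau)\le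 1-\varphi_c(\sigma\times\partial\tau)$. 4. For every cell $\sigma\times\tau$ of $K^2_\Delta$ with $\dim\sigma+\dim\tau=m$: $\delta\lambda(\sigma\times\tau)=-\varphi_c(\sigma\times\tau)$.
   Context: A geometric realization (simplicial embedding) of $K$ in $\mathbb{R}^m$ is a map $f:\langle N\rangle\to\mathbb{R}^m$ whose simplexwise affine extension $|K|\to\mathbb{R}^m$ is injective. Simplices are nonempty finite sets $\sigma\subset\langle N\rangle$, $\dim\sigma=|\sigma|-1$, oriented by the increasing order of their vertices. $S$ denotes the $m$-skeleton of the simplex with vertex set $\langle N\rangle$, i.e. all nonempty subsets of $\langle N\rangle$ of dimension at most $m$. For a simplicial complex $L$ on $\langle N\rangle$, the deleted product $L^2_\Delta$ is the cell complex whose cells are the products $\sigma\times\tau$ (ordered pairs) of disjoint simplices $\sigma,\tau\in L$, with $\dim(\sigma\times\tau)=\dim\sigma+\dim\tau$; $C^k(L^2_\Delta;\mathbb{Z})$ is the group of integer-valued functions on the $k$-cells, extended linearly to chains. For a simplex $\sigma$ let $\sigma^i$ be its face obtained by deleting the $i$-th vertex (counting from $0$ in increasing order), and $\partial\sigma=\sum_{i=0}^{\dim\sigma}(-1)^i\sigma^i$ (with $\partial\sigma=0$ if $\dim\sigma=0$). The coboundary is $$\delta\lambda(\sigma\times\tau)=\sum_{i=0}^{\dim\sigma}(-1)^i\lambda(\sigma^i\times\tau)+\sum_{j=0}^{\dim\tau}(-1)^{\dim\sigma+j}\lambda(\sigma\times\tau^j),$$ where a sum is omitted if the corresponding simplex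 has dimension $0$. Products of chains are expanded bilinearly: $\lambda(\partial\sigma\times\partial\tau)=\sum_{i,j}(-1)^{i+j}\lambda(\sigma^i\times\tau^j)$ and $\varphi_c(\sigma\times\partial\tau)=\sum_j(-1)^j\varphi_c(\sigma\times\tau^j)$. The cyclic map is $c:\langle N\rangle\to\mathbb{R}^m$, $c(i)=(i,i^2,\dots,i^m)^t$. Its intersection cocycle is defined on $m$-cells by $\varphi_c(\sigma\times\tau)=(-1)^{\dim\sigma}\mathcal{I}(c(\sigma),c(\tau))$. Here, for $\sigma=\{s_0<\dots<s_k\}$, $\tau=\{t_0<\dots<t_\ell\}$ disjoint with $k+\ell=m$, $c(\sigma)=\operatorname{conv}\{c(s_i)\}$ and $c(\tau)=\operatorname{conv}\{c(t_j)\}$ meet in at most one point; $\mathcal{I}(c(\sigma),c(\tau))=0$ if they do not meet, and if they meet in $p$, $$\mathcal{I}(c(\sigma),c(\tau))=\operatorname{sgn}\det\left(\binom{1}{p},\binom{1}{c(s_1)},\dots,\binom{1}{c(s_k)},\binom{1}{c(t_1)},\dots,\binom{1}{c(t_\ell)}\right).$$ For $J=\{j_0<j_1<\dots<j_m\}\subset\langle N\rangle$ put $\ell_J^m=\#\big((J\setminus\{j_0\})\cap\{1,\dots,m\}\big)$ and $$\mathcal{P}_J=\{\tau_+\times\tau_-\in S^2_\Delta:\dim(\tau_+\times\tau_-)=m-1,\ \tau_+\cup\tau_-=J,\ j_0\in\tau_+\}.$$ $\operatorname{sgn}(\tau_+,\tau_-)$ is the sign of the shuffle permutation that sorts the sequence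 consisting of the elements of $\tau_+$ in increasing order followed by the elements of $\tau_-$ in increasing order into the increasing order of $J$. *)

theory Defs
  imports
    "Jordan_Normal_Form.Determinant"
    "HOL-Combinatorics.List_Permutation"
begin

text \<open>Simplices are nonempty finite sets of natural numbers, oriented by the increasing order
  of their vertices. \<open>\<real>\<^sup>m\<close> is rendered as \<open>carrier_vec m\<close>, so that \<open>m\<close> is an
  ordinary natural number.\<close>

section \<open>Simplicial complexes and geometric realizations\<close>

definition complex_on :: "nat \<Rightarrow> nat set set \<Rightarrow> bool" where
  "complex_on N K \<longleftrightarrow>
     (\<forall>\<sigma>\<in>K. \<sigma> \<noteq> {}) \<and>
     (\<forall>\<sigma>\<in>K. \<forall>\<tau>. \<tau> \<subseteq> \<sigma> \<longrightarrow> \<tau> \<noteq> {} \<longrightarrow> \<tau> \<in> K) \<and>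
     \<Union>K = {0..N}"

text \<open>The polyhedron \<open>|K|\<close> in barycentric coordinates.\<close>

definition polyhedron_of :: "nat set set \<Rightarrow> (nat \<Rightarrow> real) set" where
  "polyhedron_of K =
     {x. (\<forall>i. 0 \<le> x i) \<and> {i. x i \<noteq> 0} \<in> K \<and> (\<Sum>i | x i \<noteq> 0. x i) = 1}"

definition affine_extension :: "nat \<Rightarrow> (nat \<Rightarrow> real vec) \<Rightarrow> (nat \<Rightarrow> real) \<Rightarrow> real vec" where
  "affine_extension m f x = vec m (\<lambda>k. \<Sum>i | x i \<noteq> 0. x i * f i $ k)"

definition geometric_realization ::
    "nat \<Rightarrow> nat \<Rightarrow> nat set set \<Rightarrow> (nat \<Rightarrow> real vec) \<Rightarrow> bool" where
  "geometric_realization m N K f \<longleftrightarrow>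
     f \<in> {0..N} \<rightarrow> carrier_vec m \<and> inj_on (affine_extension m f) (polyhedron_of K)"

section \<open>Cells of the deleted product and cochains\<close>

definition sdim :: "nat set \<Rightarrow> nat" where
  "sdim \<sigma> = card \<sigma> - 1"

definition simplex_skeleton :: "nat \<Rightarrow> nat \<Rightarrow> nat set set" where
  "simplex_skeleton m N = {\<sigma>. \<sigma> \<noteq> {} \<and> \<sigma> \<subseteq> {0..N} \<and> sdim \<sigma> \<le> m}"

definition deleted_product :: "nat set set \<Rightarrow> (nat set \<times> nat set) set" where
  "deleted_product L = {(\<sigma>, \<tau>). \<sigma> \<in> L \<and> \<tau> \<in> L \<and> \<sigma> \<inter> \<tau> = {}}"

definition dp_cells :: "nat \<Rightarrow> nat set set \<Rightarrow> (nat set \<times> nat set) set" where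
  "dp_cells k L = {(\<sigma>, \<tau>) \<in> deleted_product L. sdim \<sigma> + sdim \<tau> = k}"

text \<open>Integer-valued functions on the \<open>k\<close>-cells, represented by total functions vanishing
  elsewhere.\<close>

definition cochains :: "nat \<Rightarrow> nat set set \<Rightarrow> (nat set \<times> nat set \<Rightarrow> int) set" where
  "cochains k L = {u. \<forall>c. c \<notin> dp_cells k L \<longrightarrow> u c = 0}"

definition face :: "nat set \<Rightarrow> nat \<Rightarrow> nat set" where
  "face \<sigma> i = \<sigma> - {sorted_list_of_set \<sigma> ! i}"

text \<open>Indices of the faces occurring in \<open>\<partial>\<sigma>\<close>; empty for a vertex, because then \<open>\<partial>\<sigma> = 0\<close>.\<close>

definition face_indices :: "nat set \<Rightarrow> nat set" where
  "face_indices \<sigma> = (if sdim \<sigma> = 0 then {} else {0..sdim \<sigma>})"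

definition coboundary :: "(nat set \<times> nat set \<Rightarrow> int) \<Rightarrow> nat set \<times> nat set \<Rightarrow> int" where
  "coboundary u = (\<lambda>(\<sigma>, \<tau>).
     (\<Sum>i\<in>face_indices \<sigma>. (-1) ^ i * u (face \<sigma> i, \<tau>)) +
     (\<Sum>j\<in>face_indices \<tau>. (-1) ^ (sdim \<sigma> + j) * u (\<sigma>, face \<tau> j)))"

text \<open>The values \<open>u(\<partial>\<sigma> \<times> \<partial>\<tau>)\<close> and \<open>u(\<sigma> \<times> \<partial>\<tau>)\<close>.\<close>

definition eval_bd_bd :: "(nat set \<times> nat set \<Rightarrow> int) \<Rightarrow> nat set \<Rightarrow> nat set \<Rightarrow> int" where
  "eval_bd_bd u \<sigma> \<tau> =
     (\<Sum>i\<in>face_indices \<sigma>. \<Sum>j\<in>face_indices \<tau>. (-1) ^ (i + j) * u (face \<sigma> i, face \<tau> j))"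

definition eval_id_bd :: "(nat set \<times> nat set \<Rightarrow> int) \<Rightarrow> nat set \<Rightarrow> nat set \<Rightarrow> int" where
  "eval_id_bd u \<sigma> \<tau> = (\<Sum>j\<in>face_indices \<tau>. (-1) ^ j * u (\<sigma>, face \<tau> j))"

section \<open>The intersection cocycle of the cyclic map\<close>

definition cyclic_map :: "nat \<Rightarrow> nat \<Rightarrow> real vec" where
  "cyclic_map m i = vec m (\<lambda>k. real i ^ (k + 1))"

text \<open>The convex hull of the points \<open>f v\<close> with \<open>v \<in> \<sigma>\<close>, for finite \<open>\<sigma>\<close>.\<close>

definition conv_image :: "nat \<Rightarrow> (nat \<Rightarrow> real vec) \<Rightarrow> nat set \<Rightarrow> real vec set" where
  "conv_image m f \<sigma> =
     {vec m (\<lambda>k. \<Sum>v\<in>\<sigma>. w v * f v $ k) | w. (\<forall>v\<in>\<sigma>. 0 \<le> w v) \<and> (\<Sum>v\<in>\<sigma>. w v) = 1}"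

text \<open>Intended for simplices of complementary dimension whose images meet in at most one point,
  which holds for the cyclic map; the floor only converts the real sign to an integer.\<close>

definition intersection_number ::
    "nat \<Rightarrow> (nat \<Rightarrow> real vec) \<Rightarrow> nat set \<Rightarrow> nat set \<Rightarrow> int" where
  "intersection_number m f \<sigma> \<tau> =
     (if conv_image m f \<sigma> \<inter> conv_image m f \<tau> = {} then 0
      else let p = (THE p. p \<in> conv_image m f \<sigma> \<inter> conv_image m f \<tau>) in
        \<lfloor>sgn (det (mat_of_cols (m + 1) (map (vCons 1)
           (p # map f (tl (sorted_list_of_set \<sigma>)) @ map f (tl (sorted_list_of_set \<tau>))))))\<rfloor>)"

definition cyclic_cocycle :: "nat \<Rightarrow> nat set \<times> nat set \<Rightarrow> int" where
  "cyclic_cocycle m = (\<lambda>(\<sigma>, \<tau>). (-1) ^ sdim \<sigma> * intersection_number m (cyclic_map m) \<sigma> \<tau>)"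

section \<open>Splittings of a vertex set\<close>

definition ell :: "nat \<Rightarrow> nat set \<Rightarrow> nat" where
  "ell m J = card ((J - {Min J}) \<inter> {1..m})"

definition splittings :: "nat \<Rightarrow> nat \<Rightarrow> nat set \<Rightarrow> (nat set \<times> nat set) set" where
  "splittings m N J =
     {(\<tau>\<^sub>1, \<tau>\<^sub>2) \<in> dp_cells (m - 1) (simplex_skeleton m N). \<tau>\<^sub>1 \<union> \<tau>\<^sub>2 = J \<and> Min J \<in> \<tau>\<^sub>1}"

text \<open>For disjoint finite sets the sorting permutation is unique since the list is distinct.\<close>

definition shuffle_sign :: "nat set \<times> nat set \<Rightarrow> int" where
  "shuffle_sign = (\<lambda>(\<tau>\<^sub>1, \<tau>\<^sub>2).
     let xs = sorted_list_of_set \<tau>\<^sub>1 @ sorted_list_of_set \<tau>\<^sub>2 in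
       sign (THE p. p permutes {..<length xs} \<and> permute_list p xs = sort xs))"

end

theory Submission
  imports Defs "HOL-Analysis.Function_Topology"
begin

text \<open>Perturb the realization and normalize it by an affine map so that it agrees with the cyclic map
  on the vertices \<open>0, \<dots>, m\<close>, then move the cyclic map linearly to it. For an \<open>(m+1)\<close>-set \<open>J\<close> of
  vertices the orientation determinant along this homotopy is a polynomial of degree at most
  \<open>m - \<ell>\<^sub>J\<close>, starting at a positive Vandermonde determinant. At a zero the points of \<open>J\<close> have a unique
  Radon partition, and \<open>\<lambda>\<close> counts, with the signs of the changes of orientation, the zeros with a given
  partition. The degree bounds the number of crossings, and their signs telescope to the total change of
  orientation.

  For \<open>m + 2\<close> vertices the unique affine dependency decides whether two complementary faces intersect,
  and with which sign. It changes its sign pattern exactly at the crossings of the \<open>(m+1)\<close>-subsets, so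
  \<open>\<delta>\<lambda>\<close> is the difference of the intersection cocycles of the realization and of the cyclic map. The former takes
  values in \<open>{-1, 0, 1}\<close>, vanishes on \<open>K\<close>, and a triangle boundary meets a hyperplane in at most two
  points of opposite sign.\<close>

section \<open>Determinants of lists of columns\<close>

definition cdet :: "(nat \<Rightarrow> nat \<Rightarrow> 'a :: comm_ring_1) \<Rightarrow> nat list \<Rightarrow> 'a" where
  "cdet V xs = det (mat (length xs) (length xs) (\<lambda>(i, j). V i (xs ! j)))"

lemma cdet_cong:
  assumes "\<And>i x. i < length xs \<Longrightarrow> x \<in> set xs \<Longrightarrow> V i x = W i x"
  shows "cdet V xs = cdet W xs"
  unfolding cdet_def by (rule arg_cong[where f = det], rule cong_mat) (auto simp: assms)

lemma cdet_Nil [simp]: "cdet V [] = 1"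
  unfolding cdet_def by (simp add: det_dim_zero)

lemma cdet_permute:
  assumes "p permutes {..<length xs}"
  shows "cdet V (permute_list p xs) = of_int (sign p) * cdet V xs"
proof -
  let ?n = "length xs"
  let ?A = "mat ?n ?n (\<lambda>(i, j). V i (xs ! j))"
  have p: "p permutes {0..<?n}"
    using assms by (simp add: atLeast0LessThan)
  have "cdet V (permute_list p xs) = det (mat ?n ?n (\<lambda>(i, j). V i (permute_list p xs ! j)))"
    by (simp add: cdet_def)
  also have "mat ?n ?n (\<lambda>(i, j). V i (permute_list p xs ! j))
      = transpose_mat (mat ?n ?n (\<lambda>(i, j). transpose_mat ?A $$ (p i, j)))"
    using p permutes_in_image[OF assms] by (intro eq_matI) (auto simp: permute_list_nth[OF assms])
  also have "det \<dots> = det (mat ?n ?n (\<lambda>(i, j). transpose_mat ?A $$ (p i, j)))"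
    by (rule det_transpose) auto
  also have "\<dots> = of_int (sign p) * det (transpose_mat ?A)"
    by (rule det_permute_rows[OF _ p]) auto
  also have "det (transpose_mat ?A) = det ?A"
    by (rule det_transpose) auto
  finally show ?thesis by (simp add: cdet_def)
qed

lemma cdet_eq_0_mset:
  fixes V :: "nat \<Rightarrow> nat \<Rightarrow> 'a :: comm_ring_1"
  assumes "mset xs = mset ys"
  shows "cdet V xs = 0 \<longleftrightarrow> cdet V ys = 0"
proof -
  obtain p where p: "p permutes {..<length ys}" "permute_list p ys = xs"
    using mset_eq_permutation[OF assms] by blast
  have "cdet V xs = of_int (sign p) * cdet V ys"
    using cdet_permute[OF p(1), of V] p(2) by simp
  then show ?thesis by (auto simp: sign_def)
qed

lemma cdet_expand_last_row:
  assumes "length xs = Suc n"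
  shows "cdet V xs =
    (\<Sum>j<Suc n. V n (xs ! j) * ((-1) ^ (n + j) * cdet V (take j xs @ drop (Suc j) xs)))"
proof -
  let ?A = "mat (Suc n) (Suc n) (\<lambda>(i, j). V i (xs ! j))"
  have "cdet V xs = (\<Sum>j<Suc n. ?A $$ (n, j) * cofactor ?A n j)"
    unfolding cdet_def assms by (rule laplace_expansion_row) auto
  also have "\<dots> = (\<Sum>j<Suc n. V n (xs ! j) * ((-1) ^ (n + j) * cdet V (take j xs @ drop (Suc j) xs)))"
  proof (rule sum.cong[OF refl])
    fix j assume j: "j \<in> {..<Suc n}"
    have len: "length (take j xs @ drop (Suc j) xs) = n" using j assms by auto
    have "mat_delete ?A n j = mat n n (\<lambda>(i, k). V i ((take j xs @ drop (Suc j) xs) ! k))"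
      using j assms by (intro eq_matI) (auto simp: mat_delete_def nth_append min_def not_less)
    then show "?A $$ (n, j) * cofactor ?A n j
        = V n (xs ! j) * ((-1) ^ (n + j) * cdet V (take j xs @ drop (Suc j) xs))"
      using j unfolding cofactor_def cdet_def len by simp
  qed
  finally show ?thesis .
qed

lemma cdet_snoc_upd:
  assumes "x \<notin> set xs"
  shows "cdet (V(length xs := (V (length xs))(x := y))) (xs @ [x])
    = cdet (V(length xs := (V (length xs))(x := 0))) (xs @ [x]) + y * cdet V xs"
proof -
  let ?n = "length xs" and ?zs = "xs @ [x]"
  let ?V = "\<lambda>y. V(length xs := (V (length xs))(x := y))"
  have len: "length ?zs = Suc ?n" by simp
  have minor: "cdet (?V y) (take j ?zs @ drop (Suc j) ?zs) = cdet V (take j ?zs @ drop (Suc j) ?zs)"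
    if "j < Suc ?n" for j y
    using that by (intro cdet_cong) auto
  have expand: "cdet (?V y) ?zs
      = (\<Sum>j<?n. V ?n (xs ! j) * ((-1) ^ (?n + j) * cdet V (take j ?zs @ drop (Suc j) ?zs)))
        + y * cdet V xs" for y
  proof -
    have "cdet (?V y) ?zs = (\<Sum>j<Suc ?n. ?V y ?n (?zs ! j) *
        ((-1) ^ (?n + j) * cdet V (take j ?zs @ drop (Suc j) ?zs)))"
      unfolding cdet_expand_last_row[OF len]
      by (rule sum.cong[OF refl]) (metis lessThan_iff minor)
    also have "\<dots> = (\<Sum>j<?n. V ?n (xs ! j) * ((-1) ^ (?n + j) * cdet V (take j ?zs @ drop (Suc j) ?zs)))
        + y * ((-1) ^ (?n + ?n) * cdet V xs)"
      unfolding sum.lessThan_Suc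
      using assms by (intro arg_cong2[where f = "(+)"] sum.cong refl) (auto simp: nth_append)
    finally show ?thesis by (simp add: power_add[symmetric] flip: mult_2)
  qed
  show ?thesis unfolding expand[of y] expand[of 0] by simp
qed

lemma cdet_snoc:
  assumes "x \<notin> set xs"
  shows "cdet V (xs @ [x])
    = cdet (V(length xs := (V (length xs))(x := 0))) (xs @ [x]) + V (length xs) x * cdet V xs"
  using cdet_snoc_upd[OF assms, of V "V (length xs) x"] by simp

lemma cdet_hom:
  assumes "comm_ring_hom h"
  shows "cdet (\<lambda>i j. h (V i j)) xs = h (cdet V xs)"
proof -
  interpret comm_ring_hom h by fact
  have "mat (length xs) (length xs) (\<lambda>(i, j). h (V i (xs ! j)))
     = map_mat h (mat (length xs) (length xs) (\<lambda>(i, j). V i (xs ! j)))"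
    by (intro eq_matI) auto
  then show ?thesis unfolding cdet_def by (simp add: hom_det)
qed

definition cpoly :: "(nat \<Rightarrow> nat \<Rightarrow> real) \<Rightarrow> (nat \<Rightarrow> nat \<Rightarrow> real) \<Rightarrow> nat list \<Rightarrow> real poly" where
  "cpoly C E xs = cdet (\<lambda>i j. [:C i j, E i j:]) xs"

lemma poly_cpoly: "poly (cpoly C E xs) t = cdet (\<lambda>i j. C i j + t * E i j) xs"
proof -
  have "comm_ring_hom (\<lambda>p. poly p t)"
    by unfold_locales auto
  from cdet_hom[OF this, of "\<lambda>i j. [:C i j, E i j:]" xs] show ?thesis
    by (simp add: cpoly_def)
qed

lemma degree_det_le_row:
  fixes A :: "'a :: comm_ring_1 poly mat"
  assumes A: "A \<in> carrier_mat n n"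
    and deg: "\<And>i j. i < n \<Longrightarrow> j < n \<Longrightarrow> degree (A $$ (i, j)) \<le> d i"
  shows "degree (det A) \<le> (\<Sum>i<n. d i)"
  unfolding det_def'[OF A]
proof (rule degree_sum_le)
  fix p assume "p \<in> {p. p permutes {0..<n}}"
  then have p: "p permutes {0..<n}" by simp
  have "degree (of_int (sign p) * (\<Prod>i = 0..<n. A $$ (i, p i))) \<le> degree (\<Prod>i = 0..<n. A $$ (i, p i))"
    by (auto simp: sign_def)
  also have "\<dots> \<le> (\<Sum>i = 0..<n. degree (A $$ (i, p i)))"
    using degree_prod_sum_le[of "{0..<n}" "\<lambda>i. A $$ (i, p i)"] by (simp add: o_def)
  also have "\<dots> \<le> (\<Sum>i = 0..<n. d i)"
    using permutes_in_image[OF p] by (intro sum_mono deg) auto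
  finally show "degree (of_int (sign p) * (\<Prod>i = 0..<n. A $$ (i, p i))) \<le> (\<Sum>i<n. d i)"
    by (simp add: atLeast0LessThan)
qed (simp add: finite_permutations)

lemma degree_cpoly_row:
  assumes "\<And>i j. i < length xs \<Longrightarrow> j \<in> set xs \<Longrightarrow> d i = 0 \<Longrightarrow> E i j = 0"
    and "\<And>i. d i \<le> 1"
  shows "degree (cpoly C E xs) \<le> (\<Sum>i<length xs. d i)"
proof -
  have "degree [:C i (xs ! j), E i (xs ! j):] \<le> d i" if "i < length xs" "j < length xs" for i j
    using assms(1)[of i "xs ! j"] that by (cases "d i = 0") auto
  then show ?thesis
    unfolding cpoly_def cdet_def by (intro degree_det_le_row) auto
qed

lemma degree_cpoly_col:
  assumes "\<And>i j. i < length xs \<Longrightarrow> j < length xs \<Longrightarrow> d j = 0 \<Longrightarrow> E i (xs ! j) = 0"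
  shows "degree (cpoly C E xs) \<le> (\<Sum>j<length xs. d j)"
proof -
  let ?A = "mat (length xs) (length xs) (\<lambda>(i, j). [:C i (xs ! j), E i (xs ! j):])"
  have "degree (det (transpose_mat ?A)) \<le> (\<Sum>j<length xs. d j)"
  proof (intro degree_det_le_row)
    fix i j assume "i < length xs" "j < length xs"
    then show "degree (transpose_mat ?A $$ (i, j)) \<le> d i"
      using assms[of j i] by (cases "d i = 0") auto
  qed auto
  moreover have "det (transpose_mat ?A) = det ?A"
    by (rule det_transpose) auto
  ultimately show ?thesis unfolding cpoly_def cdet_def by simp
qed

lemma cdet_kernel_trivial:
  fixes V :: "nat \<Rightarrow> nat \<Rightarrow> 'a :: idom"
  assumes "cdet V xs \<noteq> 0" "distinct xs"
    and ker: "\<And>i. i < length xs \<Longrightarrow> (\<Sum>x\<in>set xs. b x * V i x) = 0"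
  shows "\<forall>x\<in>set xs. b x = 0"
proof -
  let ?n = "length xs"
  let ?A = "mat ?n ?n (\<lambda>(i, j). V i (xs ! j))"
  let ?b = "vec ?n (\<lambda>j. b (xs ! j))"
  have "?A *\<^sub>v ?b = 0\<^sub>v ?n"
  proof (rule eq_vecI)
    fix i assume i: "i < dim_vec (0\<^sub>v ?n :: 'a vec)"
    have "(?A *\<^sub>v ?b) $ i = (\<Sum>j<?n. V i (xs ! j) * b (xs ! j))"
      using i by (simp add: scalar_prod_def atLeast0LessThan)
    also have "\<dots> = (\<Sum>x\<in>set xs. b x * V i x)"
      using sum.reindex_bij_betw[OF bij_betw_nth[OF assms(2) refl refl], of "\<lambda>x. b x * V i x"]
      by (simp add: mult.commute)
    finally show "(?A *\<^sub>v ?b) $ i = (0\<^sub>v ?n) $ i"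
      using ker i by simp
  qed auto
  moreover have "?A \<in> carrier_mat ?n ?n" "?b \<in> carrier_vec ?n" by auto
  ultimately have "?b = 0\<^sub>v ?n"
    using assms(1) det_0_iff_vec_prod_zero[of ?A ?n] unfolding cdet_def by blast
  then have "b (xs ! j) = 0" if "j < ?n" for j
    using that by (metis index_vec index_zero_vec(1))
  then show ?thesis by (metis in_set_conv_nth)
qed

lemma cdet_relation:
  assumes "length xs = Suc n" "r < n"
  shows "(\<Sum>j<Suc n. V r (xs ! j) * ((-1) ^ j * cdet V (take j xs @ drop (Suc j) xs))) = 0"
proof -
  let ?W = "V(n := V r)"
  let ?A = "mat (Suc n) (Suc n) (\<lambda>(i, j). ?W i (xs ! j))"
  have "cdet ?W xs = 0"
    unfolding cdet_def assms(1)
  proof (rule det_identical_rows[of ?A "Suc n" r n])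
    show "row ?A r = row ?A n" using assms(2) by (intro eq_vecI) auto
  qed (use assms(2) in auto)
  moreover have "cdet ?W (take j xs @ drop (Suc j) xs) = cdet V (take j xs @ drop (Suc j) xs)"
    if "j < Suc n" for j
    using that assms by (intro cdet_cong) auto
  ultimately have "(\<Sum>j<Suc n. V r (xs ! j) * ((-1) ^ (n + j) * cdet V (take j xs @ drop (Suc j) xs))) = 0"
    unfolding cdet_expand_last_row[OF assms(1)] by simp
  then have "(-1) ^ n * (\<Sum>j<Suc n. V r (xs ! j) * ((-1) ^ (n + j) * cdet V (take j xs @ drop (Suc j) xs))) = 0"
    by simp
  moreover have "(-1) ^ n * (a * ((-1) ^ (n + j) * c)) = a * ((-1) ^ j * c)" for a c :: 'a and j
  proof -
    have "(-1 :: 'a) ^ n * (-1) ^ (n + j) = (-1) ^ j"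
      by (simp add: power_add flip: mult.assoc power_mult_distrib)
    then show ?thesis by (metis mult.assoc mult.left_commute)
  qed
  ultimately show ?thesis by (simp only: sum_distrib_left)
qed

section \<open>Vandermonde determinants and shuffle signs\<close>

definition moment :: "nat \<Rightarrow> nat \<Rightarrow> real" where
  "moment i j = real j ^ i"

text \<open>Expanding along the last column exhibits the determinant as a polynomial in \<open>x\<close> with
  roots \<open>xs\<close>.\<close>

lemma vandermonde_snoc:
  assumes "distinct xs"
  shows "cdet moment (xs @ [x]) = cdet moment xs * (\<Prod>y\<in>set xs. real x - real y)"
proof -
  let ?n = "length xs"
  define A where "A x = mat (Suc ?n) (Suc ?n) (\<lambda>(i, j). if j < ?n then real (xs ! j) ^ i else x ^ i)"
    for x :: real
  define c where "c i = cofactor (A 0) i ?n" for i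
  define p where "p = (\<Sum>i<Suc ?n. monom (c i) i)"
  have A: "A x \<in> carrier_mat (Suc ?n) (Suc ?n)" for x
    by (simp add: A_def)
  have del: "mat_delete (A x) i ?n = mat_delete (A 0) i ?n" if "i < Suc ?n" for x i
    unfolding mat_delete_def A_def by (rule eq_matI) auto
  have poly_p: "poly p x = det (A x)" for x
  proof -
    have "det (A x) = (\<Sum>i<Suc ?n. A x $$ (i, ?n) * cofactor (A x) i ?n)"
      by (rule laplace_expansion_column[OF A]) simp
    also have "\<dots> = (\<Sum>i<Suc ?n. x ^ i * c i)"
    proof (rule sum.cong[OF refl])
      fix i assume "i \<in> {..<Suc ?n}"
      then have i: "i < Suc ?n" by simp
      have "cofactor (A x) i ?n = c i"
        unfolding c_def cofactor_def del[OF i, of x] ..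
      then show "A x $$ (i, ?n) * cofactor (A x) i ?n = x ^ i * c i"
        using i by (simp add: A_def)
    qed
    also have "\<dots> = poly p x"
      by (simp add: p_def poly_sum poly_monom mult.commute)
    finally show ?thesis ..
  qed
  have "mat_delete (A 0) ?n ?n = mat ?n ?n (\<lambda>(i, j). moment i (xs ! j))"
    unfolding mat_delete_def A_def moment_def by (rule eq_matI) auto
  then have lead: "coeff p ?n = cdet moment xs"
    unfolding p_def by (simp add: coeff_sum if_distrib c_def cofactor_def cdet_def flip: mult_2)
  have deg_p: "degree p \<le> ?n"
    unfolding p_def by (rule degree_sum_le) (auto intro: order.trans[OF degree_monom_le])
  have root: "poly p (real y) = 0" if y: "y \<in> set xs" for y
  proof -
    obtain k where k: "k < ?n" "xs ! k = y" using y by (metis in_set_conv_nth)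
    have "col (A (real y)) k = col (A (real y)) ?n"
      using k by (intro eq_vecI) (auto simp: A_def)
    then show ?thesis
      unfolding poly_p using det_identical_columns[OF A, of k ?n] k by auto
  qed
  define q where "q = (\<Prod>y\<in>set xs. [:- real y, 1:])"
  have q: "degree q = ?n" "lead_coeff q = 1"
  proof -
    show "degree q = ?n"
      unfolding q_def by (subst degree_prod_eq_sum_degree) (use assms in \<open>auto simp: distinct_card\<close>)
    show "lead_coeff q = 1"
      unfolding q_def by (simp add: lead_coeff_prod)
  qed
  have "p = smult (cdet moment xs) q"
  proof (rule ccontr)
    assume "p \<noteq> smult (cdet moment xs) q"
    define r where "r = p - smult (cdet moment xs) q"
    have r: "r \<noteq> 0" using \<open>p \<noteq> _\<close> by (simp add: r_def)
    have "degree r \<le> ?n"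
      unfolding r_def using deg_p q(1)
      by (intro degree_diff_le) (auto intro: order.trans[OF degree_smult_le])
    moreover have "coeff r ?n = 0"
      unfolding r_def using lead q by simp
    ultimately have deg_r: "degree r < ?n"
      using r by (metis le_neq_implies_less leading_coeff_0_iff)
    have "real ` set xs \<subseteq> {x. poly r x = 0}"
      using root by (auto simp: r_def q_def poly_prod)
    then have "card (real ` set xs) \<le> card {x. poly r x = 0}"
      using poly_roots_finite[OF r] by (intro card_mono)
    also have "\<dots> \<le> degree r"
      by (rule card_poly_roots_bound[OF r])
    finally show False
      using deg_r assms by (simp add: card_image distinct_card)
  qed
  then have "poly p (real x) = cdet moment xs * (\<Prod>y\<in>set xs. real x - real y)"
    by (simp add: q_def poly_prod)
  moreover have "poly p (real x) = cdet moment (xs @ [x])"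
    unfolding poly_p cdet_def A_def moment_def
    by (rule arg_cong[where f = det], rule eq_matI) (auto simp: nth_append less_Suc_eq)
  ultimately show ?thesis by simp
qed

lemma vandermonde_nonzero:
  "distinct xs \<Longrightarrow> cdet moment xs \<noteq> 0"
  by (induction xs rule: rev_induct) (auto simp: vandermonde_snoc)

lemma sgn_prod_eq: "sgn (prod f A) = (\<Prod>x\<in>A. sgn (f x))" for f :: "'b \<Rightarrow> real"
  by (induction A rule: infinite_finite_induct) (auto simp: sgn_mult)

lemma vandermonde_append_sgn:
  assumes "sorted_wrt (<) ys" "distinct (xs @ ys)"
  shows "sgn (cdet moment (xs @ ys))
    = sgn (cdet moment xs) * of_int (\<Prod>x\<in>set xs. \<Prod>y\<in>set ys. sgn (int y - int x))"
  using assms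
proof (induction ys rule: rev_induct)
  case (snoc y ys)
  have dist: "distinct (xs @ ys)" and sorted: "sorted_wrt (<) ys" and y: "y \<notin> set ys"
    using snoc.prems by (auto simp: strict_sorted_iff sorted_append)
  have "(\<Prod>z\<in>set (xs @ ys). real y - real z)
      = (\<Prod>z\<in>set xs. real y - real z) * (\<Prod>z\<in>set ys. real y - real z)"
    using dist by (simp add: prod.union_disjoint)
  moreover have "(\<Prod>z\<in>set ys. real y - real z) > 0"
  proof (rule prod_pos)
    fix z assume "z \<in> set ys"
    with snoc.prems(1) y show "0 < real y - real z"
      by (metis diff_gt_0_iff_gt of_nat_less_iff sorted_wrt_append list.set_intros(1))
  qed
  moreover have "sgn (\<Prod>z\<in>set xs. real y - real z) = of_int (\<Prod>z\<in>set xs. sgn (int y - int z))"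
    unfolding sgn_prod_eq of_int_prod
    by (intro prod.cong refl) (auto simp: sgn_if)
  moreover have "cdet moment (xs @ ys @ [y])
      = cdet moment (xs @ ys) * (\<Prod>z\<in>set (xs @ ys). real y - real z)"
    using vandermonde_snoc[OF dist] by simp
  ultimately have "sgn (cdet moment (xs @ ys @ [y]))
      = sgn (cdet moment xs) * of_int (\<Prod>x\<in>set xs. \<Prod>y\<in>set ys. sgn (int y - int x))
        * of_int (\<Prod>z\<in>set xs. sgn (int y - int z))"
    using snoc.IH[OF sorted dist] by (simp add: sgn_mult)
  also have "\<dots> = sgn (cdet moment xs)
      * of_int (\<Prod>x\<in>set xs. \<Prod>y\<in>set (ys @ [y]). sgn (int y - int x))"
    using y by (simp add: prod.distrib[symmetric] mult.commute)
  finally show ?case .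
qed simp

lemma vandermonde_pos:
  assumes "sorted_wrt (<) xs"
  shows "cdet moment xs > 0"
  using vandermonde_append_sgn[OF assms, of "[]"] assms
  by (simp add: strict_sorted_iff sgn_if split: if_splits)

text \<open>The sign of the sorting permutation is read off the Vandermonde determinant.\<close>

lemma shuffle_sign_aux:
  assumes "finite A" "finite B" "A \<inter> B = {}"
  shows "shuffle_sign (A, B) = (\<Prod>x\<in>A. \<Prod>y\<in>B. sgn (int y - int x))"
    and "cdet V (sorted_list_of_set A @ sorted_list_of_set B)
      = of_int (shuffle_sign (A, B)) * cdet V (sorted_list_of_set (A \<union> B))"
proof -
  let ?xs = "sorted_list_of_set A @ sorted_list_of_set B"
  have dist: "distinct ?xs" using assms by auto
  have sort: "sort ?xs = sorted_list_of_set (A \<union> B)"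
    using assms dist by (intro sorted_distinct_set_unique) auto
  obtain p where p: "p permutes {..<length ?xs}" "permute_list p ?xs = sort ?xs"
    using mset_eq_permutation[of "sort ?xs" ?xs] by auto
  have uniq: "q = p" if q: "q permutes {..<length ?xs}" "permute_list q ?xs = sort ?xs" for q
  proof
    fix i
    show "q i = p i"
    proof (cases "i < length ?xs")
      case True
      then have "?xs ! q i = ?xs ! p i"
        using permute_list_nth[OF p(1) True] permute_list_nth[OF q(1) True] p q by simp
      moreover have "q i < length ?xs" "p i < length ?xs"
        using True permutes_in_image[OF p(1)] permutes_in_image[OF q(1)] by auto
      ultimately show ?thesis using dist nth_eq_iff_index_eq by blast
    next
      case False
      then show ?thesis using p(1) q(1) by (metis lessThan_iff permutes_not_in)
    qed
  qed
  have "(THE p. p permutes {..<length ?xs} \<and> permute_list p ?xs = sort ?xs) = p"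
    using p uniq by (intro the_equality) blast+
  then have sh: "shuffle_sign (A, B) = sign p"
    unfolding shuffle_sign_def by (simp add: Let_def)
  have perm: "cdet W (sorted_list_of_set (A \<union> B)) = of_int (sign p) * cdet W ?xs"
    for W :: "nat \<Rightarrow> nat \<Rightarrow> 'b :: comm_ring_1"
    using cdet_permute[OF p(1), of W] p(2) sort by simp
  show "cdet V ?xs = of_int (shuffle_sign (A, B)) * cdet V (sorted_list_of_set (A \<union> B))"
    unfolding perm sh by (simp add: sign_def)
  have "1 = sgn (cdet moment (sorted_list_of_set (A \<union> B)))"
    using vandermonde_pos[of "sorted_list_of_set (A \<union> B)"] by simp
  also have "\<dots> = of_int (sign p) * sgn (cdet moment ?xs)"
    unfolding perm by (simp add: sgn_mult sign_def)
  also have "sgn (cdet moment ?xs)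
      = sgn (cdet moment (sorted_list_of_set A)) * of_int (\<Prod>x\<in>A. \<Prod>y\<in>B. sgn (int y - int x))"
    using vandermonde_append_sgn[of "sorted_list_of_set B" "sorted_list_of_set A"] assms dist by simp
  also have "sgn (cdet moment (sorted_list_of_set A)) = 1"
    using vandermonde_pos[of "sorted_list_of_set A"] by simp
  finally have "real_of_int (sign p * (\<Prod>x\<in>A. \<Prod>y\<in>B. sgn (int y - int x))) = 1"
    by simp
  then have "sign p * (\<Prod>x\<in>A. \<Prod>y\<in>B. sgn (int y - int x)) = 1"
    by linarith
  then show "shuffle_sign (A, B) = (\<Prod>x\<in>A. \<Prod>y\<in>B. sgn (int y - int x))"
    unfolding sh by (auto simp: sign_def split: if_splits)
qed

lemmas shuffle_sign_eq = shuffle_sign_aux(1)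
lemmas cdet_shuffle = shuffle_sign_aux(2)

section \<open>Generic homotopies\<close>

definition homotopy :: "(nat \<Rightarrow> nat \<Rightarrow> real) \<Rightarrow> real \<Rightarrow> nat \<Rightarrow> nat \<Rightarrow> real" where
  "homotopy E t i j = moment i j + t * E i j"

lemma cdet_homotopy: "cdet (homotopy E t) xs = poly (cpoly moment E xs) t"
  unfolding poly_cpoly by (intro cdet_cong) (simp add: homotopy_def)

lemma cdet_homotopy_0: "cdet (homotopy E 0) xs = cdet moment xs"
  by (intro cdet_cong) (simp add: homotopy_def)

lemma cpoly_moment_nonzero: "distinct xs \<Longrightarrow> cpoly moment E xs \<noteq> 0"
  using vandermonde_nonzero cdet_homotopy_0[of E xs] cdet_homotopy[of E 0 xs] by force

lemma finite_homotopy_zeros: "distinct xs \<Longrightarrow> finite {t. cdet (homotopy E t) xs = 0}"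
  unfolding cdet_homotopy by (intro poly_roots_finite cpoly_moment_nonzero)

lemma homotopy_zero_nonzero: "distinct xs \<Longrightarrow> cdet (homotopy E t) xs = 0 \<Longrightarrow> t \<noteq> 0"
  using vandermonde_nonzero cdet_homotopy_0[of E xs] by force

text \<open>A common zero of two maximal minors sharing all but one column is an event of codimension two.
  The middle clause makes it possible to choose the entries row by row: where a minor of the first
  \<open>k\<close> rows vanishes, a minor of \<open>k + 1\<close> rows containing its columns does not depend on the last
  entry of the additional column.\<close>

definition generic_upto :: "(nat \<Rightarrow> nat \<Rightarrow> real) \<Rightarrow> nat \<Rightarrow> nat \<Rightarrow> nat \<Rightarrow> bool" where
  "generic_upto E n k j \<longleftrightarrow>
     (\<forall>xs v w t. length xs = k \<longrightarrow> distinct (xs @ [v, w]) \<longrightarrow> set (xs @ [v, w]) \<subseteq> {..<j} \<longrightarrow>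
        cdet (homotopy E t) (xs @ [v]) \<noteq> 0 \<or> cdet (homotopy E t) (xs @ [w]) \<noteq> 0) \<and>
     (\<forall>xs w t. length xs = k \<longrightarrow> distinct (xs @ [w]) \<longrightarrow> set xs \<subseteq> {..<j} \<longrightarrow> w < n \<longrightarrow>
        cdet (homotopy E t) xs \<noteq> 0 \<or> cdet (homotopy E t) (xs @ [w]) \<noteq> 0) \<and>
     (\<forall>xs. length xs = Suc k \<longrightarrow> distinct xs \<longrightarrow> set xs \<subseteq> {..<j} \<longrightarrow>
        cdet (homotopy E 1) xs \<noteq> 0)"

lemma generic_uptoD:
  assumes "generic_upto E n k j"
  shows "\<And>xs v w t. length xs = k \<Longrightarrow> distinct (xs @ [v, w]) \<Longrightarrow> set (xs @ [v, w]) \<subseteq> {..<j} \<Longrightarrow>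
        cdet (homotopy E t) (xs @ [v]) \<noteq> 0 \<or> cdet (homotopy E t) (xs @ [w]) \<noteq> 0"
    and "\<And>xs w t. length xs = k \<Longrightarrow> distinct (xs @ [w]) \<Longrightarrow> set xs \<subseteq> {..<j} \<Longrightarrow> w < n \<Longrightarrow>
        cdet (homotopy E t) xs \<noteq> 0 \<or> cdet (homotopy E t) (xs @ [w]) \<noteq> 0"
    and "\<And>xs. length xs = Suc k \<Longrightarrow> distinct xs \<Longrightarrow> set xs \<subseteq> {..<j} \<Longrightarrow>
        cdet (homotopy E 1) xs \<noteq> 0"
  using assms unfolding generic_upto_def by blast+

lemma generic_upto_cong:
  assumes "generic_upto E n k j" "\<And>i. i \<le> k \<Longrightarrow> E' i = E i"
  shows "generic_upto E' n k j"
proof -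
  have "cdet (homotopy E' t) xs = cdet (homotopy E t) xs" if "length xs \<le> Suc k" for xs t
    using that assms(2) by (intro cdet_cong) (simp add: homotopy_def)
  then show ?thesis
    using generic_uptoD[OF assms(1)] unfolding generic_upto_def by auto
qed

lemma finite_common_solutions:
  fixes Z :: "real set"
  assumes "finite Z" "\<And>t. t \<in> Z \<Longrightarrow> t \<noteq> 0 \<and> (B t \<noteq> 0 \<or> B' t \<noteq> 0)"
  shows "finite {y. \<exists>t\<in>Z. A t + (c + t * y) * B t = 0 \<and> A' t + (c + t * y) * B' t = 0}"
proof -
  have "{y. \<exists>t\<in>Z. A t + (c + t * y) * B t = 0 \<and> A' t + (c + t * y) * B' t = 0}
      \<subseteq> (\<Union>t\<in>Z. {(- A t / B t - c) / t, (- A' t / B' t - c) / t})"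
  proof clarify
    fix y t assume t: "t \<in> Z" and eqs: "A t + (c + t * y) * B t = 0" "A' t + (c + t * y) * B' t = 0"
    have "y = (- A t / B t - c) / t \<or> y = (- A' t / B' t - c) / t"
      using assms(2)[OF t] eqs by (auto simp: field_simps eq_neg_iff_add_eq_0)
    with t show "y \<in> (\<Union>t\<in>Z. {(- A t / B t - c) / t, (- A' t / B' t - c) / t})" by blast
  qed
  then show ?thesis by (rule finite_subset) (use assms(1) in auto)
qed

locale one_entry =
  fixes E :: "nat \<Rightarrow> nat \<Rightarrow> real" and n k j :: nat
  assumes k: "k \<ge> 1" and j: "j < n"
    and lower: "generic_upto E n (k - 1) n"
    and same: "generic_upto E n k j"
begin

abbreviation upd :: "real \<Rightarrow> nat \<Rightarrow> nat \<Rightarrow> real" where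
  "upd y \<equiv> E(k := (E k)(j := y))"

definition rest :: "nat list \<Rightarrow> real poly" where
  "rest xs = cpoly (moment(k := (moment k)(j := 0))) (upd 0) (xs @ [j])"

lemma cdet_upd_short: "length xs \<le> k \<Longrightarrow> cdet (homotopy (upd y) t) xs = cdet (homotopy E t) xs"
  by (intro cdet_cong) (simp add: homotopy_def)

lemma cdet_upd_other: "j \<notin> set xs \<Longrightarrow> cdet (homotopy (upd y) t) xs = cdet (homotopy E t) xs"
  by (intro cdet_cong) (auto simp: homotopy_def)

lemma cdet_upd:
  assumes "length xs = k" "j \<notin> set xs"
  shows "cdet (homotopy (upd y) t) (xs @ [j])
    = poly (rest xs) t + (moment k j + t * y) * cdet (homotopy E t) xs"
proof -
  have "cdet (homotopy (upd y) t) (xs @ [j])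
      = cdet ((homotopy (upd y) t)(k := (homotopy (upd y) t k)(j := 0))) (xs @ [j])
        + homotopy (upd y) t k j * cdet (homotopy (upd y) t) xs"
    using cdet_snoc[OF assms(2), of "homotopy (upd y) t"] assms(1) by simp
  moreover have "cdet ((homotopy (upd y) t)(k := (homotopy (upd y) t k)(j := 0))) (xs @ [j])
      = poly (rest xs) t"
    unfolding rest_def poly_cpoly by (intro cdet_cong) (auto simp: homotopy_def)
  ultimately show ?thesis
    using cdet_upd_short[of xs] assms(1) by (simp add: homotopy_def)
qed

definition bad :: "real set \<Rightarrow> nat list \<Rightarrow> nat list \<Rightarrow> real set" where
  "bad Z xs ys = {y. \<exists>t\<in>Z. cdet (homotopy (upd y) t) (xs @ [j]) = 0 \<and>
                            cdet (homotopy (upd y) t) (ys @ [j]) = 0}"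

lemma finite_bad:
  assumes "finite Z" "length xs = k" "length ys = k" "j \<notin> set xs" "j \<notin> set ys"
    and "\<And>t. t \<in> Z \<Longrightarrow> t \<noteq> 0 \<and> (cdet (homotopy E t) xs \<noteq> 0 \<or> cdet (homotopy E t) ys \<noteq> 0)"
  shows "finite (bad Z xs ys)"
  unfolding bad_def cdet_upd[OF assms(2,4)] cdet_upd[OF assms(3,5)]
  by (rule finite_common_solutions[OF assms(1,6)])

definition elim :: "nat list \<Rightarrow> nat \<Rightarrow> nat \<Rightarrow> real poly" where
  "elim R v w = rest (R @ [v]) * cpoly moment E (R @ [w]) - rest (R @ [w]) * cpoly moment E (R @ [v])"

lemma elim_zero:
  assumes "length R = k - 1" "j \<notin> set (R @ [v, w])"
    and "cdet (homotopy (upd y) t) (R @ [v, j]) = 0" "cdet (homotopy (upd y) t) (R @ [w, j]) = 0"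
  shows "poly (elim R v w) t = 0"
proof -
  let ?D = "cdet (homotopy E t)" and ?c = "moment k j + t * y"
  have "poly (rest (R @ [v])) t + ?c * ?D (R @ [v]) = 0" "poly (rest (R @ [w])) t + ?c * ?D (R @ [w]) = 0"
    using assms k cdet_upd[of "R @ [v]" y t] cdet_upd[of "R @ [w]" y t] by auto
  then have "poly (rest (R @ [v])) t = - ?c * ?D (R @ [v])" "poly (rest (R @ [w])) t = - ?c * ?D (R @ [w])"
    by linarith+
  then show ?thesis
    by (simp add: elim_def cdet_homotopy)
qed

lemma elim_0:
  assumes "length R = k - 1" "distinct (R @ [v, w, j])"
  shows "poly (elim R v w) 0 \<noteq> 0"
proof -
  define P where "P x = (\<Prod>r\<in>set R. real x - real r)" for x
  have P: "P x \<noteq> 0" if "x \<notin> set R" for x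
    using that unfolding P_def by auto
  let ?D = "cdet moment"
  have rest: "poly (rest (R @ [x])) 0 = ?D (R @ [x, j]) - moment k j * ?D (R @ [x])"
    if "x \<noteq> j" for x
    using cdet_upd[of "R @ [x]" 0 0] that assms k by (simp add: cdet_homotopy_0)
  have one: "?D (R @ [x]) = ?D R * P x" if "x \<in> {v, w}" for x
    using vandermonde_snoc[of R x] assms by (simp add: P_def)
  have two: "?D (R @ [x, j]) = ?D R * P x * (P j * (real j - real x))" if "x \<in> {v, w}" for x
    using vandermonde_snoc[of "R @ [x]" j] one[OF that] that assms by (auto simp: P_def)
  have "poly (elim R v w) 0 = ?D (R @ [v, j]) * ?D (R @ [w]) - ?D (R @ [w, j]) * ?D (R @ [v])"
  proof -
    have "v \<noteq> j" "w \<noteq> j" using assms(2) by auto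
    then show ?thesis
      unfolding elim_def poly_diff poly_mult cdet_homotopy[symmetric] cdet_homotopy_0
      by (simp add: rest algebra_simps)
  qed
  also have "\<dots> = ?D R * ?D R * P v * P w * P j * (real w - real v)"
    unfolding one[of v, simplified] one[of w, simplified] two[of v, simplified] two[of w, simplified]
    by (simp add: algebra_simps)
  also have "\<dots> \<noteq> 0"
    using P assms vandermonde_nonzero[of R] by simp
  finally show ?thesis .
qed

lemma finite_bad_values: "finite {y. \<not> generic_upto (upd y) n k (Suc j)}"
proof -
  let ?D = "\<lambda>y t xs. cdet (homotopy (upd y) t) xs" and ?B = "\<lambda>t xs. cdet (homotopy E t) xs"
  define L where "L l = {xs. set xs \<subseteq> {..<n} \<and> length xs = l}" for l
  have L: "finite (L l)" for l
    unfolding L_def by (rule finite_lists_length_eq) simp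
  define B1 where "B1 = (\<Union>xs\<in>L k. \<Union>v\<in>{v. v < n \<and> distinct (xs @ [v, j]) \<and> set (xs @ [v]) \<subseteq> {..<j}}.
    bad {t. ?B t (xs @ [v]) = 0} xs xs)"
  define B2 where "B2 = (\<Union>R\<in>L (k - 1). \<Union>v\<in>{..<n}. \<Union>w\<in>{w. w < n \<and> distinct (R @ [v, w, j])}.
    bad {t. poly (elim R v w) t = 0} (R @ [v]) (R @ [w]))"
  define B3 where "B3 = (\<Union>R\<in>L (k - 1). \<Union>w\<in>{w. w < n \<and> distinct (R @ [w, j])}.
    bad {t. ?B t (R @ [j]) = 0} (R @ [w]) (R @ [w]))"
  define B4 where "B4 = (\<Union>R\<in>{R\<in>L k. distinct (R @ [j])}. bad {1} R R)"
  have "finite B1"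
    unfolding B1_def
  proof (intro finite_UN_I L)
    fix xs v assume xs: "xs \<in> L k" and v: "v \<in> {v. v < n \<and> distinct (xs @ [v, j]) \<and> set (xs @ [v]) \<subseteq> {..<j}}"
    show "finite (bad {t. ?B t (xs @ [v]) = 0} xs xs)"
    proof (rule finite_bad)
      fix t assume "t \<in> {t. ?B t (xs @ [v]) = 0}"
      then show "t \<noteq> 0 \<and> (?B t xs \<noteq> 0 \<or> ?B t xs \<noteq> 0)"
        using v xs homotopy_zero_nonzero[of "xs @ [v]" E t] generic_uptoD(2)[OF same, of xs v t]
        by (auto simp: L_def)
    qed (use xs v finite_homotopy_zeros[of "xs @ [v]" E] in \<open>auto simp: L_def\<close>)
  qed auto
  moreover have "finite B2"
    unfolding B2_def
  proof (intro finite_UN_I L)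
    fix R v w assume R: "R \<in> L (k - 1)" "v \<in> {..<n}" and w: "w \<in> {w. w < n \<and> distinct (R @ [v, w, j])}"
    have nz: "poly (elim R v w) 0 \<noteq> 0"
      using R w by (intro elim_0) (auto simp: L_def)
    then have "elim R v w \<noteq> 0" by auto
    then have fin: "finite {t. poly (elim R v w) t = 0}" by (rule poly_roots_finite)
    show "finite (bad {t. poly (elim R v w) t = 0} (R @ [v]) (R @ [w]))"
    proof (rule finite_bad[OF fin])
      fix t assume "t \<in> {t. poly (elim R v w) t = 0}"
      then show "t \<noteq> 0 \<and> (?B t (R @ [v]) \<noteq> 0 \<or> ?B t (R @ [w]) \<noteq> 0)"
        using nz R w generic_uptoD(1)[OF lower, of R v w t] by (auto simp: L_def)
    qed (use R w k in \<open>auto simp: L_def\<close>)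
  qed auto
  moreover have "finite B3"
    unfolding B3_def
  proof (intro finite_UN_I L)
    fix R w assume R: "R \<in> L (k - 1)" and w: "w \<in> {w. w < n \<and> distinct (R @ [w, j])}"
    show "finite (bad {t. ?B t (R @ [j]) = 0} (R @ [w]) (R @ [w]))"
    proof (rule finite_bad)
      fix t assume "t \<in> {t. ?B t (R @ [j]) = 0}"
      then show "t \<noteq> 0 \<and> (?B t (R @ [w]) \<noteq> 0 \<or> ?B t (R @ [w]) \<noteq> 0)"
        using R w j homotopy_zero_nonzero[of "R @ [j]" E t] generic_uptoD(1)[OF lower, of R j w t]
        by (auto simp: L_def)
    qed (use R w k finite_homotopy_zeros[of "R @ [j]" E] in \<open>auto simp: L_def\<close>)
  qed auto
  moreover have "finite B4"
    unfolding B4_def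
  proof (intro finite_UN_I)
    fix R assume R: "R \<in> {R\<in>L k. distinct (R @ [j])}"
    show "finite (bad {1} R R)"
    proof (rule finite_bad)
      fix t :: real assume "t \<in> {1}"
      then show "t \<noteq> 0 \<and> (?B t R \<noteq> 0 \<or> ?B t R \<noteq> 0)"
        using R k generic_uptoD(3)[OF lower, of R] by (auto simp: L_def)
    qed (use R in \<open>auto simp: L_def\<close>)
  qed (use L[of k] in auto)
  moreover have "generic_upto (upd y) n k (Suc j)" if y: "y \<notin> B1" "y \<notin> B2" "y \<notin> B3" "y \<notin> B4" for y
  proof -
    have part: "mset xs = mset (remove1 j xs @ [j])" "set (remove1 j xs) = set xs - {j}"
      "distinct (remove1 j xs)" "length (remove1 j xs) = length xs - 1"
      if "j \<in> set xs" "distinct xs" for xs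
      using that by (auto simp: set_remove1_eq distinct_remove1 length_remove1)
    have G1: "?D y t (xs @ [v]) \<noteq> 0 \<or> ?D y t (xs @ [j]) \<noteq> 0"
      if "length xs = k" "distinct (xs @ [v, j])" "set (xs @ [v]) \<subseteq> {..<Suc j}" for xs v t
    proof -
      have "v \<noteq> j" "j \<notin> set xs" using that(2) by auto
      then have sub: "set (xs @ [v]) \<subseteq> {..<j}" using that by (auto simp: less_Suc_eq)
      then have "xs \<in> L k" "v < n" using that j by (auto simp: L_def)
      then show ?thesis
        using y(1) sub that \<open>v \<noteq> j\<close> \<open>j \<notin> set xs\<close> cdet_upd_other[of "xs @ [v]" y t]
        unfolding B1_def bad_def by auto
    qed
    have "?D y t (xs @ [v]) \<noteq> 0 \<or> ?D y t (xs @ [w]) \<noteq> 0"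
      if xs: "length xs = k" "distinct (xs @ [v, w])" "set (xs @ [v, w]) \<subseteq> {..<Suc j}" for xs v w t
    proof -
      consider "j \<notin> set (xs @ [v, w])" | "j = v" | "j = w" | "j \<in> set xs" by auto
      then show ?thesis
      proof cases
        case 1
        then have "set (xs @ [v, w]) \<subseteq> {..<j}" using xs(3) by (auto simp: less_Suc_eq)
        then show ?thesis
          using 1 xs generic_uptoD(1)[OF same, of xs v w t]
            cdet_upd_other[of "xs @ [v]" y t] cdet_upd_other[of "xs @ [w]" y t] by auto
      next
        case 2
        then show ?thesis using G1[of xs w t] xs by auto
      next
        case 3
        then show ?thesis using G1[of xs v t] xs by auto
      next
        case 4
        let ?R = "remove1 j xs"
        note R = part[OF 4]
        have dist: "distinct xs" using xs(2) by simp
        have RL: "?R \<in> L (k - 1)" "v < n" "w < n" "distinct (?R @ [v, w, j])"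
          using xs R[OF dist] j 4 by (auto simp: L_def)
        have "?D y t (xs @ [u]) = 0 \<longleftrightarrow> ?D y t (?R @ [u, j]) = 0" for u
          by (rule cdet_eq_0_mset) (use R(1)[OF dist] in simp)
        moreover have "y \<notin> bad {t. poly (elim ?R v w) t = 0} (?R @ [v]) (?R @ [w])"
          using y(2) RL unfolding B2_def by auto
        moreover have "length ?R = k - 1" "j \<notin> set (?R @ [v, w])"
          using RL by (auto simp: L_def)
        ultimately show ?thesis
          using elim_zero[of ?R v w y t] unfolding bad_def by auto
      qed
    qed
    moreover have "?D y t xs \<noteq> 0 \<or> ?D y t (xs @ [w]) \<noteq> 0"
      if xs: "length xs = k" "distinct (xs @ [w])" "set xs \<subseteq> {..<Suc j}" "w < n" for xs w t
    proof (cases "j \<in> set xs")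
      case False
      then have sub: "set xs \<subseteq> {..<j}" using xs(3) by (auto simp: less_Suc_eq)
      show ?thesis
      proof (cases "w = j")
        case True
        have upd_E: "upd (E k j) = E" by auto
        show ?thesis
          using generic_uptoD(2)[OF same, of xs w t] xs sub True False
            cdet_upd[of xs y t] cdet_upd[of xs "E k j" t] cdet_upd_other[of xs y t]
          unfolding upd_E by auto
      next
        case w: False
        then show ?thesis
          using generic_uptoD(2)[OF same, of xs w t] xs sub False
            cdet_upd_other[of xs y t] cdet_upd_other[of "xs @ [w]" y t] by auto
      qed
    next
      case True
      let ?R = "remove1 j xs"
      have dist: "distinct xs" using xs(2) by simp
      note R = part[OF True dist]
      have RL: "?R \<in> L (k - 1)" "distinct (?R @ [w, j])"
        using xs R j True by (auto simp: L_def)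
      have "?D y t (xs @ [w]) = 0 \<longleftrightarrow> ?D y t (?R @ [w, j]) = 0" "?D y t xs = 0 \<longleftrightarrow> ?D y t (?R @ [j]) = 0"
        by (rule cdet_eq_0_mset; use R(1) in simp)+
      then show ?thesis
        using y(3) RL xs(4) k cdet_upd_short[of "?R @ [j]" y t] unfolding B3_def bad_def
        by (auto simp: L_def)
    qed
    moreover have "?D y 1 xs \<noteq> 0"
      if xs: "length xs = Suc k" "distinct xs" "set xs \<subseteq> {..<Suc j}" for xs
    proof (cases "j \<in> set xs")
      case False
      then have sub: "set xs \<subseteq> {..<j}" using xs(3) by (auto simp: less_Suc_eq)
      then show ?thesis
        using generic_uptoD(3)[OF same, of xs] xs False cdet_upd_other[of xs y 1] by auto
    next
      case True
      let ?R = "remove1 j xs"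
      note R = part[OF True xs(2)]
      have RL: "?R \<in> L k" "distinct (?R @ [j])"
        using xs R j True by (auto simp: L_def)
      have "?D y 1 xs = 0 \<longleftrightarrow> ?D y 1 (?R @ [j]) = 0"
        by (rule cdet_eq_0_mset) (use R(1) in simp)
      then show ?thesis
        using y(4) RL unfolding B4_def bad_def by auto
    qed
    ultimately show ?thesis unfolding generic_upto_def by blast
  qed
  then have "{y. \<not> generic_upto (upd y) n k (Suc j)} \<subseteq> B1 \<union> B2 \<union> B3 \<union> B4" by blast
  ultimately show ?thesis by (meson finite_UnI finite_subset)
qed

end

lemma generic_upto_fixed:
  assumes "\<And>i l. l \<le> m \<Longrightarrow> E i l = 0"
  shows "generic_upto E n k (Suc m)"
proof -
  have "cdet (homotopy E t) xs \<noteq> 0" if "distinct xs" "set xs \<subseteq> {..<Suc m}" for xs t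
  proof -
    have "cdet (homotopy E t) xs = cdet moment xs"
      using assms that by (intro cdet_cong) (auto simp: homotopy_def less_Suc_eq_le subset_iff)
    then show ?thesis using vandermonde_nonzero that by metis
  qed
  then show ?thesis unfolding generic_upto_def by auto
qed

lemma generic_row:
  assumes "k \<ge> 1" "generic_upto E n (k - 1) n" "\<And>i l. l \<le> m \<Longrightarrow> E i l = 0" "\<epsilon> > 0" "Suc m + d \<le> n"
  shows "\<exists>e. (\<forall>l. \<bar>e l - E k l\<bar> < \<epsilon>) \<and> (\<forall>l\<le>m. e l = 0) \<and> generic_upto (E(k := e)) n k (Suc m + d)"
  using assms(5)
proof (induction d)
  case 0
  then show ?case
    using generic_upto_fixed[OF assms(3)] assms(3,4) by (intro exI[of _ "E k"]) auto
next
  case (Suc d)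
  then obtain e where e: "\<forall>l. \<bar>e l - E k l\<bar> < \<epsilon>" "\<forall>l\<le>m. e l = 0"
    "generic_upto (E(k := e)) n k (Suc m + d)" by (metis Suc_leD add_Suc_right)
  let ?j = "Suc m + d" and ?E = "E(k := e)"
  have "generic_upto ?E n (k - 1) n"
    by (rule generic_upto_cong[OF assms(2)]) (use assms(1) in auto)
  then interpret one_entry ?E n k ?j
    using assms(1) Suc.prems e(3) by unfold_locales auto
  have "infinite {E k ?j - \<epsilon><..<E k ?j + \<epsilon>}"
    using assms(4) by (intro infinite_Ioo) simp
  then obtain y where y: "y \<in> {E k ?j - \<epsilon><..<E k ?j + \<epsilon>}" "generic_upto (upd y) n k (Suc ?j)"
    using finite_bad_values by (metis (mono_tags, lifting) finite_subset mem_Collect_eq subsetI)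
  have "upd y = E(k := e(?j := y))" by auto
  then have "generic_upto (E(k := e(?j := y))) n k (Suc m + Suc d)"
    using y(2) by simp
  moreover have "\<forall>l. \<bar>(e(?j := y)) l - E k l\<bar> < \<epsilon>" "\<forall>l\<le>m. (e(?j := y)) l = 0"
    using y(1) e by auto
  ultimately show ?case by blast
qed

lemma generic_perturbation:
  assumes "\<And>i l. l \<le> m \<Longrightarrow> E i l = 0" "\<And>l. E 0 l = 0" "\<epsilon> > 0" "m < n"
  shows "\<exists>E'. (\<forall>i l. \<bar>E' i l - E i l\<bar> < \<epsilon>) \<and> (\<forall>i l. l \<le> m \<longrightarrow> E' i l = 0) \<and>
    (\<forall>l. E' 0 l = 0) \<and> generic_upto E' n k n"
proof -
  have "\<exists>E'. (\<forall>i l. \<bar>E' i l - E i l\<bar> < \<epsilon>) \<and> (\<forall>i l. l \<le> m \<longrightarrow> E' i l = 0) \<and>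
    (\<forall>l. E' 0 l = 0) \<and> (\<forall>i>k. E' i = E i) \<and> generic_upto E' n k n"
  proof (induction k)
    case 0
    have "cdet (homotopy E t) xs = 1" if "length xs = Suc 0" for t xs
      using that assms(2) cdet_expand_last_row[of xs 0 "homotopy E t"]
      by (simp add: homotopy_def moment_def)
    then have "generic_upto E n 0 n"
      unfolding generic_upto_def by auto
    then show ?case using assms by (intro exI[of _ E]) auto
  next
    case (Suc k)
    then obtain E' where E': "\<forall>i l. \<bar>E' i l - E i l\<bar> < \<epsilon>" "\<forall>i l. l \<le> m \<longrightarrow> E' i l = 0"
      "\<forall>l. E' 0 l = 0" "\<forall>i>k. E' i = E i" "generic_upto E' n k n" by blast
    obtain e where e: "\<forall>l. \<bar>e l - E' (Suc k) l\<bar> < \<epsilon>" "\<forall>l\<le>m. e l = 0"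
      "generic_upto (E'(Suc k := e)) n (Suc k) (Suc m + (n - Suc m))"
      using generic_row[of "Suc k" E' n m \<epsilon> "n - Suc m"] E' assms by auto
    have "\<bar>(E'(Suc k := e)) i l - E i l\<bar> < \<epsilon>" for i l
      using E' e(1) by auto
    moreover have "\<forall>i l. l \<le> m \<longrightarrow> (E'(Suc k := e)) i l = 0" "\<forall>l. (E'(Suc k := e)) 0 l = 0"
      "\<forall>i>Suc k. (E'(Suc k := e)) i = E i"
      using E' e(2) by auto
    moreover have "generic_upto (E'(Suc k := e)) n (Suc k) n"
      using e(3) assms(4) by simp
    ultimately show ?case by blast
  qed
  then show ?thesis by blast
qed

section \<open>Affine dependencies and intersection numbers\<close>

lemma sorted_list_remove_nth:
  assumes "finite L" "j < card L"
  shows "card {x\<in>L. x < sorted_list_of_set L ! j} = j"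
    and "take j (sorted_list_of_set L) @ drop (Suc j) (sorted_list_of_set L)
      = sorted_list_of_set (L - {sorted_list_of_set L ! j})"
proof -
  let ?xs = "sorted_list_of_set L"
  have len: "length ?xs = card L" and dist: "distinct ?xs" and set: "set ?xs = L"
    and sorted: "sorted_wrt (<) ?xs"
    using assms by auto
  have split: "?xs = take j ?xs @ ?xs ! j # drop (Suc j) ?xs"
    using assms(2) len by (simp add: id_take_nth_drop)
  have sorted': "sorted_wrt (<) (take j ?xs @ ?xs ! j # drop (Suc j) ?xs)"
    using sorted split by simp
  have set': "L = set (take j ?xs) \<union> {?xs ! j} \<union> set (drop (Suc j) ?xs)"
    using arg_cong[OF split, of set] set by auto
  have "{x\<in>L. x < ?xs ! j} = set (take j ?xs)"
  proof (intro equalityI subsetI)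
    fix x assume x: "x \<in> {x\<in>L. x < ?xs ! j}"
    then have "x \<in> set (take j ?xs) \<union> {?xs ! j} \<union> set (drop (Suc j) ?xs)"
      using set' by blast
    then show "x \<in> set (take j ?xs)"
      using x sorted' by (auto simp: sorted_wrt_append dest: less_asym)
  next
    fix x assume "x \<in> set (take j ?xs)"
    then show "x \<in> {x\<in>L. x < ?xs ! j}"
      using set' sorted' by (auto simp: sorted_wrt_append)
  qed
  then show "card {x\<in>L. x < ?xs ! j} = j"
    using dist assms(2) len by (simp add: distinct_card)
  have "set (take j ?xs @ drop (Suc j) ?xs) = L - {?xs ! j}"
    using set' sorted' by (auto simp: sorted_wrt_append)
  moreover have "sorted_wrt (<) (take j ?xs @ drop (Suc j) ?xs)"
    using sorted' by (auto simp: sorted_wrt_append)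
  ultimately show "take j ?xs @ drop (Suc j) ?xs = sorted_list_of_set (L - {?xs ! j})"
    using assms(1) by (intro strict_sorted_equal) auto
qed

lemma prod_sgn_diff:
  fixes A :: "nat set"
  assumes "finite A" "v \<notin> A"
  shows "(\<Prod>x\<in>A. sgn (int v - int x)) = (-1) ^ card {x\<in>A. v < x}"
    and "(\<Prod>x\<in>A. sgn (int x - int v)) = (-1) ^ card {x\<in>A. x < v}"
    and "card {x\<in>A. v < x} + card {x\<in>A. x < v} = card A"
proof -
  have "(\<Prod>x\<in>A. sgn (int v - int x)) = (\<Prod>x\<in>A. if v < x then -1 else 1)"
    using assms by (intro prod.cong) (auto simp: sgn_if)
  also have "\<dots> = (\<Prod>x\<in>{x\<in>A. v < x}. -1)"
    using assms by (simp add: prod.If_cases Int_def)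
  finally show "(\<Prod>x\<in>A. sgn (int v - int x)) = (-1) ^ card {x\<in>A. v < x}" by simp
  have "(\<Prod>x\<in>A. sgn (int x - int v)) = (\<Prod>x\<in>A. if x < v then -1 else 1)"
    using assms by (intro prod.cong) (auto simp: sgn_if)
  also have "\<dots> = (\<Prod>x\<in>{x\<in>A. x < v}. -1)"
    using assms by (simp add: prod.If_cases Int_def)
  finally show "(\<Prod>x\<in>A. sgn (int x - int v)) = (-1) ^ card {x\<in>A. x < v}" by simp
  have "{x\<in>A. v < x} \<union> {x\<in>A. x < v} = A"
    using assms by auto (metis linorder_neqE_nat)
  moreover have "{x\<in>A. v < x} \<inter> {x\<in>A. x < v} = {}" by auto
  ultimately show "card {x\<in>A. v < x} + card {x\<in>A. x < v} = card A"
    using assms card_Un_disjoint[of "{x\<in>A. v < x}" "{x\<in>A. x < v}"] by simp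
qed

lemma card_less_Un:
  assumes "finite A" "finite B" "A \<inter> B = {}"
  shows "card {x\<in>A \<union> B. x < v} = card {x\<in>A. x < v} + card {x\<in>B. x < (v :: nat)}"
proof -
  have "{x\<in>A \<union> B. x < v} = {x\<in>A. x < v} \<union> {x\<in>B. x < v}" by auto
  then show ?thesis using assms by (simp add: card_Un_disjoint disjoint_iff)
qed

lemma shuffle_sign_remove_left:
  assumes "finite A" "finite B" "A \<inter> B = {}" "v \<in> A"
  shows "shuffle_sign (A - {v}, B) = shuffle_sign (A, B) * (-1) ^ card {x\<in>B. x < v}"
proof -
  have "shuffle_sign (A, B) = (\<Prod>y\<in>B. sgn (int y - int v)) * shuffle_sign (A - {v}, B)"
    using assms by (subst (1 2) shuffle_sign_eq) (auto simp: prod.remove)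
  moreover have "v \<notin> B" using assms by auto
  ultimately show ?thesis
    using prod_sgn_diff(2)[OF assms(2)] by (simp flip: power_add mult_2)
qed

lemma shuffle_sign_remove_right:
  assumes "finite A" "finite B" "A \<inter> B = {}" "v \<in> B"
  shows "shuffle_sign (A, B - {v}) = shuffle_sign (A, B) * (-1) ^ card {x\<in>A. v < x}"
proof -
  have "shuffle_sign (A, B) = (\<Prod>x\<in>A. sgn (int v - int x) * (\<Prod>y\<in>B - {v}. sgn (int y - int x)))"
    using assms by (subst shuffle_sign_eq) (auto simp: prod.remove)
  also have "\<dots> = (\<Prod>x\<in>A. sgn (int v - int x)) * shuffle_sign (A, B - {v})"
    using assms by (subst shuffle_sign_eq) (auto simp: prod.distrib)
  finally have "shuffle_sign (A, B) = (\<Prod>x\<in>A. sgn (int v - int x)) * shuffle_sign (A, B - {v})" .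
  moreover have "v \<notin> A" using assms by auto
  ultimately show ?thesis
    using prod_sgn_diff(1)[OF assms(1)] by (simp flip: power_add mult_2)
qed

lemma shuffle_sign_swap:
  assumes "finite A" "finite B" "A \<inter> B = {}"
  shows "shuffle_sign (B, A) = (-1) ^ (card A * card B) * shuffle_sign (A, B)"
proof -
  have "shuffle_sign (B, A) = (\<Prod>y\<in>B. \<Prod>x\<in>A. - sgn (int y - int x))"
    using assms by (subst shuffle_sign_eq) (auto intro!: prod.cong simp: sgn_if)
  also have "\<dots> = (\<Prod>y\<in>B. (-1) ^ card A * (\<Prod>x\<in>A. sgn (int y - int x)))"
    by (simp add: prod_uminus)
  also have "\<dots> = (-1) ^ (card A * card B) * (\<Prod>y\<in>B. \<Prod>x\<in>A. sgn (int y - int x))"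
    by (simp add: prod.distrib power_mult)
  also have "(\<Prod>y\<in>B. \<Prod>x\<in>A. sgn (int y - int x)) = shuffle_sign (A, B)"
    using assms by (subst shuffle_sign_eq) (auto intro: prod.swap)
  finally show ?thesis .
qed

lemma shuffle_sign_pm:
  assumes "finite A" "finite B" "A \<inter> B = {}"
  shows "shuffle_sign (A, B) = 1 \<or> shuffle_sign (A, B) = -1"
proof -
  have "\<bar>shuffle_sign (A, B)\<bar> = (\<Prod>x\<in>A. \<Prod>y\<in>B. \<bar>sgn (int y - int x)\<bar>)"
    using assms by (simp add: shuffle_sign_eq abs_prod)
  also have "\<dots> = 1"
    using assms by (intro prod.neutral ballI) (auto simp: sgn_if)
  finally show ?thesis by linarith
qed

definition cofactor_vec :: "(nat \<Rightarrow> nat \<Rightarrow> real) \<Rightarrow> nat set \<Rightarrow> nat \<Rightarrow> real" where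
  "cofactor_vec V L v = (-1) ^ card {x\<in>L. x < v} * cdet V (sorted_list_of_set (L - {v}))"

lemma cofactor_vec_relation:
  assumes "finite L" "card L = m + 2" "r \<le> m"
  shows "(\<Sum>v\<in>L. cofactor_vec V L v * V r v) = 0"
proof -
  let ?xs = "sorted_list_of_set L"
  have bij: "bij_betw ((!) ?xs) {..<card L} L"
    using assms by (intro bij_betw_nth) auto
  have "(\<Sum>v\<in>L. cofactor_vec V L v * V r v)
      = (\<Sum>j<card L. cofactor_vec V L (?xs ! j) * V r (?xs ! j))"
    by (rule sum.reindex_bij_betw[OF bij, symmetric])
  also have "\<dots> = (\<Sum>j<Suc (Suc m). V r (?xs ! j) * ((-1) ^ j * cdet V (take j ?xs @ drop (Suc j) ?xs)))"
    using assms by (intro sum.cong) (auto simp: cofactor_vec_def sorted_list_remove_nth)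
  also have "\<dots> = 0"
    using assms by (intro cdet_relation) auto
  finally show ?thesis .
qed

lemma dependency_unique:
  assumes L: "finite L" "card L = m + 2"
    and dep: "\<And>r. r \<le> m \<Longrightarrow> (\<Sum>v\<in>L. b v * V r v) = 0"
    and u: "u \<in> L" "cofactor_vec V L u \<noteq> 0" and x: "x \<in> L"
  shows "b x * cofactor_vec V L u = b u * cofactor_vec V L x"
proof -
  define d where "d x = b x * cofactor_vec V L u - b u * cofactor_vec V L x" for x
  have "(\<Sum>v\<in>L - {u}. d v * V r v) = 0" if "r \<le> m" for r
  proof -
    have "(\<Sum>v\<in>L. d v * V r v)
        = (\<Sum>v\<in>L. b v * V r v) * cofactor_vec V L u - b u * (\<Sum>v\<in>L. cofactor_vec V L v * V r v)"
      unfolding d_def sum_distrib_left sum_distrib_right sum_subtractf[symmetric]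
      by (intro sum.cong) (auto simp: algebra_simps)
    then have "(\<Sum>v\<in>L. d v * V r v) = 0"
      using dep[OF that] cofactor_vec_relation[OF L that, of V] by simp
    then show ?thesis
      using L(1) u(1) by (simp add: sum.remove d_def)
  qed
  then have "\<forall>x\<in>set (sorted_list_of_set (L - {u})). d x = 0"
    using L u by (intro cdet_kernel_trivial[of V]) (auto simp: cofactor_vec_def)
  then show ?thesis
    using x L(1) by (cases "x = u") (auto simp: d_def)
qed

definition split_sign :: "(nat \<Rightarrow> real) \<Rightarrow> nat set \<Rightarrow> nat set \<Rightarrow> int" where
  "split_sign a A B =
    (if (\<forall>x\<in>A. a x > 0) \<and> (\<forall>x\<in>B. a x < 0) then 1
     else if (\<forall>x\<in>A. a x < 0) \<and> (\<forall>x\<in>B. a x > 0) then -1 else 0)"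

lemma det_first_column_sum:
  fixes V :: "nat \<Rightarrow> nat \<Rightarrow> 'a :: comm_ring_1"
  assumes "length zs = n"
  shows "det (mat (Suc n) (Suc n) (\<lambda>(i, j). if j = 0 then \<Sum>v\<in>S. w v * V i v else V i (zs ! (j - 1))))
    = (\<Sum>v\<in>S. w v * cdet V (v # zs))"
proof -
  define A where "A c = mat (Suc n) (Suc n) (\<lambda>(i, j). if j = 0 then c i else V i (zs ! (j - 1)))"
    for c :: "nat \<Rightarrow> 'a"
  define k where "k i = cofactor (A (\<lambda>_. 0)) i 0" for i
  have det_A: "det (A c) = (\<Sum>i<Suc n. c i * k i)" for c
  proof -
    have "det (A c) = (\<Sum>i<Suc n. A c $$ (i, 0) * cofactor (A c) i 0)"
      by (rule laplace_expansion_column) (auto simp: A_def)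
    also have "\<dots> = (\<Sum>i<Suc n. c i * k i)"
    proof (rule sum.cong[OF refl])
      fix i assume i: "i \<in> {..<Suc n}"
      have "mat_delete (A c) i 0 = mat_delete (A (\<lambda>_. 0)) i 0"
        unfolding mat_delete_def A_def by (rule eq_matI) auto
      then show "A c $$ (i, 0) * cofactor (A c) i 0 = c i * k i"
        using i unfolding k_def cofactor_def by (simp add: A_def)
    qed
    finally show ?thesis .
  qed
  have "A (\<lambda>i. V i v) = mat (Suc n) (Suc n) (\<lambda>(i, j). V i ((v # zs) ! j))" for v
    unfolding A_def by (rule eq_matI) (auto simp: nth_Cons')
  then have "cdet V (v # zs) = (\<Sum>i<Suc n. V i v * k i)" for v
    using det_A[of "\<lambda>i. V i v"] assms by (simp add: cdet_def)
  then have "(\<Sum>v\<in>S. w v * cdet V (v # zs)) = (\<Sum>v\<in>S. \<Sum>i<Suc n. w v * V i v * k i)"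
    by (simp add: sum_distrib_left mult.assoc del: sum.lessThan_Suc)
  also have "\<dots> = (\<Sum>i<Suc n. (\<Sum>v\<in>S. w v * V i v) * k i)"
    by (subst sum.swap) (simp add: sum_distrib_right)
  also have "\<dots> = det (A (\<lambda>i. \<Sum>v\<in>S. w v * V i v))"
    unfolding det_A ..
  finally show ?thesis unfolding A_def ..
qed

lemma conv_imageI:
  assumes "\<forall>v\<in>\<sigma>. 0 \<le> w v" "(\<Sum>v\<in>\<sigma>. w v) = 1"
  shows "vec m (\<lambda>k. \<Sum>v\<in>\<sigma>. w v * f v $ k) \<in> conv_image m f \<sigma>"
  unfolding conv_image_def using assms by blast

lemma cdet_Cons_repeated:
  assumes "v \<in> set zs"
  shows "cdet V (v # zs) = 0"
proof -
  obtain k where "k < length zs" "zs ! k = v" using assms by (metis in_set_conv_nth)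
  then show ?thesis
    unfolding cdet_def
    by (intro det_identical_columns[of _ "length (v # zs)" 0 "Suc k"]) (auto intro!: eq_vecI)
qed

context
  fixes m :: nat and f :: "nat \<Rightarrow> real vec" and V :: "nat \<Rightarrow> nat \<Rightarrow> real" and A B :: "nat set"
    and a :: "nat \<Rightarrow> real" and S :: real
  assumes f: "\<And>v. vCons 1 (f v) = vec (m + 1) (\<lambda>r. V r v)"
    and fin: "finite A" "finite B" and disj: "A \<inter> B = {}" and card: "card A + card B = m + 2"
    and ne: "A \<noteq> {}" "B \<noteq> {}"
    and nonzero: "\<And>v. v \<in> A \<union> B \<Longrightarrow> cofactor_vec V (A \<union> B) v \<noteq> 0"
  defines "a \<equiv> cofactor_vec V (A \<union> B)" and "S \<equiv> \<Sum>v\<in>A. a v"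
begin

private lemma L: "finite (A \<union> B)" "card (A \<union> B) = m + 2"
  using fin disj card by (auto simp: card_Un_disjoint)

private lemma row_0: "V 0 v = 1"
  using arg_cong[OF f[of v], of "\<lambda>x. x $ 0"] by simp

private lemma row_Suc: "k < m \<Longrightarrow> V (Suc k) v = f v $ k"
  using arg_cong[OF f[of v], of "\<lambda>x. x $ Suc k"] arg_cong[OF f[of v], of dim_vec] by simp

private lemma a_relation: "r \<le> m \<Longrightarrow> (\<Sum>v\<in>A. a v * V r v) = - (\<Sum>v\<in>B. a v * V r v)"
  using cofactor_vec_relation[OF L, of r V] fin disj
  by (simp add: a_def sum.union_disjoint eq_neg_iff_add_eq_0)

private lemma conv_inter:
  "conv_image m f A \<inter> conv_image m f B
    = (if split_sign a A B = 0 then {} else {vec m (\<lambda>k. \<Sum>v\<in>A. a v / S * f v $ k)})"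
proof -
  let ?P = "vec m (\<lambda>k. \<Sum>v\<in>A. a v / S * f v $ k)"
  have 1: "split_sign a A B \<noteq> 0 \<and> p = ?P" if p: "p \<in> conv_image m f A" "p \<in> conv_image m f B" for p
  proof -
    obtain w where w: "\<forall>v\<in>A. 0 \<le> w v" "(\<Sum>v\<in>A. w v) = 1" "p = vec m (\<lambda>k. \<Sum>v\<in>A. w v * f v $ k)"
      using p(1) by (auto simp: conv_image_def)
    obtain w' where w': "\<forall>v\<in>B. 0 \<le> w' v" "(\<Sum>v\<in>B. w' v) = 1" "p = vec m (\<lambda>k. \<Sum>v\<in>B. w' v * f v $ k)"
      using p(2) by (auto simp: conv_image_def)
    define b where "b v = (if v \<in> A then w v else - w' v)" for v
    have bA: "b v = w v" if "v \<in> A" for v using that by (simp add: b_def)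
    have bB: "b v = - w' v" if "v \<in> B" for v using that disj by (auto simp: b_def)
    have dep: "(\<Sum>v\<in>A \<union> B. b v * V r v) = 0" if "r \<le> m" for r
    proof -
      have "(\<Sum>v\<in>A \<union> B. b v * V r v) = (\<Sum>v\<in>A. w v * V r v) - (\<Sum>v\<in>B. w' v * V r v)"
        using fin disj by (simp add: sum.union_disjoint bA bB sum_negf)
      also have "\<dots> = 0"
      proof (cases r)
        case 0
        then show ?thesis using w(2) w'(2) by (simp add: row_0)
      next
        case (Suc k)
        then have "k < m" using that by simp
        then show ?thesis
          using arg_cong[OF w(3)[symmetric, unfolded w'(3)], of "\<lambda>x. x $ k"] Suc by (simp add: row_Suc)
      qed
      finally show ?thesis .
    qed
    obtain x0 where x0: "x0 \<in> A" "b x0 \<noteq> 0"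
      using w(2) bA by (metis sum.neutral zero_neq_one)
    define c where "c = b x0 / a x0"
    have b: "b x = c * a x" if "x \<in> A \<union> B" for x
      using dependency_unique[where b = b and V = V and u = x0 and x = x, OF L dep] x0 nonzero[of x0] that
      by (simp add: c_def a_def field_simps)
    have c: "c \<noteq> 0" using x0 b[of x0] by auto
    have a_nz: "a x \<noteq> 0" if "x \<in> A \<union> B" for x using nonzero that by (simp add: a_def)
    have pos: "c * a x > 0" if "x \<in> A" for x
    proof -
      have "0 \<le> c * a x" using b[of x] w(1) bA[OF that] that by fastforce
      then show ?thesis using c a_nz[of x] that by (simp add: less_le)
    qed
    have neg: "c * a x < 0" if "x \<in> B" for x
    proof -
      have "c * a x \<le> 0" using b[of x] w'(1) bB[OF that] that by fastforce
      then show ?thesis using c a_nz[of x] that by (simp add: less_le)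
    qed
    have "split_sign a A B \<noteq> 0"
    proof (cases "c > 0")
      case True
      then show ?thesis
        using pos neg by (auto simp: split_sign_def zero_less_mult_iff mult_less_0_iff)
    next
      case False
      then have "c < 0" using c by simp
      then have "(\<forall>x\<in>A. a x < 0) \<and> (\<forall>x\<in>B. a x > 0)"
        using pos neg by (auto simp: zero_less_mult_iff mult_less_0_iff)
      then show ?thesis by (simp add: split_sign_def)
    qed
    moreover have cS: "c * S = 1"
      using w(2) b bA by (simp add: S_def sum_distrib_left)
    have "w v = a v / S" if "v \<in> A" for v
    proof -
      have "w v * S = a v * (c * S)" using b[of v] bA[OF that] that by simp
      moreover have "S \<noteq> 0" using cS by auto
      ultimately show ?thesis using cS by (simp add: eq_divide_eq)
    qed
    then have "p = ?P" unfolding w(3) by simp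
    ultimately show ?thesis by blast
  qed
  have 2: "?P \<in> conv_image m f A" "?P \<in> conv_image m f B" if "split_sign a A B \<noteq> 0"
  proof -
    have "(\<forall>x\<in>A. a x > 0) \<and> (\<forall>x\<in>B. a x < 0) \<or> (\<forall>x\<in>A. a x < 0) \<and> (\<forall>x\<in>B. a x > 0)"
      using that by (auto simp: split_sign_def split: if_splits)
    then have S: "S \<noteq> 0" "\<forall>v\<in>A. 0 \<le> a v / S" "\<forall>v\<in>B. 0 \<le> - a v / S"
    proof -
      assume "(\<forall>x\<in>A. a x > 0) \<and> (\<forall>x\<in>B. a x < 0) \<or> (\<forall>x\<in>A. a x < 0) \<and> (\<forall>x\<in>B. a x > 0)"
      then show "S \<noteq> 0" "\<forall>v\<in>A. 0 \<le> a v / S" "\<forall>v\<in>B. 0 \<le> - a v / S"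
      proof (atomize (full), elim disjE conjE, goal_cases)
        case 1
        then have "S > 0" unfolding S_def using fin ne by (intro sum_pos) auto
        with 1 show ?case by (auto simp: divide_nonpos_pos less_imp_le)
      next
        case 2
        then have "- S > 0" unfolding S_def sum_negf[symmetric] using fin ne by (intro sum_pos) auto
        with 2 show ?case by (auto simp: divide_nonpos_neg divide_nonneg_neg less_imp_le)
      qed
    qed
    have "(\<Sum>v\<in>A. a v / S) = 1"
      using S(1) by (simp add: sum_divide_distrib[symmetric] S_def)
    then show "?P \<in> conv_image m f A"
      using conv_imageI[of A "\<lambda>v. a v / S"] S(2) by simp
    have "(\<Sum>v\<in>B. - a v / S) = 1"
      using S(1) a_relation[of 0] by (simp add: row_0 S_def sum_negf flip: sum_divide_distrib)
    then have "vec m (\<lambda>k. \<Sum>v\<in>B. - a v / S * f v $ k) \<in> conv_image m f B"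
      by (rule conv_imageI[OF S(3)])
    moreover have "?P = vec m (\<lambda>k. \<Sum>v\<in>B. - a v / S * f v $ k)"
    proof (rule eq_vecI)
      fix k assume "k < dim_vec (vec m (\<lambda>k. \<Sum>v\<in>B. - a v / S * f v $ k))"
      then have k: "k < m" by simp
      have "(\<Sum>v\<in>A. a v * f v $ k) / S = (\<Sum>v\<in>B. - a v * f v $ k) / S"
        using a_relation[of "Suc k"] k by (simp add: row_Suc sum_negf)
      then show "?P $ k = vec m (\<lambda>k. \<Sum>v\<in>B. - a v / S * f v $ k) $ k"
        using k by (simp add: sum_divide_distrib)
    qed simp
    ultimately show "?P \<in> conv_image m f B"
      by (simp only:)
  qed
  show ?thesis
  proof (cases "split_sign a A B = 0")
    case True
    then have "conv_image m f A \<inter> conv_image m f B = {}" using 1 by blast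
    then show ?thesis using True by simp
  next
    case False
    have "conv_image m f A \<inter> conv_image m f B = {?P}"
    proof (intro equalityI subsetI)
      fix p assume "p \<in> conv_image m f A \<inter> conv_image m f B"
      then show "p \<in> {?P}" using 1 by blast
    next
      fix p assume "p \<in> {?P}"
      then show "p \<in> conv_image m f A \<inter> conv_image m f B" using 2[OF False] by blast
    qed
    then show ?thesis using False by (simp only: if_False)
  qed
qed

lemma intersection_number_split_sign:
  "(-1) ^ sdim A * intersection_number m f A B = shuffle_sign (A, B) * split_sign a A B"
proof (cases "split_sign a A B = 0")
  case True
  then show ?thesis by (simp add: intersection_number_def conv_inter)
next
  case False
  define s where "s = Min A"
  define t where "t = Min B"
  let ?xs = "sorted_list_of_set A" and ?ys = "sorted_list_of_set B"
  let ?zs = "tl ?xs @ tl ?ys"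
  let ?P = "vec m (\<lambda>k. \<Sum>v\<in>A. a v / S * f v $ k)"
  have s: "s \<in> A" and t: "t \<in> B" using fin ne by (auto simp: s_def t_def)
  have xs: "?xs = s # tl ?xs" "tl ?xs = sorted_list_of_set (A - {s})"
    using fin ne sorted_list_of_set_nonempty[of A] by (auto simp: s_def)
  have ys: "?ys = t # tl ?ys" "tl ?ys = sorted_list_of_set (B - {t})"
    using fin ne sorted_list_of_set_nonempty[of B] by (auto simp: t_def)
  have len: "length ?zs = m"
    using card fin ne card_gt_0_iff[of A] card_gt_0_iff[of B] by simp
  have signs: "(\<forall>x\<in>A. a x > 0) \<and> (\<forall>x\<in>B. a x < 0) \<or> (\<forall>x\<in>A. a x < 0) \<and> (\<forall>x\<in>B. a x > 0)"
    using False by (auto simp: split_sign_def split: if_splits)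
  then have aS: "a s / S > 0"
  proof (elim disjE conjE)
    assume *: "\<forall>x\<in>A. a x > 0"
    then have "S > 0" unfolding S_def using fin ne by (intro sum_pos) auto
    then show ?thesis using * s by simp
  next
    assume *: "\<forall>x\<in>A. a x < 0"
    then have "- S > 0" unfolding S_def sum_negf[symmetric] using fin ne by (intro sum_pos) auto
    then show ?thesis using * s by (simp add: divide_neg_neg)
  qed
  have a_t: "sgn (a t) = - of_int (split_sign a A B)"
    using signs s t by (auto simp: split_sign_def)
  have S: "S \<noteq> 0" using aS by auto
  have first: "vCons 1 ?P = vec (m + 1) (\<lambda>r. \<Sum>v\<in>A. a v / S * V r v)"
  proof (rule eq_vecI)
    fix r assume "r < dim_vec (vec (m + 1) (\<lambda>r. \<Sum>v\<in>A. a v / S * V r v))"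
    then show "vCons 1 ?P $ r = vec (m + 1) (\<lambda>r. \<Sum>v\<in>A. a v / S * V r v) $ r"
      using S by (cases r) (auto simp: row_0 row_Suc S_def simp flip: sum_divide_distrib)
  qed simp
  have "mat_of_cols (m + 1) (map (vCons 1) (?P # map f (tl ?xs) @ map f (tl ?ys)))
      = mat (Suc m) (Suc m) (\<lambda>(i, j). if j = 0 then \<Sum>v\<in>A. a v / S * V i v else V i (?zs ! (j - 1)))"
  proof (rule eq_matI)
    fix i j
    assume "i < dim_row (mat (Suc m) (Suc m) (\<lambda>(i, j). if j = 0 then \<Sum>v\<in>A. a v / S * V i v else V i (?zs ! (j - 1))))"
      and "j < dim_col (mat (Suc m) (Suc m) (\<lambda>(i, j). if j = 0 then \<Sum>v\<in>A. a v / S * V i v else V i (?zs ! (j - 1))))"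
    then have ij: "i < Suc m" "j < Suc m" by auto
    have cols: "map (vCons 1) (?P # map f (tl ?xs) @ map f (tl ?ys)) = vCons 1 ?P # map (\<lambda>v. vCons 1 (f v)) ?zs"
      by simp
    show "mat_of_cols (m + 1) (map (vCons 1) (?P # map f (tl ?xs) @ map f (tl ?ys))) $$ (i, j)
      = mat (Suc m) (Suc m) (\<lambda>(i, j). if j = 0 then \<Sum>v\<in>A. a v / S * V i v else V i (?zs ! (j - 1))) $$ (i, j)"
      unfolding cols first f using ij len
      by (cases j) (auto simp: mat_of_cols_def nth_append)
  qed (use len in auto)
  then have "det (mat_of_cols (m + 1) (map (vCons 1) (?P # map f (tl ?xs) @ map f (tl ?ys))))
      = (\<Sum>v\<in>A. a v / S * cdet V (v # ?zs))"
    using det_first_column_sum[where S = A and w = "\<lambda>v. a v / S" and V = V, OF len] by simp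
  also have "\<dots> = a s / S * cdet V (s # ?zs)"
  proof -
    have "cdet V (v # ?zs) = 0" if "v \<in> A - {s}" for v
      using that xs fin by (intro cdet_Cons_repeated) auto
    then show ?thesis
      using fin s by (simp add: sum.remove[of A s])
  qed
  also have "s # ?zs = ?xs @ sorted_list_of_set (B - {t})"
    using xs ys by (metis append_Cons)
  also have "cdet V (?xs @ sorted_list_of_set (B - {t}))
      = of_int (shuffle_sign (A, B - {t})) * cdet V (sorted_list_of_set (A \<union> B - {t}))"
  proof -
    have "A \<union> (B - {t}) = A \<union> B - {t}" using t disj by auto
    then show ?thesis
      using cdet_shuffle[of A "B - {t}" V] fin disj by (metis Diff_disjoint Int_Diff finite_Diff empty_Diff)
  qed
  finally have det: "det (mat_of_cols (m + 1) (map (vCons 1) (?P # map f (tl ?xs) @ map f (tl ?ys))))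
    = a s / S * (of_int (shuffle_sign (A, B - {t})) * cdet V (sorted_list_of_set (A \<union> B - {t})))" .
  have "t \<notin> A" using t disj by auto
  have below: "card {x\<in>A \<union> B. x < t} = card {x\<in>A. x < t}"
  proof -
    have "{x\<in>B. x < t} = {}" using fin by (auto simp: t_def not_less)
    then show ?thesis unfolding card_less_Un[OF fin disj] by simp
  qed
  have "sgn (cdet V (sorted_list_of_set (A \<union> B - {t}))) = (-1) ^ card {x\<in>A. x < t} * sgn (a t)"
    unfolding a_def cofactor_vec_def below by (simp add: sgn_mult flip: power_add mult_2 mult.assoc)
  moreover have "sgn (real_of_int (shuffle_sign (A, B))) = of_int (shuffle_sign (A, B))"
    using shuffle_sign_pm[OF fin disj] by auto
  ultimately have "sgn (det (mat_of_cols (m + 1) (map (vCons 1) (?P # map f (tl ?xs) @ map f (tl ?ys)))))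
      = of_int (shuffle_sign (A, B) * ((-1) ^ card {x\<in>A. t < x} * (-1) ^ card {x\<in>A. x < t}) * - split_sign a A B)"
    unfolding det shuffle_sign_remove_right[OF fin disj t] sgn_mult sgn_pos[OF aS]
    using a_t by (simp add: sgn_mult)
  also have "(-1) ^ card {x\<in>A. t < x} * (-1) ^ card {x\<in>A. x < t} = (-1 :: int) ^ card A"
    using prod_sgn_diff(3)[OF fin(1) \<open>t \<notin> A\<close>] by (simp flip: power_add)
  finally have "\<lfloor>sgn (det (mat_of_cols (m + 1) (map (vCons 1) (?P # map f (tl ?xs) @ map f (tl ?ys)))))\<rfloor>
      = shuffle_sign (A, B) * (-1) ^ card A * - split_sign a A B"
    by (simp only: floor_of_int)
  then have "intersection_number m f A B = shuffle_sign (A, B) * (-1) ^ card A * - split_sign a A B"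
    using False unfolding intersection_number_def conv_inter by (simp add: Let_def)
  moreover have "card A = Suc (sdim A)"
    using fin ne card_gt_0_iff[of A] by (simp add: sdim_def)
  ultimately show ?thesis
    by (simp flip: power_add mult_2)
qed

end

lemma cyclic_cocycle_split_sign:
  assumes "finite A" "finite B" "A \<inter> B = {}" "card A + card B = m + 2" "A \<noteq> {}" "B \<noteq> {}"
  shows "cyclic_cocycle m (A, B) = shuffle_sign (A, B) * split_sign (cofactor_vec moment (A \<union> B)) A B"
proof -
  have "vCons 1 (cyclic_map m v) = vec (m + 1) (\<lambda>r. moment r v)" for v
  proof (rule eq_vecI)
    fix i assume "i < dim_vec (vec (m + 1) (\<lambda>r. moment r v))"
    then show "vCons 1 (cyclic_map m v) $ i = vec (m + 1) (\<lambda>r. moment r v) $ i"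
      by (cases i) (auto simp: cyclic_map_def moment_def)
  qed (simp add: cyclic_map_def)
  moreover have "cofactor_vec moment (A \<union> B) v \<noteq> 0" for v
    unfolding cofactor_vec_def using vandermonde_nonzero by simp
  ultimately show ?thesis
    unfolding cyclic_cocycle_def using assms
    by (simp add: intersection_number_split_sign[where V = moment])
qed

section \<open>Crossings along a generic homotopy\<close>

lemma finite_gap:
  fixes Y :: "real set"
  assumes "finite Y"
  shows "\<exists>\<delta>>0. \<forall>x\<in>Y. \<forall>y\<in>Y. x \<noteq> y \<longrightarrow> 2 * \<delta> < \<bar>x - y\<bar>"
proof -
  define G where "G = insert 1 ((\<lambda>(x, y). \<bar>x - y\<bar>) ` {(x, y) \<in> Y \<times> Y. x \<noteq> y})"
  have "finite {(x, y) \<in> Y \<times> Y. x \<noteq> y}"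
    using assms by (intro finite_subset[OF _ finite_cartesian_product[OF assms assms]]) auto
  then have G: "finite G" "G \<noteq> {}" unfolding G_def by auto
  have "Min G > 0" using G by (auto simp: G_def)
  moreover have "2 * (Min G / 3) < \<bar>x - y\<bar>" if "x \<in> Y" "y \<in> Y" "x \<noteq> y" for x y
  proof -
    have "Min G \<le> \<bar>x - y\<bar>" using G that by (intro Min_le) (auto simp: G_def)
    then show ?thesis using \<open>Min G > 0\<close> by simp
  qed
  ultimately show ?thesis by (intro exI[of _ "Min G / 3"]) auto
qed

lemma sum_jumps:
  fixes g :: "real \<Rightarrow> int" and Z :: "real set"
  assumes "finite Z"
    and "\<delta> > 0" "a \<le> b"
    and "\<And>z. z \<in> Z \<Longrightarrow> a < z - \<delta> \<and> z + \<delta> < b"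
    and "\<And>z z'. z \<in> Z \<Longrightarrow> z' \<in> Z \<Longrightarrow> z \<noteq> z' \<Longrightarrow> 2 * \<delta> < \<bar>z - z'\<bar>"
    and "\<And>x y. a \<le> x \<Longrightarrow> x \<le> y \<Longrightarrow> y \<le> b \<Longrightarrow> {x..y} \<inter> Z = {} \<Longrightarrow> g x = g y"
  shows "(\<Sum>z\<in>Z. g (z + \<delta>) - g (z - \<delta>)) = g b - g a"
  using assms
proof (induction Z arbitrary: b rule: finite_linorder_max_induct)
  case empty
  then show ?case by simp
next
  case (insert z Z)
  have z: "a < z - \<delta>" "z + \<delta> < b" using insert.prems(3) by auto
  have sep: "z' + \<delta> < z - \<delta>" if "z' \<in> Z" for z'
    using insert.prems(4)[of z z'] insert.hyps(2) that by force
  have "(\<Sum>z\<in>Z. g (z + \<delta>) - g (z - \<delta>)) = g (z - \<delta>) - g a"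
  proof (rule insert.IH)
    show "a \<le> z - \<delta>" using z by simp
    show "a < z' - \<delta> \<and> z' + \<delta> < z - \<delta>" if "z' \<in> Z" for z'
      using that insert.prems(3) sep by auto
    show "2 * \<delta> < \<bar>x - y\<bar>" if "x \<in> Z" "y \<in> Z" "x \<noteq> y" for x y
      using that insert.prems(4) by auto
    show "g x = g y" if "a \<le> x" "x \<le> y" "y \<le> z - \<delta>" "{x..y} \<inter> Z = {}" for x y
      using that z insert.prems(1) by (intro insert.prems(5)) auto
  qed (fact insert.prems)
  moreover have "g (z + \<delta>) = g b"
  proof (rule insert.prems(5))
    show "{z + \<delta>..b} \<inter> insert z Z = {}"
      using insert.prems(1) insert.hyps(2) by fastforce
  qed (use z insert.prems(1) in auto)
  moreover have "z \<notin> Z" using insert.hyps(2) by auto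
  ultimately show ?case using insert.hyps(1) by simp
qed

lemma split_sign_change:
  assumes "v \<in> A" "B \<noteq> {}" "A \<inter> B = {}"
    and "\<And>x. x \<in> A \<union> B - {v} \<Longrightarrow> sgn (a' x) = sgn (a x)"
    and "\<And>x. x \<in> A \<union> B - {v} \<Longrightarrow> sgn (a'' x) = sgn (a x)"
    and "a' v \<noteq> 0" "a'' v \<noteq> 0"
  shows "split_sign a'' A B - split_sign a' A B
    = (if split_sign a (A - {v}) B \<noteq> 0 then of_bool (a'' v > 0) - of_bool (a' v > 0) else 0)"
proof -
  have *: "split_sign c A B = (if split_sign a (A - {v}) B = 0 then 0
      else if split_sign a (A - {v}) B = 1 then of_bool (c v > 0) else of_bool (c v > 0) - 1)"
    if c: "\<And>x. x \<in> A \<union> B - {v} \<Longrightarrow> sgn (c x) = sgn (a x)" "c v \<noteq> 0" for c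
  proof -
    have pos: "c x > 0 \<longleftrightarrow> a x > 0" if "x \<in> A \<union> B" "x \<noteq> v" for x
      using c(1)[of x] that by (auto simp: sgn_if split: if_splits)
    have neg: "c x < 0 \<longleftrightarrow> a x < 0" if "x \<in> A \<union> B" "x \<noteq> v" for x
      using c(1)[of x] that by (auto simp: sgn_if split: if_splits)
    obtain y where y: "y \<in> B" using assms(2) by blast
    have vB: "v \<notin> B" using assms(1,3) by auto
    have A1: "(\<forall>x\<in>A. c x > 0) \<longleftrightarrow> c v > 0 \<and> (\<forall>x\<in>A - {v}. a x > 0)"
      using pos assms(1) by blast
    have A2: "(\<forall>x\<in>A. c x < 0) \<longleftrightarrow> c v < 0 \<and> (\<forall>x\<in>A - {v}. a x < 0)"
      using neg assms(1) by blast
    have B1: "(\<forall>x\<in>B. c x > 0) \<longleftrightarrow> (\<forall>x\<in>B. a x > 0)"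
      using pos vB by (metis UnI2)
    have B2: "(\<forall>x\<in>B. c x < 0) \<longleftrightarrow> (\<forall>x\<in>B. a x < 0)"
      using neg vB by (metis UnI2)
    have excl: "\<not> ((\<forall>x\<in>B. a x > 0) \<and> (\<forall>x\<in>B. a x < 0))"
      using y by force
    have cv: "c v < 0 \<longleftrightarrow> \<not> c v > 0" using c(2) by auto
    define p q r s where "p \<longleftrightarrow> (\<forall>x\<in>A - {v}. a x > 0)" and "q \<longleftrightarrow> (\<forall>x\<in>A - {v}. a x < 0)"
      and "r \<longleftrightarrow> (\<forall>x\<in>B. a x > 0)" and "s \<longleftrightarrow> (\<forall>x\<in>B. a x < 0)"
    show ?thesis
      using excl unfolding split_sign_def A1 A2 B1 B2 cv
      unfolding p_def[symmetric] q_def[symmetric] r_def[symmetric] s_def[symmetric]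
      by (cases p; cases q; cases r; cases s; cases "c v > 0") auto
  qed
  show ?thesis
    using *[of a''] *[of a'] assms(4-7) by auto
qed

lemma split_sign_swap:
  assumes "A \<noteq> {} \<or> B \<noteq> {}"
  shows "split_sign a B A = - split_sign a A B"
proof -
  define p q r s where "p \<longleftrightarrow> (\<forall>x\<in>A. a x > 0)" and "q \<longleftrightarrow> (\<forall>x\<in>A. a x < 0)"
    and "r \<longleftrightarrow> (\<forall>x\<in>B. a x > 0)" and "s \<longleftrightarrow> (\<forall>x\<in>B. a x < 0)"
  have "\<not> (p \<and> q \<and> r \<and> s)"
    using assms unfolding p_def q_def r_def s_def by force
  then show ?thesis
    unfolding split_sign_def p_def[symmetric] q_def[symmetric] r_def[symmetric] s_def[symmetric]
    by (cases p; cases q; cases r; cases s) auto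
qed

lemma split_sign_cong_sgn:
  assumes "\<And>x. x \<in> A \<union> B \<Longrightarrow> sgn (a x) = sgn (a' x)"
  shows "split_sign a A B = split_sign a' A B"
proof -
  have "0 < a x \<longleftrightarrow> 0 < a' x" "a x < 0 \<longleftrightarrow> a' x < 0" if "x \<in> A \<union> B" for x
    using assms[OF that] by (auto simp: sgn_if split: if_splits)
  then show ?thesis unfolding split_sign_def by (intro if_cong) auto
qed

locale generic_homotopy =
  fixes m n :: nat and E :: "nat \<Rightarrow> nat \<Rightarrow> real"
  assumes m: "m \<ge> 1" and n: "m + 2 \<le> n"
    and fixed: "\<And>i l. l \<le> m \<Longrightarrow> E i l = 0" and row_0: "\<And>l. E 0 l = 0"
    and generic: "generic_upto E n m n"
begin

abbreviation conf :: "real \<Rightarrow> nat \<Rightarrow> nat \<Rightarrow> real" where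
  "conf \<equiv> homotopy E"

definition chi :: "nat set \<Rightarrow> real \<Rightarrow> real" where
  "chi J t = cdet (conf t) (sorted_list_of_set J)"

definition maximal :: "nat set set" where
  "maximal = {J. J \<subseteq> {..<n} \<and> card J = m + 1}"

definition crossings :: "real set" where
  "crossings = {t. 0 < t \<and> t < 1 \<and> (\<exists>J\<in>maximal. chi J t = 0)}"

definition radon :: "real \<Rightarrow> nat set \<Rightarrow> nat set \<Rightarrow> bool" where
  "radon t A B \<longleftrightarrow> (\<exists>b. (\<forall>x\<in>A. b x > 0) \<and> (\<forall>x\<in>B. b x < 0) \<and>
     (\<forall>r\<le>m. (\<Sum>x\<in>A \<union> B. b x * conf t r x) = 0))"

definition gap :: real where
  "gap = (SOME \<delta>. \<delta> > 0 \<and> (\<forall>x\<in>insert 0 (insert 1 crossings). \<forall>y\<in>insert 0 (insert 1 crossings).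
     x \<noteq> y \<longrightarrow> 2 * \<delta> < \<bar>x - y\<bar>))"

definition jump :: "nat set \<Rightarrow> real \<Rightarrow> int" where
  "jump J z = of_bool (chi J (z + gap) > 0) - of_bool (chi J (z - gap) > 0)"

definition crossing_number :: "nat set \<Rightarrow> nat set \<Rightarrow> int" where
  "crossing_number A B = (\<Sum>z\<in>crossings. if radon z A B then jump (A \<union> B) z else 0)"

lemma conf_0: "conf t 0 x = 1"
  by (simp add: homotopy_def moment_def row_0)

lemma chi_poly: "chi J t = poly (cpoly moment E (sorted_list_of_set J)) t"
  by (simp add: chi_def cdet_homotopy)

lemma chi_0: "chi J 0 > 0"
  unfolding chi_def cdet_homotopy_0 by (rule vandermonde_pos) simp

lemma maximal_finite: "J \<in> maximal \<Longrightarrow> finite J"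
  unfolding maximal_def by (auto dest: finite_subset)

lemma chi_1: "J \<in> maximal \<Longrightarrow> chi J 1 \<noteq> 0"
  using maximal_finite[of J] unfolding chi_def maximal_def
  by (intro generic_uptoD(3)[OF generic]) auto

lemma finite_crossings: "finite crossings"
proof -
  have "crossings \<subseteq> (\<Union>J\<in>maximal. {t. chi J t = 0})"
    by (auto simp: crossings_def)
  moreover have "finite maximal"
    by (rule finite_subset[of _ "Pow {..<n}"]) (auto simp: maximal_def)
  moreover have "finite {t. chi J t = 0}" for J
    unfolding chi_def by (rule finite_homotopy_zeros) simp
  ultimately show ?thesis by (meson finite_UN_I finite_subset)
qed

lemma gap: "gap > 0"
  "\<And>z. z \<in> crossings \<Longrightarrow> 0 < z - gap \<and> z + gap < 1"
  "\<And>x y. x \<in> crossings \<Longrightarrow> y \<in> crossings \<Longrightarrow> x \<noteq> y \<Longrightarrow> 2 * gap < \<bar>x - y\<bar>"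
proof -
  have *: "gap > 0 \<and> (\<forall>x\<in>insert 0 (insert 1 crossings). \<forall>y\<in>insert 0 (insert 1 crossings).
     x \<noteq> y \<longrightarrow> 2 * gap < \<bar>x - y\<bar>)"
    unfolding gap_def by (rule someI_ex, rule finite_gap) (simp add: finite_crossings)
  show pos: "gap > 0" using * by blast
  show "2 * gap < \<bar>x - y\<bar>" if "x \<in> crossings" "y \<in> crossings" "x \<noteq> y" for x y
    using * that by blast
  show "0 < z - gap \<and> z + gap < 1" if z: "z \<in> crossings" for z
  proof -
    have z01: "0 < z" "z < 1" using z by (auto simp: crossings_def)
    then have "2 * gap < \<bar>z - 0\<bar>" "2 * gap < \<bar>z - 1\<bar>" using * z by force+
    then show ?thesis using z01 pos by auto
  qed
qed

lemma chi_sgn_const: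
  assumes J: "J \<in> maximal" and xy: "0 \<le> x" "x \<le> y" "y \<le> 1"
    and nz: "\<And>t. t \<in> crossings \<Longrightarrow> x \<le> t \<Longrightarrow> t \<le> y \<Longrightarrow> chi J t \<noteq> 0"
  shows "sgn (chi J x) = sgn (chi J y)"
proof -
  have nz': "chi J t \<noteq> 0" if t: "x \<le> t" "t \<le> y" for t
  proof (cases "t = 0 \<or> t = 1")
    case True
    then show ?thesis using chi_0[of J] chi_1[OF J] by auto
  next
    case False
    then have "chi J t = 0 \<Longrightarrow> t \<in> crossings" using t xy J by (auto simp: crossings_def)
    then show ?thesis using nz t by blast
  qed
  show ?thesis
  proof (rule ccontr)
    assume "sgn (chi J x) \<noteq> sgn (chi J y)"
    moreover have "chi J x \<noteq> 0" "chi J y \<noteq> 0" using nz' xy by auto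
    ultimately have "x < y" and "chi J x < 0 \<and> 0 < chi J y \<or> 0 < chi J x \<and> chi J y < 0"
      using xy(2) by (auto simp: sgn_if less_le split: if_splits)
    then obtain t where "x < t" "t < y" "chi J t = 0"
      using poly_IVT_pos[of x y "cpoly moment E (sorted_list_of_set J)"]
        poly_IVT_neg[of x y "cpoly moment E (sorted_list_of_set J)"]
      unfolding chi_poly by blast
    then show False using nz'[of t] by simp
  qed
qed

lemma chi_near_crossing:
  assumes J: "J \<in> maximal" and z: "z \<in> crossings"
  shows "chi J (z - gap) \<noteq> 0" "chi J (z + gap) \<noteq> 0"
    and "chi J z \<noteq> 0 \<Longrightarrow> sgn (chi J (z - gap)) = sgn (chi J z)"
    and "chi J z \<noteq> 0 \<Longrightarrow> sgn (chi J (z + gap)) = sgn (chi J z)"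
proof -
  have only: "t = z" if "t \<in> crossings" "z - gap \<le> t" "t \<le> z + gap" for t
    using gap(3)[OF that(1) z] that(2,3) gap(1) by fastforce
  have in01: "0 < z - gap" "z + gap < 1" using gap(2)[OF z] by auto
  have "z - gap \<notin> crossings" "z + gap \<notin> crossings"
    using only[of "z - gap"] only[of "z + gap"] gap(1) by auto
  then show "chi J (z - gap) \<noteq> 0" "chi J (z + gap) \<noteq> 0"
    using in01 gap(1) J by (auto simp: crossings_def)
  show "sgn (chi J (z - gap)) = sgn (chi J z)" if "chi J z \<noteq> 0"
    using that only in01 gap(1) by (intro chi_sgn_const[OF J]) force+
  show "sgn (chi J (z + gap)) = sgn (chi J z)" if "chi J z \<noteq> 0"
    using that only in01 gap(1) by (intro chi_sgn_const[OF J, symmetric]) force+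
qed

lemma jump_eq_0: "J \<in> maximal \<Longrightarrow> z \<in> crossings \<Longrightarrow> chi J z \<noteq> 0 \<Longrightarrow> jump J z = 0"
  using chi_near_crossing[of J z] unfolding jump_def by (auto simp: sgn_if split: if_splits)

lemma jump_abs_le: "\<bar>jump J z\<bar> \<le> 1"
  unfolding jump_def by (simp add: of_bool_def)

lemma sum_jump:
  assumes "J \<in> maximal"
  shows "(\<Sum>z\<in>crossings. jump J z) = of_bool (chi J 1 > 0) - 1"
proof -
  have "(\<Sum>z\<in>crossings. jump J z) = of_bool (chi J 1 > 0) - of_bool (chi J 0 > 0)"
    unfolding jump_def
  proof (rule sum_jumps[OF finite_crossings])
    fix x y :: real assume xy: "0 \<le> x" "x \<le> y" "y \<le> 1" "{x..y} \<inter> crossings = {}"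
    have "sgn (chi J x) = sgn (chi J y)"
      using xy by (intro chi_sgn_const[OF assms]) auto
    then show "of_bool (chi J x > 0) = of_bool (chi J y > 0)"
      by (auto simp: sgn_if split: if_splits)
  qed (use gap in auto)
  then show ?thesis using chi_0 by simp
qed

lemma radon_swap: "radon t A B \<longleftrightarrow> radon t B A"
proof -
  have "radon t B A" if "radon t A B" for A B
  proof -
    obtain b where b: "\<forall>x\<in>A. b x > 0" "\<forall>x\<in>B. b x < 0" "\<forall>r\<le>m. (\<Sum>x\<in>A \<union> B. b x * conf t r x) = 0"
      using \<open>radon t A B\<close> unfolding radon_def by blast
    then show ?thesis
      unfolding radon_def by (intro exI[of _ "\<lambda>x. - b x"]) (auto simp: Un_commute sum_negf)
  qed
  then show ?thesis by blast
qed

lemma crossing_number_swap: "crossing_number A B = crossing_number B A"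
  unfolding crossing_number_def by (intro sum.cong refl) (metis radon_swap Un_commute)

lemma radon_nonempty:
  assumes "radon t A B" "finite A" "finite B" "A \<union> B \<noteq> {}"
  shows "A \<noteq> {}" "B \<noteq> {}"
proof -
  have *: "A \<noteq> {}" if r: "radon t A B" and fin: "finite A" "finite B" "A \<union> B \<noteq> {}" for A B
  proof
    assume "A = {}"
    obtain b where b: "\<forall>x\<in>B. b x < 0" "(\<Sum>x\<in>A \<union> B. b x * conf t 0 x) = 0"
      using r unfolding radon_def by blast
    have "(\<Sum>x\<in>B. b x) < (\<Sum>x\<in>B. 0)"
      using b(1) fin \<open>A = {}\<close> by (intro sum_strict_mono) auto
    then show False using b(2) \<open>A = {}\<close> by (simp add: conf_0)
  qed
  show "A \<noteq> {}" using *[OF assms] .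
  show "B \<noteq> {}" using *[of B A] assms radon_swap by blast
qed

lemma crossing_number_empty:
  assumes "finite B" "B \<noteq> {}"
  shows "crossing_number {} B = 0" "crossing_number B {} = 0"
proof -
  show *: "crossing_number {} B = 0"
    unfolding crossing_number_def using radon_nonempty(1)[of _ "{}" B] assms
    by (intro sum.neutral) auto
  show "crossing_number B {} = 0"
    using * crossing_number_swap by metis
qed

definition circuit :: "nat set \<Rightarrow> real \<Rightarrow> nat \<Rightarrow> real" where
  "circuit L t = cofactor_vec (conf t) L"

definition circuit_support :: "nat set \<Rightarrow> bool" where
  "circuit_support L \<longleftrightarrow> L \<subseteq> {..<n} \<and> card L = m + 2"

lemma circuit_support_finite: "circuit_support L \<Longrightarrow> finite L"
  unfolding circuit_support_def by (auto dest: finite_subset)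

lemma circuit_eq: "circuit L t v = (-1) ^ card {x\<in>L. x < v} * chi (L - {v}) t"
  by (simp add: circuit_def cofactor_vec_def chi_def)

lemma circuit_support_remove:
  "circuit_support L \<Longrightarrow> v \<in> L \<Longrightarrow> L - {v} \<in> maximal"
  using circuit_support_finite[of L] unfolding circuit_support_def maximal_def by auto

lemma circuit_relation:
  "circuit_support L \<Longrightarrow> r \<le> m \<Longrightarrow> (\<Sum>v\<in>L. circuit L t v * conf t r v) = 0"
  unfolding circuit_def
  using circuit_support_finite[of L] by (intro cofactor_vec_relation) (auto simp: circuit_support_def)

lemma circuit_generic:
  assumes "circuit_support L" "v \<in> L" "w \<in> L" "v \<noteq> w"
  shows "chi (L - {v}) t \<noteq> 0 \<or> chi (L - {w}) t \<noteq> 0"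
proof -
  let ?xs = "sorted_list_of_set (L - {v, w})"
  have fin: "finite L" using assms(1) by (rule circuit_support_finite)
  have L: "L \<subseteq> {..<n}" "card L = m + 2" using assms(1) by (auto simp: circuit_support_def)
  have "cdet (conf t) (?xs @ [v]) \<noteq> 0 \<or> cdet (conf t) (?xs @ [w]) \<noteq> 0"
  proof (rule generic_uptoD(1)[OF generic])
    show "length ?xs = m" using fin L assms by (simp add: card_Diff_subset)
  qed (use fin L assms in auto)
  moreover have "cdet (conf t) (?xs @ [v]) = 0 \<longleftrightarrow> chi (L - {w}) t = 0"
    unfolding chi_def
    by (rule cdet_eq_0_mset, subst set_eq_iff_mset_eq_distinct[symmetric]) (use fin assms in auto)
  moreover have "cdet (conf t) (?xs @ [w]) = 0 \<longleftrightarrow> chi (L - {v}) t = 0"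
    unfolding chi_def
    by (rule cdet_eq_0_mset, subst set_eq_iff_mset_eq_distinct[symmetric]) (use fin assms in auto)
  ultimately show ?thesis by blast
qed

text \<open>At a crossing of \<open>L - {v}\<close> the circuit of \<open>L\<close> vanishes exactly at \<open>v\<close>, so it carries
  the only affine dependency of \<open>L - {v}\<close>.\<close>

lemma dependency_multiple:
  assumes L: "circuit_support L" and v: "v \<in> L" "chi (L - {v}) t = 0"
    and dep: "\<And>r. r \<le> m \<Longrightarrow> (\<Sum>x\<in>L - {v}. b x * conf t r x) = 0"
  shows "\<exists>c. \<forall>x\<in>L - {v}. b x = c * circuit L t x"
proof -
  have fin: "finite L" using L by (rule circuit_support_finite)
  have cardL: "card L = m + 2" using L by (simp add: circuit_support_def)
  have "card (L - {v}) \<noteq> 0" using fin v cardL by simp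
  then have "L - {v} \<noteq> {}" by (metis card.empty)
  then obtain u where u: "u \<in> L" "u \<noteq> v" by blast
  have nz: "circuit L t u \<noteq> 0"
    using circuit_generic[OF L v(1) u(1)] u v by (auto simp: circuit_eq)
  define b' where "b' x = (if x = v then 0 else b x)" for x
  have "(\<Sum>x\<in>L. b' x * conf t r x) = 0" if "r \<le> m" for r
    using fin v(1) dep[OF that] by (simp add: sum.remove[of L v] b'_def)
  then have *: "b' x * circuit L t u = b' u * circuit L t x" if "x \<in> L" for x
    using dependency_unique[where b = b' and V = "conf t" and u = u and x = x, OF fin cardL] u(1) nz that
    by (simp add: circuit_def)
  show ?thesis
  proof (intro exI ballI)
    fix x assume "x \<in> L - {v}"
    then show "b x = b u / circuit L t u * circuit L t x"
      using *[of x] nz u(2) by (simp add: b'_def nonzero_eq_divide_eq)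
  qed
qed

lemma radon_iff_split_sign:
  assumes L: "circuit_support L" and v: "v \<in> L" "chi (L - {v}) t = 0"
    and AB: "A \<union> B = L - {v}" "A \<inter> B = {}"
  shows "radon t A B \<longleftrightarrow> split_sign (circuit L t) A B \<noteq> 0"
proof
  assume "radon t A B"
  then obtain b where b: "\<forall>x\<in>A. b x > 0" "\<forall>x\<in>B. b x < 0" "\<forall>r\<le>m. (\<Sum>x\<in>A \<union> B. b x * conf t r x) = 0"
    unfolding radon_def by blast
  obtain c where c: "\<forall>x\<in>L - {v}. b x = c * circuit L t x"
    using dependency_multiple[OF L v, of b] b(3) unfolding AB by blast
  have pos: "\<forall>x\<in>A. c * circuit L t x > 0" and neg: "\<forall>x\<in>B. c * circuit L t x < 0"
    using b(1,2) c unfolding AB(1)[symmetric] by (metis UnI1, metis UnI2)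
  show "split_sign (circuit L t) A B \<noteq> 0"
  proof (cases "c > 0")
    case True
    then show ?thesis
      using pos neg by (auto simp: split_sign_def zero_less_mult_iff mult_less_0_iff)
  next
    case False
    then have "(\<forall>x\<in>A. circuit L t x < 0) \<and> (\<forall>x\<in>B. circuit L t x > 0)"
      using pos neg by (auto simp: zero_less_mult_iff mult_less_0_iff)
    then show ?thesis by (simp add: split_sign_def)
  qed
next
  assume *: "split_sign (circuit L t) A B \<noteq> 0"
  have fin: "finite L" using L by (rule circuit_support_finite)
  have rel: "(\<Sum>x\<in>A \<union> B. circuit L t x * conf t r x) = 0" if "r \<le> m" for r
    using circuit_relation[OF L that, of t] fin v unfolding AB
    by (simp add: sum.remove[of L v] circuit_eq)
  have "(\<forall>x\<in>A. circuit L t x > 0) \<and> (\<forall>x\<in>B. circuit L t x < 0) \<or>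
      (\<forall>x\<in>B. circuit L t x > 0) \<and> (\<forall>x\<in>A. circuit L t x < 0)"
    using * by (auto simp: split_sign_def split: if_splits)
  then show "radon t A B"
  proof
    assume "(\<forall>x\<in>A. circuit L t x > 0) \<and> (\<forall>x\<in>B. circuit L t x < 0)"
    then show ?thesis unfolding radon_def using rel by blast
  next
    assume "(\<forall>x\<in>B. circuit L t x > 0) \<and> (\<forall>x\<in>A. circuit L t x < 0)"
    moreover have "\<forall>r\<le>m. (\<Sum>x\<in>B \<union> A. circuit L t x * conf t r x) = 0"
      using rel unfolding Un_commute[of B A] by blast
    ultimately have "radon t B A" unfolding radon_def by blast
    then show ?thesis using radon_swap by blast
  qed
qed

lemma split_sign_local_change:
  assumes L: "circuit_support (A \<union> B)" and AB: "A \<inter> B = {}" "B \<noteq> {}"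
    and z: "z \<in> crossings" and v: "v \<in> A" "chi (A \<union> B - {v}) z = 0"
  shows "split_sign (circuit (A \<union> B) (z + gap)) A B - split_sign (circuit (A \<union> B) (z - gap)) A B
    = (if radon z (A - {v}) B then (-1) ^ card {x\<in>A \<union> B. x < v} * jump (A \<union> B - {v}) z else 0)"
proof -
  let ?L = "A \<union> B"
  have near: "sgn (circuit ?L (z - gap) x) = sgn (circuit ?L z x)"
    "sgn (circuit ?L (z + gap) x) = sgn (circuit ?L z x)" if "x \<in> ?L - {v}" for x
    using chi_near_crossing(3,4)[OF circuit_support_remove[OF L, of x] z]
      circuit_generic[OF L, of x v z] v that
    by (auto simp: circuit_eq sgn_mult)
  have nz: "circuit ?L (z - gap) v \<noteq> 0" "circuit ?L (z + gap) v \<noteq> 0"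
    using chi_near_crossing(1,2)[OF circuit_support_remove[OF L, of v] z] v
    by (auto simp: circuit_eq)
  have "radon z (A - {v}) B \<longleftrightarrow> split_sign (circuit ?L z) (A - {v}) B \<noteq> 0"
    using v AB by (intro radon_iff_split_sign[OF L]) auto
  moreover have "of_bool (circuit ?L (z + gap) v > 0) - of_bool (circuit ?L (z - gap) v > 0)
      = (-1) ^ card {x\<in>?L. x < v} * jump (?L - {v}) z"
  proof (cases "even (card {x\<in>?L. x < v})")
    case True
    then show ?thesis by (simp add: jump_def circuit_eq)
  next
    case False
    then show ?thesis using nz by (auto simp: jump_def circuit_eq of_bool_def)
  qed
  ultimately show ?thesis
    using split_sign_change[of v A B "circuit ?L (z - gap)" "circuit ?L z" "circuit ?L (z + gap)"]
      near nz v AB by simp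
qed

lemma split_sign_difference:
  assumes L: "circuit_support (A \<union> B)" and AB: "A \<inter> B = {}" "A \<noteq> {}" "B \<noteq> {}"
  shows "split_sign (circuit (A \<union> B) 1) A B - split_sign (circuit (A \<union> B) 0) A B
    = (\<Sum>v\<in>A. (-1) ^ card {x\<in>A \<union> B. x < v} * crossing_number (A - {v}) B)
      - (\<Sum>v\<in>B. (-1) ^ card {x\<in>A \<union> B. x < v} * crossing_number A (B - {v}))"
proof -
  let ?L = "A \<union> B"
  let ?g = "\<lambda>t. split_sign (circuit ?L t) A B"
  let ?e = "\<lambda>v. (-1) ^ card {x\<in>?L. x < v} :: int"
  let ?s = "\<lambda>z. (\<Sum>v\<in>A. ?e v * (if radon z (A - {v}) B then jump (?L - {v}) z else 0))
      - (\<Sum>v\<in>B. ?e v * (if radon z A (B - {v}) then jump (?L - {v}) z else 0))"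
  have fin: "finite A" "finite B" using circuit_support_finite[OF L] by auto
  have local: "?g (z + gap) - ?g (z - gap) = ?s z" if z: "z \<in> crossings" for z
  proof (cases "\<exists>v\<in>?L. chi (?L - {v}) z = 0")
    case False
    have "sgn (circuit ?L (z - gap) x) = sgn (circuit ?L (z + gap) x)" if "x \<in> ?L" for x
      using chi_near_crossing(3,4)[OF circuit_support_remove[OF L that] z] False that
      by (simp add: circuit_eq sgn_mult)
    then have "?g (z - gap) = ?g (z + gap)" by (rule split_sign_cong_sgn)
    moreover have "jump (?L - {v}) z = 0" if "v \<in> ?L" for v
      using jump_eq_0[OF circuit_support_remove[OF L that] z] False that by blast
    then have "?s z = 0" by (simp add: sum.neutral)
    ultimately show ?thesis by simp
  next
    case True
    then obtain v where v: "v \<in> ?L" "chi (?L - {v}) z = 0" by blast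
    have other: "jump (?L - {w}) z = 0" if "w \<in> ?L" "w \<noteq> v" for w
      using circuit_generic[OF L that(1) v(1) that(2), of z] v(2) that
        jump_eq_0[OF circuit_support_remove[OF L that(1)] z] by blast
    show ?thesis
    proof (cases "v \<in> A")
      case True
      then have vB: "v \<notin> B" using AB by blast
      have "(\<Sum>v\<in>B. ?e v * (if radon z A (B - {v}) then jump (?L - {v}) z else 0)) = 0"
        by (intro sum.neutral) (use other vB in auto)
      moreover have "(\<Sum>v\<in>A. ?e v * (if radon z (A - {v}) B then jump (?L - {v}) z else 0))
          = ?e v * (if radon z (A - {v}) B then jump (?L - {v}) z else 0)"
        unfolding sum.remove[OF fin(1) True] using other by (simp add: sum.neutral)
      ultimately show ?thesis
        unfolding split_sign_local_change[OF L AB(1,3) z True v(2)] by simp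
    next
      case False
      then have vB: "v \<in> B" using v by blast
      have BA: "B \<union> A = ?L" by blast
      have "(\<Sum>v\<in>A. ?e v * (if radon z (A - {v}) B then jump (?L - {v}) z else 0)) = 0"
        by (intro sum.neutral) (use other False in auto)
      moreover have "(\<Sum>v\<in>B. ?e v * (if radon z A (B - {v}) then jump (?L - {v}) z else 0))
          = ?e v * (if radon z A (B - {v}) then jump (?L - {v}) z else 0)"
        unfolding sum.remove[OF fin(2) vB] using other by (simp add: sum.neutral)
      moreover have "?g (z + gap) - ?g (z - gap)
          = - (?e v * (if radon z A (B - {v}) then jump (?L - {v}) z else 0))"
      proof -
        have "split_sign (circuit ?L (z + gap)) B A - split_sign (circuit ?L (z - gap)) B A
            = (if radon z (B - {v}) A then ?e v * jump (?L - {v}) z else 0)"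
          using split_sign_local_change[of B A z v] L AB z vB v(2) unfolding BA by blast
        then have "- ?g (z + gap) - - ?g (z - gap)
            = ?e v * (if radon z A (B - {v}) then jump (?L - {v}) z else 0)"
          unfolding radon_swap[of z "B - {v}" A] split_sign_swap[OF disjI1[OF AB(2)]]
          by (simp only: if_distrib mult_zero_right)
        then show ?thesis by linarith
      qed
      ultimately show ?thesis by linarith
    qed
  qed
  have "?g 1 - ?g 0 = (\<Sum>z\<in>crossings. ?g (z + gap) - ?g (z - gap))"
  proof (rule sum_jumps[OF finite_crossings, symmetric])
    fix x y :: real assume xy: "0 \<le> x" "x \<le> y" "y \<le> 1" "{x..y} \<inter> crossings = {}"
    show "?g x = ?g y"
    proof (rule split_sign_cong_sgn)
      fix v assume "v \<in> ?L"
      then have "sgn (chi (?L - {v}) x) = sgn (chi (?L - {v}) y)"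
        using xy by (intro chi_sgn_const circuit_support_remove[OF L]) auto
      then show "sgn (circuit ?L x v) = sgn (circuit ?L y v)"
        by (simp add: circuit_eq sgn_mult)
    qed
  qed (use gap in auto)
  also have "\<dots> = (\<Sum>z\<in>crossings. ?s z)"
    by (rule sum.cong[OF refl local])
  also have "\<dots> = (\<Sum>v\<in>A. ?e v * (\<Sum>z\<in>crossings. if radon z (A - {v}) B then jump (?L - {v}) z else 0))
      - (\<Sum>v\<in>B. ?e v * (\<Sum>z\<in>crossings. if radon z A (B - {v}) then jump (?L - {v}) z else 0))"
    unfolding sum_subtractf sum_distrib_left
    by (intro arg_cong2[where f = "(-)"]; rule sum.swap)
  also have "\<dots> = (\<Sum>v\<in>A. ?e v * crossing_number (A - {v}) B) - (\<Sum>v\<in>B. ?e v * crossing_number A (B - {v}))"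
  proof -
    have "(A - {v}) \<union> B = ?L - {v}" if "v \<in> A" for v using that AB by blast
    moreover have "A \<union> (B - {v}) = ?L - {v}" if "v \<in> B" for v using that AB by blast
    ultimately show ?thesis
      unfolding crossing_number_def by (intro arg_cong2[where f = "(-)"] sum.cong refl) (auto cong: if_cong)
  qed
  finally show ?thesis .
qed

definition min_splittings :: "nat set \<Rightarrow> (nat set \<times> nat set) set" where
  "min_splittings J = {(A, B). A \<union> B = J \<and> A \<inter> B = {} \<and> A \<noteq> {} \<and> B \<noteq> {} \<and> Min J \<in> A}"

lemma radon_partition:
  assumes J: "J \<in> maximal" "chi J z = 0"
  shows "\<exists>c\<in>min_splittings J. radon z (fst c) (snd c) \<and>
    (\<forall>c'\<in>min_splittings J. radon z (fst c') (snd c') \<longrightarrow> c' = c)"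
proof -
  have finJ: "finite J" and J': "J \<subseteq> {..<n}" "card J = m + 1"
    using J maximal_finite[of J] by (auto simp: maximal_def)
  then have "J \<noteq> {..<n}" using n by auto
  then obtain v where v: "v < n" "v \<notin> J" using J' by auto
  define L where "L = insert v J"
  have L: "circuit_support L" "v \<in> L" "L - {v} = J"
    using v J' finJ by (auto simp: L_def circuit_support_def)
  have chi_v: "chi (L - {v}) z = 0" using J L by simp
  let ?a = "circuit L z"
  have a_nz: "?a x \<noteq> 0" if "x \<in> J" for x
  proof -
    have "x \<in> L" "x \<noteq> v" using that v by (auto simp: L_def)
    then show ?thesis
      using circuit_generic[OF L(1,2), of x z] chi_v by (auto simp: circuit_eq)
  qed
  have J_ne: "J \<noteq> {}" using J' by auto
  define s :: real where "s = (if ?a (Min J) > 0 then 1 else -1)"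
  have s: "s * ?a (Min J) > 0"
    using a_nz[of "Min J"] J_ne finJ by (auto simp: s_def)
  define A where "A = {x\<in>J. s * ?a x > 0}"
  define B where "B = {x\<in>J. s * ?a x < 0}"
  have "s * ?a x > 0 \<or> s * ?a x < 0" if "x \<in> J" for x
  proof -
    have "s * ?a x \<noteq> 0" using a_nz[OF that] by (simp add: s_def)
    then show ?thesis by linarith
  qed
  then have AB: "A \<union> B = J" "A \<inter> B = {}"
    unfolding A_def B_def by force+
  have min: "Min J \<in> A" using s J_ne finJ by (auto simp: A_def)
  have radon: "radon z A B"
    unfolding radon_iff_split_sign[OF L(1,2) chi_v AB(1)[folded L(3)] AB(2)]
    by (cases "?a (Min J) > 0") (auto simp: split_sign_def A_def B_def s_def)
  have uniq: "A' = A \<and> B' = B"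
    if AB': "A' \<union> B' = J" "A' \<inter> B' = {}" "Min J \<in> A'" "radon z A' B'" for A' B'
  proof -
    obtain b where b: "\<forall>x\<in>A'. b x > 0" "\<forall>x\<in>B'. b x < 0"
      "\<forall>r\<le>m. (\<Sum>x\<in>A' \<union> B'. b x * conf z r x) = 0"
      using AB'(4) unfolding radon_def by blast
    obtain c where c: "\<forall>x\<in>J. b x = c * ?a x"
      using dependency_multiple[OF L(1,2) chi_v, of b] b(3) unfolding AB'(1) L(3) by blast
    have "b (Min J) > 0" using b(1) AB'(3) by blast
    moreover have "Min J \<in> J" using J_ne finJ by simp
    ultimately have "c * ?a (Min J) > 0" using c by simp
    then have cs: "c * s > 0" using s by (auto simp: zero_less_mult_iff)
    have "c * ?a x > 0 \<longleftrightarrow> s * ?a x > 0" for x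
      using cs by (auto simp: zero_less_mult_iff)
    moreover have "c * ?a x < 0 \<longleftrightarrow> s * ?a x < 0" for x
      using cs by (auto simp: zero_less_mult_iff mult_less_0_iff)
    ultimately have sg: "b x > 0 \<longleftrightarrow> x \<in> A" "b x < 0 \<longleftrightarrow> x \<in> B" if "x \<in> J" for x
      using c that by (auto simp: A_def B_def)
    have "A' \<subseteq> A" using b(1) sg(1) AB'(1) by blast
    moreover have "B' \<subseteq> B" using b(2) sg(2) AB'(1) by blast
    ultimately show ?thesis using AB AB' by blast
  qed
  have ne: "A \<noteq> {}" "B \<noteq> {}"
    using radon_nonempty[OF radon] AB finJ J_ne by auto
  show ?thesis
  proof (rule bexI[of _ "(A, B)"], intro conjI ballI impI)
    show "(A, B) \<in> min_splittings J" using AB min ne by (simp add: min_splittings_def)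
    show "radon z (fst (A, B)) (snd (A, B))" using radon by simp
  next
    fix c assume "c \<in> min_splittings J" "radon z (fst c) (snd c)"
    then show "c = (A, B)"
      using uniq[of "fst c" "snd c"] by (cases c) (simp add: min_splittings_def)
  qed
qed

lemma finite_min_splittings: "finite J \<Longrightarrow> finite (min_splittings J)"
  by (rule finite_subset[of _ "Pow J \<times> Pow J"]) (auto simp: min_splittings_def)

lemma sum_over_splittings:
  assumes J: "J \<in> maximal"
  shows "(\<Sum>(A, B)\<in>min_splittings J. if radon z A B then c else 0 :: int) = (if chi J z = 0 then c else 0)"
proof (cases "chi J z = 0")
  case True
  obtain c' where c': "c' \<in> min_splittings J" "radon z (fst c') (snd c')"
    "\<And>c. c \<in> min_splittings J \<Longrightarrow> radon z (fst c) (snd c) \<Longrightarrow> c = c'"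
    using radon_partition[OF J True] by metis
  have "(\<Sum>p\<in>min_splittings J. if radon z (fst p) (snd p) then c else 0)
      = (\<Sum>p\<in>{c'}. if radon z (fst p) (snd p) then c else 0)"
  proof (intro sum.mono_neutral_right ballI)
    fix p assume "p \<in> min_splittings J - {c'}"
    then have "\<not> radon z (fst p) (snd p)" using c'(3)[of p] by blast
    then show "(if radon z (fst p) (snd p) then c else 0) = 0" by simp
  qed (use c'(1) finite_min_splittings[OF maximal_finite[OF J]] in auto)
  then show ?thesis using True c'(2) by (simp add: case_prod_beta)
next
  case False
  have "\<not> radon z A B" if "(A, B) \<in> min_splittings J" for A B
  proof
    assume "radon z A B"
    moreover have "A \<union> B = J" using that by (simp add: min_splittings_def)
    ultimately obtain b where b: "\<forall>x\<in>A. b x > 0" "\<forall>r\<le>m. (\<Sum>x\<in>J. b x * conf z r x) = 0"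
      unfolding radon_def by auto
    have "\<forall>x\<in>set (sorted_list_of_set J). b x = 0"
      using False b(2) J maximal_finite[OF J]
      by (intro cdet_kernel_trivial[of "conf z"]) (auto simp: chi_def maximal_def)
    moreover have "Min J \<in> A" "Min J \<in> J" using that by (auto simp: min_splittings_def)
    ultimately have "b (Min J) = 0" "b (Min J) > 0" using b(1) maximal_finite[OF J] by auto
    then show False by simp
  qed
  then have "(\<Sum>(A, B)\<in>min_splittings J. if radon z A B then c else 0) = 0"
    by (intro sum.neutral) auto
  then show ?thesis using False by simp
qed

lemma sum_crossing_number:
  assumes J: "J \<in> maximal"
  shows "(\<Sum>(A, B)\<in>min_splittings J. crossing_number A B) = of_bool (chi J 1 > 0) - 1"
proof -
  have "(\<Sum>(A, B)\<in>min_splittings J. crossing_number A B)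
      = (\<Sum>(A, B)\<in>min_splittings J. \<Sum>z\<in>crossings. if radon z A B then jump J z else 0)"
    unfolding crossing_number_def by (intro sum.cong) (auto simp: min_splittings_def)
  also have "\<dots> = (\<Sum>z\<in>crossings. \<Sum>(A, B)\<in>min_splittings J. if radon z A B then jump J z else 0)"
    unfolding case_prod_beta by (rule sum.swap)
  also have "\<dots> = (\<Sum>z\<in>crossings. jump J z)"
    unfolding sum_over_splittings[OF J] using jump_eq_0[OF J] by (intro sum.cong) auto
  also have "\<dots> = of_bool (chi J 1 > 0) - 1"
    by (rule sum_jump[OF J])
  finally show ?thesis .
qed

lemma degree_chi:
  assumes J: "J \<in> maximal"
  shows "degree (cpoly moment E (sorted_list_of_set J)) \<le> m - ell m J"
proof -
  let ?xs = "sorted_list_of_set J"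
  have finJ: "finite J" and J': "card J = m + 1"
    using J maximal_finite[of J] by (auto simp: maximal_def)
  have J_ne: "J \<noteq> {}" using J' by auto
  show ?thesis
  proof (cases "Min J \<le> m")
    case True
    have "degree (cpoly moment E ?xs) \<le> (\<Sum>j<length ?xs. of_bool (\<not> ?xs ! j \<le> m))"
      using fixed by (intro degree_cpoly_col) auto
    also have "\<dots> = (\<Sum>x\<in>J. of_bool (\<not> x \<le> m))"
      using finJ
      by (intro sum.reindex_bij_betw[where g = "\<lambda>x. of_bool (\<not> x \<le> m)"] bij_betw_nth) auto
    also have "\<dots> = card {x\<in>J. \<not> x \<le> m}"
      using finJ by (simp add: of_bool_def sum.If_cases Int_def)
    also have "\<dots> \<le> m - ell m J"
    proof -
      have "x \<noteq> Min J \<Longrightarrow> x \<in> J \<Longrightarrow> 1 \<le> x" for x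
        using finJ Min_le[of J x] by (cases x) auto
      then have "{x\<in>J. x \<le> m} = insert (Min J) ((J - {Min J}) \<inter> {1..m})"
        using True finJ Min_in[OF finJ J_ne] by auto
      then have "card {x\<in>J. x \<le> m} = Suc (ell m J)"
        using finJ by (simp add: ell_def)
      moreover have "card {x\<in>J. x \<le> m} + card {x\<in>J. \<not> x \<le> m} = card J"
      proof -
        have "{x\<in>J. x \<le> m} \<union> {x\<in>J. \<not> x \<le> m} = J" by auto
        moreover have "{x\<in>J. x \<le> m} \<inter> {x\<in>J. \<not> x \<le> m} = {}" by auto
        ultimately show ?thesis
          using finJ card_Un_disjoint[of "{x\<in>J. x \<le> m}" "{x\<in>J. \<not> x \<le> m}"] by simp
      qed
      ultimately show ?thesis using J' by simp
    qed
    finally show ?thesis .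
  next
    case False
    have "x \<notin> (J - {Min J}) \<inter> {1..m}" for x
      using False Min_le[OF finJ, of x] by auto
    then have "(J - {Min J}) \<inter> {1..m} = {}" by blast
    then have "ell m J = 0" by (simp add: ell_def)
    moreover have "degree (cpoly moment E ?xs) \<le> m"
    proof -
      have len: "length ?xs = Suc m" using J' by simp
      have "degree (cpoly moment E ?xs) \<le> (\<Sum>i<length ?xs. of_bool (i \<noteq> 0))"
        by (intro degree_cpoly_row) (auto simp: row_0)
      also have "\<dots> = m"
        unfolding len sum.lessThan_Suc_shift by simp
      finally show ?thesis .
    qed
    ultimately show ?thesis by simp
  qed
qed

lemma ell_le: "J \<in> maximal \<Longrightarrow> ell m J \<le> m"
proof -
  assume J: "J \<in> maximal"
  have "card ((J - {Min J}) \<inter> {1..m}) \<le> card {1..m}" by (intro card_mono) auto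
  then show ?thesis by (simp add: ell_def)
qed

lemma sum_abs_crossing_number:
  assumes J: "J \<in> maximal"
  shows "(\<Sum>(A, B)\<in>min_splittings J. \<bar>crossing_number A B\<bar>) \<le> int m - int (ell m J)"
proof -
  have "(\<Sum>(A, B)\<in>min_splittings J. \<bar>crossing_number A B\<bar>)
      \<le> (\<Sum>(A, B)\<in>min_splittings J. \<Sum>z\<in>crossings. if radon z A B then 1 else 0)"
    unfolding case_prod_beta crossing_number_def
    by (intro sum_mono order.trans[OF sum_abs]) (auto simp: jump_abs_le)
  also have "\<dots> = (\<Sum>z\<in>crossings. \<Sum>(A, B)\<in>min_splittings J. if radon z A B then 1 else 0)"
    unfolding case_prod_beta by (rule sum.swap)
  also have "\<dots> = (\<Sum>z\<in>crossings. if chi J z = 0 then 1 else 0)"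
    unfolding sum_over_splittings[OF J] ..
  also have "\<dots> = int (card {z\<in>crossings. chi J z = 0})"
    using finite_crossings by (simp add: sum.If_cases Int_def)
  also have "\<dots> \<le> int (card {z. chi J z = 0})"
    unfolding of_nat_le_iff chi_def by (intro card_mono finite_homotopy_zeros) auto
  also have "\<dots> \<le> int (degree (cpoly moment E (sorted_list_of_set J)))"
    unfolding of_nat_le_iff chi_poly by (intro card_poly_roots_bound cpoly_moment_nonzero) simp
  also have "\<dots> \<le> int (m - ell m J)"
    using degree_chi[OF J] by simp
  finally show ?thesis using ell_le[OF J] by simp
qed

end

section \<open>Generic realizations\<close>

definition homogenized :: "(nat \<Rightarrow> real vec) \<Rightarrow> nat \<Rightarrow> nat \<Rightarrow> real" where
  "homogenized f r v = (if r = 0 then 1 else f v $ (r - 1))"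

definition separated :: "nat \<Rightarrow> nat set set \<Rightarrow> (nat \<Rightarrow> nat \<Rightarrow> real) \<Rightarrow> bool" where
  "separated m K V \<longleftrightarrow> (\<forall>\<sigma>\<in>K. \<forall>\<tau>\<in>K. \<sigma> \<inter> \<tau> = {} \<longrightarrow>
     (\<forall>w. (\<forall>v. 0 \<le> w v) \<longrightarrow> (\<Sum>v\<in>\<sigma>. w v) = 1 \<longrightarrow> (\<Sum>v\<in>\<tau>. w v) = 1 \<longrightarrow>
       (\<exists>r\<le>m. (\<Sum>v\<in>\<sigma>. w v * V r v) \<noteq> (\<Sum>v\<in>\<tau>. w v * V r v))))"

lemma complex_on_finite:
  assumes "complex_on N K"
  shows "finite K" "\<sigma> \<in> K \<Longrightarrow> finite \<sigma>" "\<sigma> \<in> K \<Longrightarrow> \<sigma> \<subseteq> {0..N}" "\<sigma> \<in> K \<Longrightarrow> \<sigma> \<noteq> {}"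
proof -
  have sub: "\<sigma> \<subseteq> {0..N}" if "\<sigma> \<in> K" for \<sigma>
    using assms that unfolding complex_on_def by blast
  then show "\<sigma> \<in> K \<Longrightarrow> \<sigma> \<subseteq> {0..N}" "\<sigma> \<in> K \<Longrightarrow> finite \<sigma>"
    by (auto dest: finite_subset)
  show "finite K"
    by (rule finite_subset[of _ "Pow {0..N}"]) (use sub in auto)
  show "\<sigma> \<in> K \<Longrightarrow> \<sigma> \<noteq> {}" using assms unfolding complex_on_def by blast
qed

lemma geometric_realization_separated:
  assumes K: "complex_on N K" and f: "geometric_realization m N K f"
  shows "separated m K (homogenized f)"
  unfolding separated_def
proof (intro ballI impI allI)
  fix \<sigma> \<tau> w
  assume \<sigma>: "\<sigma> \<in> K" and \<tau>: "\<tau> \<in> K" and disj: "\<sigma> \<inter> \<tau> = {}" and w: "\<forall>v. 0 \<le> w v"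
    and sums: "(\<Sum>v\<in>\<sigma>. w v) = 1" "(\<Sum>v\<in>\<tau>. w v) = (1 :: real)"
  define x where "x \<rho> i = (if i \<in> \<rho> then w i else 0)" for \<rho> :: "nat set" and i
  have supp: "(\<Sum>i | x \<rho> i \<noteq> 0. x \<rho> i * g i) = (\<Sum>i\<in>\<rho>. w i * g i)" if "\<rho> \<in> K" for \<rho> g
  proof -
    have "(\<Sum>i\<in>\<rho>. w i * g i) = (\<Sum>i\<in>\<rho>. x \<rho> i * g i)" by (simp add: x_def)
    also have "\<dots> = (\<Sum>i | x \<rho> i \<noteq> 0. x \<rho> i * g i)"
      using complex_on_finite(2)[OF K that]
      by (intro sum.mono_neutral_right) (auto simp: x_def split: if_splits)
    finally show ?thesis ..
  qed
  have in_poly: "x \<rho> \<in> polyhedron_of K" if \<rho>: "\<rho> \<in> K" "(\<Sum>v\<in>\<rho>. w v) = 1" for \<rho>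
  proof -
    have "{i. x \<rho> i \<noteq> 0} \<noteq> {}"
      using supp[OF \<rho>(1), of "\<lambda>_. 1"] \<rho>(2) by force
    moreover have "{i. x \<rho> i \<noteq> 0} \<subseteq> \<rho>" by (auto simp: x_def)
    ultimately have "{i. x \<rho> i \<noteq> 0} \<in> K"
      using K \<rho>(1) unfolding complex_on_def by blast
    then show ?thesis
      using supp[OF \<rho>(1), of "\<lambda>_. 1"] \<rho>(2) w by (auto simp: polyhedron_of_def x_def)
  qed
  show "\<exists>r\<le>m. (\<Sum>v\<in>\<sigma>. w v * homogenized f r v) \<noteq> (\<Sum>v\<in>\<tau>. w v * homogenized f r v)"
  proof (rule ccontr)
    assume "\<not> ?thesis"
    then have eq: "(\<Sum>v\<in>\<sigma>. w v * homogenized f r v) = (\<Sum>v\<in>\<tau>. w v * homogenized f r v)"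
      if "r \<le> m" for r using that by blast
    have "affine_extension m f (x \<sigma>) = affine_extension m f (x \<tau>)"
      unfolding affine_extension_def supp[OF \<sigma>] supp[OF \<tau>]
    proof (rule eq_vecI)
      fix k assume "k < dim_vec (vec m (\<lambda>k. \<Sum>v\<in>\<tau>. w v * f v $ k))"
      then show "vec m (\<lambda>k. \<Sum>v\<in>\<sigma>. w v * f v $ k) $ k = vec m (\<lambda>k. \<Sum>v\<in>\<tau>. w v * f v $ k) $ k"
        using eq[of "Suc k"] by (simp add: homogenized_def)
    qed simp
    then have "x \<sigma> = x \<tau>"
      using f in_poly[OF \<sigma> sums(1)] in_poly[OF \<tau> sums(2)]
      unfolding geometric_realization_def by (auto dest: inj_onD)
    moreover obtain i where "i \<in> \<sigma>" "w i \<noteq> 0"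
      using sums(1) by (metis sum.neutral zero_neq_one)
    ultimately have "x \<sigma> i = x \<tau> i" "i \<notin> \<tau>" using disj by auto
    then show False using \<open>i \<in> \<sigma>\<close> \<open>w i \<noteq> 0\<close> by (simp add: x_def)
  qed
qed

lemma compact_weights: "compact {w :: nat \<Rightarrow> real. \<forall>v. 0 \<le> w v \<and> w v \<le> 1}"
proof -
  have "compactin (product_topology (\<lambda>_. euclidean) UNIV) (PiE UNIV (\<lambda>_ :: nat. {0..1 :: real}))"
    by (subst compactin_PiE) simp
  moreover have "PiE UNIV (\<lambda>_ :: nat. {0..1 :: real}) = {w. \<forall>v. 0 \<le> w v \<and> w v \<le> 1}"
    by (auto simp: PiE_def Pi_def)
  ultimately show ?thesis by (simp add: euclidean_product_topology)
qed

lemma separated_pair_open: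
  fixes V :: "nat \<Rightarrow> nat \<Rightarrow> real"
  assumes fin: "finite \<sigma>" "finite \<tau>" and disj: "\<sigma> \<inter> \<tau> = {}"
    and sep: "\<And>w. \<forall>v. 0 \<le> w v \<Longrightarrow> (\<Sum>v\<in>\<sigma>. w v) = 1 \<Longrightarrow> (\<Sum>v\<in>\<tau>. w v) = 1 \<Longrightarrow>
      \<exists>r\<le>m. (\<Sum>v\<in>\<sigma>. w v * V r v) \<noteq> (\<Sum>v\<in>\<tau>. w v * V r v)"
  shows "\<exists>\<delta>>0. \<forall>V'. (\<forall>r\<le>m. \<forall>v\<in>\<sigma> \<union> \<tau>. \<bar>V' r v - V r v\<bar> \<le> \<delta>) \<longrightarrow>
    (\<forall>w. (\<forall>v. 0 \<le> w v) \<longrightarrow> (\<Sum>v\<in>\<sigma>. w v) = 1 \<longrightarrow> (\<Sum>v\<in>\<tau>. w v) = 1 \<longrightarrow>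
      (\<exists>r\<le>m. (\<Sum>v\<in>\<sigma>. w v * V' r v) \<noteq> (\<Sum>v\<in>\<tau>. w v * V' r v)))"
proof -
  define W where "W = {w :: nat \<Rightarrow> real. \<forall>v. 0 \<le> w v \<and> w v \<le> 1} \<inter>
    ({w. (\<Sum>v\<in>\<sigma>. w v) = 1} \<inter> {w. (\<Sum>v\<in>\<tau>. w v) = 1})"
  define g where "g w = (\<Sum>r\<le>m. \<bar>(\<Sum>v\<in>\<sigma>. w v * V r v) - (\<Sum>v\<in>\<tau>. w v * V r v)\<bar>)" for w
  have coord: "continuous_on UNIV (\<lambda>w :: nat \<Rightarrow> real. w v)" for v by simp
  have "closed ({w :: nat \<Rightarrow> real. (\<Sum>v\<in>\<sigma>. w v) = 1} \<inter> {w. (\<Sum>v\<in>\<tau>. w v) = 1})"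
    by (intro closed_Int closed_Collect_eq continuous_intros coord)
  then have "compact W"
    unfolding W_def by (intro compact_Int_closed compact_weights)
  moreover have "continuous_on W g"
    unfolding g_def
    by (rule continuous_on_subset[of UNIV]) (auto intro!: continuous_intros coord)
  ultimately have inf: "W = {} \<or> (\<exists>x\<in>W. \<forall>w\<in>W. g x \<le> g w)"
    using continuous_attains_inf by blast
  have pos: "g w > 0" if "w \<in> W" for w
  proof -
    have "\<forall>v. 0 \<le> w v" "(\<Sum>v\<in>\<sigma>. w v) = 1" "(\<Sum>v\<in>\<tau>. w v) = 1"
      using that by (auto simp: W_def)
    then obtain r where r: "r \<le> m" "(\<Sum>v\<in>\<sigma>. w v * V r v) \<noteq> (\<Sum>v\<in>\<tau>. w v * V r v)"
      using sep by blast
    then have "0 < \<bar>(\<Sum>v\<in>\<sigma>. w v * V r v) - (\<Sum>v\<in>\<tau>. w v * V r v)\<bar>" by simp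
    also have "\<dots> \<le> g w"
      unfolding g_def using r(1) by (intro member_le_sum) auto
    finally show ?thesis .
  qed
  have "\<exists>c>0. \<forall>w\<in>W. c \<le> g w"
  proof (cases "W = {}")
    case True
    then show ?thesis by (intro exI[of _ 1]) simp
  next
    case False
    then obtain x where "x \<in> W" "\<forall>w\<in>W. g x \<le> g w" using inf by blast
    then show ?thesis using pos by blast
  qed
  then obtain c where c: "c > 0" "\<And>w. w \<in> W \<Longrightarrow> c \<le> g w" by blast
  define \<delta> where "\<delta> = c / (2 * real (Suc m) + 1)"
  have \<delta>: "\<delta> > 0" using c(1) by (simp add: \<delta>_def)
  have "\<exists>r\<le>m. (\<Sum>v\<in>\<sigma>. w v * V' r v) \<noteq> (\<Sum>v\<in>\<tau>. w v * V' r v)"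
    if V': "\<forall>r\<le>m. \<forall>v\<in>\<sigma> \<union> \<tau>. \<bar>V' r v - V r v\<bar> \<le> \<delta>"
      and w: "\<forall>v. 0 \<le> w v" "(\<Sum>v\<in>\<sigma>. w v) = 1" "(\<Sum>v\<in>\<tau>. w v) = 1" for V' w
  proof (rule ccontr)
    assume "\<not> ?thesis"
    then have eq: "(\<Sum>v\<in>\<sigma>. w v * V' r v) = (\<Sum>v\<in>\<tau>. w v * V' r v)" if "r \<le> m" for r
      using that by blast
    define w' where "w' v = (if v \<in> \<sigma> \<union> \<tau> then w v else 0)" for v
    have w'_sum: "(\<Sum>v\<in>\<sigma>. w' v * h v) = (\<Sum>v\<in>\<sigma>. w v * h v)" "(\<Sum>v\<in>\<tau>. w' v * h v) = (\<Sum>v\<in>\<tau>. w v * h v)"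
      for h by (auto simp: w'_def intro!: sum.cong)
    have "w v \<le> 1" if "v \<in> \<sigma> \<union> \<tau>" for v
      using that member_le_sum[of v \<sigma> w] member_le_sum[of v \<tau> w] fin w by auto
    then have "w' \<in> W"
      using w w'_sum[of "\<lambda>_. 1"] unfolding W_def by (auto simp: w'_def)
    then have "c \<le> g w'" by (rule c(2))
    also have "g w' = g w" unfolding g_def w'_sum ..
    also have "g w \<le> (\<Sum>r\<le>m. 2 * \<delta>)"
      unfolding g_def
    proof (rule sum_mono)
      fix r assume "r \<in> {..m}"
      then have r: "r \<le> m" by simp
      have diff: "\<bar>(\<Sum>v\<in>\<rho>. w v * V r v) - (\<Sum>v\<in>\<rho>. w v * V' r v)\<bar> \<le> \<delta>"
        if \<rho>: "\<rho> \<subseteq> \<sigma> \<union> \<tau>" "(\<Sum>v\<in>\<rho>. w v) = 1" for \<rho>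
      proof -
        have "\<bar>(\<Sum>v\<in>\<rho>. w v * V r v) - (\<Sum>v\<in>\<rho>. w v * V' r v)\<bar> = \<bar>\<Sum>v\<in>\<rho>. w v * (V r v - V' r v)\<bar>"
          by (simp add: sum_subtractf right_diff_distrib)
        also have "\<dots> \<le> (\<Sum>v\<in>\<rho>. \<bar>w v * (V r v - V' r v)\<bar>)" by (rule sum_abs)
        also have "\<dots> \<le> (\<Sum>v\<in>\<rho>. w v * \<delta>)"
        proof (rule sum_mono)
          fix v assume "v \<in> \<rho>"
          then have "\<bar>V r v - V' r v\<bar> \<le> \<delta>"
            using V' r \<rho>(1) by (subst abs_minus_commute) blast
          then show "\<bar>w v * (V r v - V' r v)\<bar> \<le> w v * \<delta>"
            using w(1) by (simp add: abs_mult mult_left_mono)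
        qed
        also have "\<dots> = \<delta>" using \<rho>(2) by (simp flip: sum_distrib_right)
        finally show ?thesis .
      qed
      show "\<bar>(\<Sum>v\<in>\<sigma>. w v * V r v) - (\<Sum>v\<in>\<tau>. w v * V r v)\<bar> \<le> 2 * \<delta>"
        using diff[of \<sigma>] diff[of \<tau>] eq[OF r] w(2,3) by auto
    qed
    also have "\<dots> = 2 * real (Suc m) * \<delta>" by simp
    also have "\<dots> < c"
      using c(1) by (simp add: \<delta>_def field_simps)
    finally show False by simp
  qed
  then show ?thesis using \<delta> by blast
qed

lemma separated_open:
  assumes K: "complex_on N K" and sep: "separated m K V"
  shows "\<exists>\<delta>>0. \<forall>V'. (\<forall>r\<le>m. \<forall>v\<le>N. \<bar>V' r v - V r v\<bar> \<le> \<delta>) \<longrightarrow> separated m K V'"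
proof -
  define P where "P = {(\<sigma>, \<tau>) \<in> K \<times> K. \<sigma> \<inter> \<tau> = {}}"
  define Q where "Q \<delta> p \<longleftrightarrow> \<delta> > 0 \<and> (\<forall>V'. (\<forall>r\<le>m. \<forall>v\<in>fst p \<union> snd p. \<bar>V' r v - V r v\<bar> \<le> \<delta>) \<longrightarrow>
    (\<forall>w. (\<forall>v. 0 \<le> w v) \<longrightarrow> (\<Sum>v\<in>fst p. w v) = 1 \<longrightarrow> (\<Sum>v\<in>snd p. w v) = 1 \<longrightarrow>
      (\<exists>r\<le>m. (\<Sum>v\<in>fst p. w v * V' r v) \<noteq> (\<Sum>v\<in>snd p. w v * V' r v))))"
    for \<delta> :: real and p
  have "\<exists>\<delta>. Q \<delta> p" if "p \<in> P" for p
  proof -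
    obtain \<sigma> \<tau> where p: "p = (\<sigma>, \<tau>)" "\<sigma> \<in> K" "\<tau> \<in> K" "\<sigma> \<inter> \<tau> = {}" using \<open>p \<in> P\<close> by (auto simp: P_def)
    have "\<exists>r\<le>m. (\<Sum>v\<in>\<sigma>. w v * V r v) \<noteq> (\<Sum>v\<in>\<tau>. w v * V r v)"
      if "\<forall>v. 0 \<le> w v" "(\<Sum>v\<in>\<sigma>. w v) = 1" "(\<Sum>v\<in>\<tau>. w v) = 1" for w
      using sep p(2-4) that unfolding separated_def by blast
    from separated_pair_open[OF complex_on_finite(2)[OF K p(2)] complex_on_finite(2)[OF K p(3)] p(4) this]
    show ?thesis unfolding Q_def p(1) fst_conv snd_conv .
  qed
  then obtain d where d: "\<And>p. p \<in> P \<Longrightarrow> Q (d p) p" by metis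
  have finP: "finite P"
    by (rule finite_subset[of _ "K \<times> K"]) (auto simp: P_def complex_on_finite(1)[OF K])
  define \<delta> where "\<delta> = Min (insert 1 (d ` P))"
  have "\<delta> > 0"
    using finP d by (auto simp: \<delta>_def Q_def)
  moreover have "separated m K V'" if V': "\<forall>r\<le>m. \<forall>v\<le>N. \<bar>V' r v - V r v\<bar> \<le> \<delta>" for V'
    unfolding separated_def
  proof (intro ballI impI allI)
    fix \<sigma> \<tau> w
    assume *: "\<sigma> \<in> K" "\<tau> \<in> K" "\<sigma> \<inter> \<tau> = {}" "\<forall>v. 0 \<le> w v" "(\<Sum>v\<in>\<sigma>. w v) = 1" "(\<Sum>v\<in>\<tau>. w v) = (1 :: real)"
    then have p: "(\<sigma>, \<tau>) \<in> P" by (auto simp: P_def)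
    have "\<delta> \<le> d (\<sigma>, \<tau>)" using finP p by (auto simp: \<delta>_def)
    moreover have "v \<le> N" if "v \<in> \<sigma> \<union> \<tau>" for v
      using that complex_on_finite(3)[OF K *(1)] complex_on_finite(3)[OF K *(2)] by auto
    ultimately have "\<forall>r\<le>m. \<forall>v\<in>\<sigma> \<union> \<tau>. \<bar>V' r v - V r v\<bar> \<le> d (\<sigma>, \<tau>)"
      using V' by (meson order.trans)
    then show "\<exists>r\<le>m. (\<Sum>v\<in>\<sigma>. w v * V' r v) \<noteq> (\<Sum>v\<in>\<tau>. w v * V' r v)"
      using d[OF p] * unfolding Q_def fst_conv snd_conv by blast
  qed
  ultimately show ?thesis by blast
qed

lemma separated_general_position:
  assumes K: "complex_on N K" and sep: "separated m K V" and row_0: "\<And>v. V 0 v = 1"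
  shows "\<exists>V'. separated m K V' \<and> (\<forall>v. V' 0 v = 1) \<and> cdet V' [0..<Suc m] \<noteq> 0"
proof -
  obtain \<delta> where \<delta>: "\<delta> > 0" "\<And>V'. \<forall>r\<le>m. \<forall>v\<le>N. \<bar>V' r v - V r v\<bar> \<le> \<delta> \<Longrightarrow> separated m K V'"
    using separated_open[OF K sep] by blast
  define D where "D r v = moment r v - V r v" for r v
  define M where "M = (\<Sum>r\<le>m. \<Sum>v\<le>N. \<bar>D r v\<bar>)"
  have M: "\<bar>D r v\<bar> \<le> M" if "r \<le> m" "v \<le> N" for r v
  proof -
    have "\<bar>D r v\<bar> \<le> (\<Sum>v\<le>N. \<bar>D r v\<bar>)" using that by (intro member_le_sum) auto
    also have "\<dots> \<le> M" unfolding M_def using that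
      by (intro member_le_sum[of r "{..m}" "\<lambda>r. \<Sum>v\<le>N. \<bar>D r v\<bar>"]) (auto intro: sum_nonneg)
    finally show ?thesis .
  qed
  then have M0: "M \<ge> 0" using order.trans[OF abs_ge_zero M[of 0 0]] by simp
  have "poly (cpoly V D [0..<Suc m]) 1 = cdet moment [0..<Suc m]"
    unfolding poly_cpoly by (intro cdet_cong) (simp add: D_def)
  then have "cpoly V D [0..<Suc m] \<noteq> 0"
    using vandermonde_nonzero[of "[0..<Suc m]"] by force
  then have "finite {s. poly (cpoly V D [0..<Suc m]) s = 0}" by (rule poly_roots_finite)
  moreover have "infinite {0<..<\<delta> / (M + 1)}"
    using \<delta>(1) M0 by (intro infinite_Ioo) simp
  ultimately obtain s where s: "s \<in> {0<..<\<delta> / (M + 1)}" "poly (cpoly V D [0..<Suc m]) s \<noteq> 0"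
    by (metis (mono_tags, lifting) finite_subset mem_Collect_eq subsetI)
  define V' where "V' r v = V r v + s * D r v" for r v
  have "separated m K V'"
  proof (rule \<delta>(2), intro allI impI)
    fix r v assume "r \<le> m" "v \<le> N"
    have "\<bar>V' r v - V r v\<bar> = s * \<bar>D r v\<bar>" using s by (simp add: V'_def abs_mult)
    also have "\<dots> \<le> s * (M + 1)" using M[OF \<open>r \<le> m\<close> \<open>v \<le> N\<close>] s by (intro mult_left_mono) auto
    also have "\<dots> \<le> \<delta>" using s M0 by (simp add: field_simps)
    finally show "\<bar>V' r v - V r v\<bar> \<le> \<delta>" .
  qed
  moreover have "V' 0 v = 1" for v by (simp add: V'_def D_def row_0 moment_def)
  moreover have "cdet V' [0..<Suc m] \<noteq> 0"
    using s(2) unfolding poly_cpoly V'_def .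
  ultimately show ?thesis by blast
qed

lemma nonzero_det_inverse:
  fixes A :: "'a :: field mat"
  assumes "A \<in> carrier_mat n n" "det A \<noteq> 0"
  shows "\<exists>B\<in>carrier_mat n n. A * B = 1\<^sub>m n \<and> B * A = 1\<^sub>m n"
  using det_non_zero_imp_unit[OF assms, of undefined]
  by (auto simp: Units_def ring_mat_def)

lemma separated_normalize:
  assumes sep: "separated m K V" and row_0: "\<And>v. V 0 v = 1" and det: "cdet V [0..<Suc m] \<noteq> 0"
  shows "\<exists>V'. separated m K V' \<and> (\<forall>v. V' 0 v = 1) \<and> (\<forall>r. \<forall>v\<le>m. V' r v = moment r v)"
proof -
  let ?n = "Suc m"
  define M where "M = mat ?n ?n (\<lambda>(i, j). V i j)"
  define C where "C = mat ?n ?n (\<lambda>(i, j). moment i j)"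
  have MC: "M \<in> carrier_mat ?n ?n" "C \<in> carrier_mat ?n ?n" by (auto simp: M_def C_def)
  have as_cdet: "mat ?n ?n (\<lambda>(i, j). W i j) = mat (length [0..<?n]) (length [0..<?n]) (\<lambda>(i, j). W i ([0..<?n] ! j))"
    for W :: "nat \<Rightarrow> nat \<Rightarrow> real"
    by (rule eq_matI) (auto simp del: upt_Suc)
  have "det M \<noteq> 0" "det C \<noteq> 0"
    using det vandermonde_nonzero[of "[0..<?n]"] unfolding M_def C_def as_cdet cdet_def by auto
  then obtain Mi Ci where Mi: "Mi \<in> carrier_mat ?n ?n" "M * Mi = 1\<^sub>m ?n" "Mi * M = 1\<^sub>m ?n"
    and Ci: "Ci \<in> carrier_mat ?n ?n" "C * Ci = 1\<^sub>m ?n" "Ci * C = 1\<^sub>m ?n"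
    using nonzero_det_inverse MC by metis
  define T where "T = C * Mi"
  define S where "S = M * Ci"
  have TS: "T \<in> carrier_mat ?n ?n" "S \<in> carrier_mat ?n ?n" using MC Mi Ci by (auto simp: T_def S_def)
  have TM: "T * M = C"
    unfolding T_def using MC Mi by (metis assoc_mult_mat right_mult_one_mat)
  have ST: "S * T = 1\<^sub>m ?n"
  proof -
    have "S * T = M * (Ci * (C * Mi))"
      unfolding S_def T_def using MC Mi Ci by (intro assoc_mult_mat[of _ ?n ?n _ ?n _ ?n]) auto
    also have "Ci * (C * Mi) = (Ci * C) * Mi"
      using MC Mi Ci by (intro assoc_mult_mat[of _ ?n ?n _ ?n _ ?n, symmetric]) auto
    also have "M * \<dots> = 1\<^sub>m ?n" using Mi Ci by simp
    finally show ?thesis .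
  qed
  have entry: "(A * B) $$ (i, j) = (\<Sum>q<?n. A $$ (i, q) * B $$ (q, j))"
    if "A \<in> carrier_mat ?n ?n" "B \<in> carrier_mat ?n ?n" "i < ?n" "j < ?n" for A B :: "real mat" and i j
    using that by (simp add: scalar_prod_def atLeast0LessThan)
  define V' where "V' r v = (if r \<le> m then \<Sum>q<?n. T $$ (r, q) * V q v else moment r v)" for r v
  have recover: "V r v = (\<Sum>q<?n. S $$ (r, q) * V' q v)" if r: "r \<le> m" for r v
  proof -
    have "(\<Sum>q<?n. S $$ (r, q) * V' q v) = (\<Sum>q<?n. S $$ (r, q) * (\<Sum>p<?n. T $$ (q, p) * V p v))"
      by (intro sum.cong refl) (simp add: V'_def)
    also have "\<dots> = (\<Sum>q<?n. \<Sum>p<?n. S $$ (r, q) * T $$ (q, p) * V p v)"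
      by (simp only: sum_distrib_left mult.assoc)
    also have "\<dots> = (\<Sum>p<?n. \<Sum>q<?n. S $$ (r, q) * T $$ (q, p) * V p v)"
      by (rule sum.swap)
    also have "\<dots> = (\<Sum>p<?n. (S * T) $$ (r, p) * V p v)"
      using entry[OF TS(2,1), of r] r by (intro sum.cong refl) (simp only: sum_distrib_right lessThan_iff less_Suc_eq_le)
    also have "\<dots> = (\<Sum>p<?n. if p = r then V p v else 0)"
      unfolding ST using r by (intro sum.cong refl) auto
    also have "\<dots> = V r v" using r by simp
    finally show ?thesis ..
  qed
  have "V' 0 v = 1" for v
  proof -
    have T_row: "T $$ (0, q) = (if q = 0 then 1 else 0)" if "q < ?n" for q
    proof -
      have "T $$ (0, q) = (\<Sum>p<?n. C $$ (0, p) * Mi $$ (p, q))"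
        unfolding T_def using entry[OF MC(2) Mi(1), of 0 q] that by simp
      also have "\<dots> = (\<Sum>p<?n. M $$ (0, p) * Mi $$ (p, q))"
        by (intro sum.cong refl) (simp add: C_def M_def row_0 moment_def)
      also have "\<dots> = (M * Mi) $$ (0, q)"
        using entry[OF MC(1) Mi(1), of 0 q] that by simp
      finally show ?thesis unfolding Mi(2) using that by simp
    qed
    have "V' 0 v = (\<Sum>q<?n. T $$ (0, q) * V q v)"
      by (simp add: V'_def del: sum.lessThan_Suc)
    also have "\<dots> = (\<Sum>q<?n. if q = 0 then V q v else 0)"
      by (intro sum.cong refl) (use T_row in auto)
    finally show ?thesis using row_0 by (simp del: sum.lessThan_Suc)
  qed
  moreover have "V' r v = moment r v" if "v \<le> m" for r v
  proof (cases "r \<le> m")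
    case True
    then have "V' r v = (\<Sum>q<?n. T $$ (r, q) * M $$ (q, v))"
      using that by (simp add: V'_def M_def del: sum.lessThan_Suc)
    also have "\<dots> = C $$ (r, v)"
      using entry[OF TS(1) MC(1), of r v] True that TM by simp
    finally show ?thesis using True that by (simp add: C_def)
  qed (simp add: V'_def)
  moreover have "separated m K V'"
    unfolding separated_def
  proof (intro ballI impI allI)
    fix \<sigma> \<tau> w
    assume *: "\<sigma> \<in> K" "\<tau> \<in> K" "\<sigma> \<inter> \<tau> = {}" "\<forall>v. 0 \<le> w v" "(\<Sum>v\<in>\<sigma>. w v) = 1" "(\<Sum>v\<in>\<tau>. w v) = (1 :: real)"
    show "\<exists>r\<le>m. (\<Sum>v\<in>\<sigma>. w v * V' r v) \<noteq> (\<Sum>v\<in>\<tau>. w v * V' r v)"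
    proof (rule ccontr)
      assume "\<not> ?thesis"
      then have eq: "(\<Sum>v\<in>\<sigma>. w v * V' q v) = (\<Sum>v\<in>\<tau>. w v * V' q v)" if "q < ?n" for q
        using that by (simp add: less_Suc_eq_le)
      have expand: "(\<Sum>v\<in>\<rho>. w v * V r v) = (\<Sum>q<?n. S $$ (r, q) * (\<Sum>v\<in>\<rho>. w v * V' q v))"
        if "r \<le> m" for r \<rho>
      proof -
        have "(\<Sum>v\<in>\<rho>. w v * V r v) = (\<Sum>v\<in>\<rho>. \<Sum>q<?n. S $$ (r, q) * (w v * V' q v))"
          unfolding recover[OF that] sum_distrib_left by (intro sum.cong refl) simp
        also have "\<dots> = (\<Sum>q<?n. \<Sum>v\<in>\<rho>. S $$ (r, q) * (w v * V' q v))" by (rule sum.swap)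
        finally show ?thesis by (simp only: sum_distrib_left)
      qed
      have "(\<Sum>v\<in>\<sigma>. w v * V r v) = (\<Sum>v\<in>\<tau>. w v * V r v)" if "r \<le> m" for r
        unfolding expand[OF that] by (intro sum.cong refl) (simp only: eq lessThan_iff)
      then show False using sep * unfolding separated_def by blast
    qed
  qed
  ultimately show ?thesis by blast
qed

lemma generic_realization:
  assumes K: "complex_on N K" and f: "geometric_realization m N K f" and "m \<ge> 1"
  shows "\<exists>E. generic_homotopy m (max (N + 1) (m + 2)) E \<and> separated m K (homotopy E 1)"
proof -
  let ?n = "max (N + 1) (m + 2)"
  obtain V1 where V1: "separated m K V1" "\<forall>v. V1 0 v = 1" "cdet V1 [0..<Suc m] \<noteq> 0"
    using separated_general_position[OF K geometric_realization_separated[OF K f]]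
    by (auto simp: homogenized_def)
  then obtain V2 where V2: "separated m K V2" "\<forall>v. V2 0 v = 1" "\<forall>r. \<forall>v\<le>m. V2 r v = moment r v"
    using separated_normalize[of m K V1] by blast
  obtain \<delta> where \<delta>: "\<delta> > 0" "\<And>V'. \<forall>r\<le>m. \<forall>v\<le>N. \<bar>V' r v - V2 r v\<bar> \<le> \<delta> \<Longrightarrow> separated m K V'"
    using separated_open[OF K V2(1)] by blast
  define E0 where "E0 r v = V2 r v - moment r v" for r v
  have "\<exists>E'. (\<forall>i l. \<bar>E' i l - E0 i l\<bar> < \<delta>) \<and> (\<forall>i l. l \<le> m \<longrightarrow> E' i l = 0) \<and>
    (\<forall>l. E' 0 l = 0) \<and> generic_upto E' ?n m ?n"
    using V2 \<delta>(1) by (intro generic_perturbation) (auto simp: E0_def moment_def)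
  then obtain E where E: "\<forall>i l. \<bar>E i l - E0 i l\<bar> < \<delta>" "\<forall>i l. l \<le> m \<longrightarrow> E i l = 0"
    "\<forall>l. E 0 l = 0" "generic_upto E ?n m ?n" by blast
  have "\<bar>homotopy E 1 r v - V2 r v\<bar> \<le> \<delta>" for r v
  proof -
    have "homotopy E 1 r v - V2 r v = E r v - E0 r v" by (simp add: homotopy_def E0_def)
    then show ?thesis using E(1) by (simp add: less_imp_le)
  qed
  then have "separated m K (homotopy E 1)" using \<delta>(2) by blast
  moreover have "generic_homotopy m ?n E"
    using E assms(3) by unfold_locales auto
  ultimately show ?thesis by blast
qed

section \<open>The crossing cochain\<close>

lemma sum_faces:
  fixes g :: "nat set \<Rightarrow> int"
  assumes "finite \<sigma>" "\<sigma> \<noteq> {}"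
  shows "(\<Sum>i\<in>face_indices \<sigma>. (-1) ^ i * g (face \<sigma> i))
    = (if card \<sigma> = 1 then 0 else \<Sum>v\<in>\<sigma>. (-1) ^ card {x\<in>\<sigma>. x < v} * g (\<sigma> - {v}))"
proof (cases "card \<sigma> = 1")
  case True
  then show ?thesis by (simp add: face_indices_def sdim_def)
next
  case False
  let ?xs = "sorted_list_of_set \<sigma>"
  have "card \<sigma> > 1" using assms False card_gt_0_iff[of \<sigma>] by linarith
  then have idx: "face_indices \<sigma> = {..<card \<sigma>}"
    by (auto simp: face_indices_def sdim_def)
  have bij: "bij_betw ((!) ?xs) {..<card \<sigma>} \<sigma>"
    using assms by (intro bij_betw_nth) auto
  have "(\<Sum>v\<in>\<sigma>. (-1) ^ card {x\<in>\<sigma>. x < v} * g (\<sigma> - {v}))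
      = (\<Sum>i<card \<sigma>. (-1) ^ card {x\<in>\<sigma>. x < ?xs ! i} * g (\<sigma> - {?xs ! i}))"
    by (rule sum.reindex_bij_betw[OF bij, symmetric])
  also have "\<dots> = (\<Sum>i<card \<sigma>. (-1) ^ i * g (face \<sigma> i))"
    using sorted_list_remove_nth(1)[OF assms(1)] by (intro sum.cong refl) (simp add: face_def)
  finally show ?thesis using False idx by simp
qed

lemma coboundary_shuffle:
  fixes u X
  assumes fin: "finite A" "finite B" and disj: "A \<inter> B = {}" and ne: "A \<noteq> {}" "B \<noteq> {}"
    and left: "\<And>v. v \<in> A \<Longrightarrow> card A \<noteq> 1 \<Longrightarrow> u (A - {v}, B) = shuffle_sign (A - {v}, B) * X (A - {v}) B"
    and right: "\<And>v. v \<in> B \<Longrightarrow> card B \<noteq> 1 \<Longrightarrow> u (A, B - {v}) = shuffle_sign (A, B - {v}) * X A (B - {v})"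
    and empty: "X {} B = 0" "X A {} = 0"
  shows "coboundary u (A, B) = shuffle_sign (A, B) *
    ((\<Sum>v\<in>A. (-1) ^ card {x\<in>A \<union> B. x < v} * X (A - {v}) B)
      - (\<Sum>v\<in>B. (-1) ^ card {x\<in>A \<union> B. x < v} * X A (B - {v})))"
proof -
  have cancel: "(-1) ^ k * (s * (-1) ^ l * x) = s * ((-1) ^ (k + l) * x)" for k l and s x :: int
    by (simp add: power_add)
  have 1: "(\<Sum>i\<in>face_indices A. (-1) ^ i * u (face A i, B))
      = shuffle_sign (A, B) * (\<Sum>v\<in>A. (-1) ^ card {x\<in>A \<union> B. x < v} * X (A - {v}) B)"
  proof (cases "card A = 1")
    case True
    then obtain a where "A = {a}" by (auto simp: card_1_singleton_iff)
    then show ?thesis using sum_faces[OF fin(1) ne(1), of "\<lambda>A. u (A, B)"] empty by simp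
  next
    case False
    show ?thesis
      unfolding sum_faces[OF fin(1) ne(1), of "\<lambda>A. u (A, B)"] sum_distrib_left if_not_P[OF False]
      by (intro sum.cong refl, subst left[OF _ False], assumption,
          subst shuffle_sign_remove_left[OF fin disj], assumption, subst cancel)
         (simp only: card_less_Un[OF fin disj])
  qed
  have 2: "(\<Sum>j\<in>face_indices B. (-1) ^ (sdim A + j) * u (A, face B j))
      = - (shuffle_sign (A, B) * (\<Sum>v\<in>B. (-1) ^ card {x\<in>A \<union> B. x < v} * X A (B - {v})))"
  proof -
    have "(\<Sum>j\<in>face_indices B. (-1) ^ (sdim A + j) * u (A, face B j))
        = (-1) ^ sdim A * (\<Sum>j\<in>face_indices B. (-1) ^ j * u (A, face B j))"
      by (simp add: sum_distrib_left power_add mult.assoc)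
    also have "\<dots> = - (shuffle_sign (A, B) * (\<Sum>v\<in>B. (-1) ^ card {x\<in>A \<union> B. x < v} * X A (B - {v})))"
    proof (cases "card B = 1")
      case True
      then obtain b where "B = {b}" by (auto simp: card_1_singleton_iff)
      then show ?thesis using sum_faces[OF fin(2) ne(2), of "\<lambda>B. u (A, B)"] empty by simp
    next
      case False
      have "(-1) ^ sdim A * ((-1) ^ card {x\<in>B. x < v} * u (A, B - {v}))
          = - (shuffle_sign (A, B) * ((-1) ^ card {x\<in>A \<union> B. x < v} * X A (B - {v})))"
        if v: "v \<in> B" for v
      proof -
        have "v \<notin> A" using v disj by blast
        from prod_sgn_diff(3)[OF fin(1) this]
        have cardA: "card {x\<in>A. v < x} + card {x\<in>A. x < v} = Suc (sdim A)"
          using fin(1) ne(1) card_gt_0_iff[of A] by (simp add: sdim_def)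
        have "(-1 :: int) ^ sdim A * (-1) ^ card {x\<in>A. v < x} = - ((-1) ^ card {x\<in>A. x < v})"
        proof -
          have "(-1 :: int) ^ (card {x\<in>A. v < x} + card {x\<in>A. x < v}) = - ((-1) ^ sdim A)"
            unfolding cardA by simp
          then show ?thesis
            by (cases "even (card {x\<in>A. v < x})"; cases "even (card {x\<in>A. x < v})"; cases "even (sdim A)") auto
        qed
        then have "(-1) ^ sdim A * (-1) ^ card {x\<in>A. v < x} * ((-1) ^ card {x\<in>B. x < v} * shuffle_sign (A, B) * X A (B - {v}))
            = - ((-1) ^ card {x\<in>A. x < v}) * ((-1) ^ card {x\<in>B. x < v} * shuffle_sign (A, B) * X A (B - {v}))"
          by simp
        then show ?thesis
          unfolding right[OF v False] shuffle_sign_remove_right[OF fin disj v] card_less_Un[OF fin disj] power_add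
          by (simp add: mult_ac)
      qed
      then show ?thesis
        unfolding sum_faces[OF fin(2) ne(2), of "\<lambda>B. u (A, B)"] sum_distrib_left if_not_P[OF False]
        by (simp add: sum_negf[symmetric])
    qed
    finally show ?thesis .
  qed
  show ?thesis
    unfolding coboundary_def using 1 2 by (simp add: right_diff_distrib)
qed

lemma dp_cells_skeleton_iff:
  "(A, B) \<in> dp_cells k (simplex_skeleton m N) \<longleftrightarrow>
    A \<noteq> {} \<and> B \<noteq> {} \<and> A \<subseteq> {0..N} \<and> B \<subseteq> {0..N} \<and> A \<inter> B = {} \<and>
    sdim A \<le> m \<and> sdim B \<le> m \<and> card A + card B = k + 2"
proof (cases "A \<noteq> {} \<and> B \<noteq> {} \<and> A \<subseteq> {0..N} \<and> B \<subseteq> {0..N}")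
  case True
  then have "card A > 0" "card B > 0"
    using finite_subset[of _ "{0..N}"] by (auto simp: card_gt_0_iff)
  then have "sdim A + sdim B = k \<longleftrightarrow> card A + card B = k + 2"
    unfolding sdim_def by linarith
  then show ?thesis
    using True unfolding dp_cells_def deleted_product_def simplex_skeleton_def by auto
next
  case False
  then show ?thesis
    unfolding dp_cells_def deleted_product_def simplex_skeleton_def by auto
qed

lemma pair_bounds:
  fixes x :: "'c \<Rightarrow> int"
  assumes S: "finite S" "c \<in> S" and abs: "(\<Sum>c\<in>S. \<bar>x c\<bar>) \<le> int k"
    and sum: "-1 \<le> (\<Sum>c\<in>S. x c)" "(\<Sum>c\<in>S. x c) \<le> 0"
  shows "- \<lceil>real k / 2\<rceil> \<le> x c" "x c \<le> \<lfloor>real k / 2\<rfloor>"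
proof -
  define r where "r = (\<Sum>c\<in>S - {c}. x c)"
  have "\<bar>r\<bar> \<le> (\<Sum>c\<in>S - {c}. \<bar>x c\<bar>)" unfolding r_def by (rule sum_abs)
  then have r: "\<bar>r\<bar> + \<bar>x c\<bar> \<le> int k"
    using abs unfolding sum.remove[OF S] by simp
  have s: "-1 \<le> x c + r" "x c + r \<le> 0"
    using sum unfolding sum.remove[OF S] r_def by auto
  have up: "2 * x c \<le> int k" and down: "- 2 * x c \<le> int k + 1"
    using r s by linarith+
  show "x c \<le> \<lfloor>real k / 2\<rfloor>"
    using up by (simp add: le_floor_iff)
  have "of_int (- x c - 1) < real k / 2"
    using down by simp
  then have "- x c - 1 < \<lceil>real k / 2\<rceil>" by (simp only: less_ceiling_iff)
  then show "- \<lceil>real k / 2\<rceil> \<le> x c" by simp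
qed

lemma sum_face_indices_triple:
  fixes g :: "nat set \<Rightarrow> int"
  assumes "a < b" "b < c"
  shows "(\<Sum>j\<in>face_indices {a, b, c}. (-1) ^ j * g (face {a, b, c} j)) = g {b, c} - g {a, c} + g {a, b}"
proof -
  have xs: "sorted_list_of_set {a, b, c} = [a, b, c]"
    using assms by (intro sorted_distinct_set_unique) auto
  have "face_indices {a, b, c} = {0, 1, 2}"
    using assms by (auto simp: face_indices_def sdim_def)
  moreover have "{a, b, c} - {a} = {b, c}" "{a, b, c} - {b} = {a, c}" "{a, b, c} - {c} = {a, b}"
    using assms by auto
  ultimately show ?thesis by (simp add: face_def xs)
qed

lemma sum_face_indices_pair:
  fixes g :: "nat set \<Rightarrow> int"
  assumes "a < b"
  shows "(\<Sum>j\<in>face_indices {a, b}. (-1) ^ j * g (face {a, b} j)) = g {b} - g {a}"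
proof -
  have xs: "sorted_list_of_set {a, b} = [a, b]"
    using assms by (intro sorted_distinct_set_unique) auto
  have "face_indices {a, b} = {0, 1}"
    using assms by (auto simp: face_indices_def sdim_def)
  moreover have "{a, b} - {a} = {b}" "{a, b} - {b} = {a}"
    using assms by auto
  ultimately show ?thesis by (simp add: face_def xs)
qed

lemma obtain_triple:
  assumes "card (T :: nat set) = 3"
  obtains a b c where "a < b" "b < c" "T = {a, b, c}"
proof -
  have fin: "finite T" using assms by (metis card.infinite zero_neq_numeral)
  let ?xs = "sorted_list_of_set T"
  have "\<exists>a b c. xs = [a, b, c]" if "length xs = 3" for xs :: "nat list"
    using that by (auto simp: length_Suc_conv numeral_3_eq_3)
  moreover have "length ?xs = 3" using assms by simp
  ultimately obtain a b c where xs: "?xs = [a, b, c]" by blast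
  have "sorted_wrt (<) ?xs" "set ?xs = T" using fin by auto
  then show ?thesis using that[of a b c] unfolding xs by auto
qed

text \<open>The terms with \<open>\<partial>\<partial>\<tau>\<close> cancel.\<close>

lemma eval_bd_bd_triangle:
  assumes "a < b" "b < c"
  shows "eval_bd_bd u \<sigma> {a, b, c}
    = coboundary u (\<sigma>, {b, c}) - coboundary u (\<sigma>, {a, c}) + coboundary u (\<sigma>, {a, b})"
proof -
  let ?G = "\<lambda>\<tau>. \<Sum>i\<in>face_indices \<sigma>. (-1) ^ i * u (face \<sigma> i, \<tau>)"
  have cob: "coboundary u (\<sigma>, {x, y}) = ?G {x, y} + (-1) ^ sdim \<sigma> * (u (\<sigma>, {y}) - u (\<sigma>, {x}))"
    if "x < y" for x y
  proof -
    have "(\<Sum>j\<in>face_indices {x, y}. (-1) ^ (sdim \<sigma> + j) * u (\<sigma>, face {x, y} j))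
        = (-1) ^ sdim \<sigma> * (\<Sum>j\<in>face_indices {x, y}. (-1) ^ j * u (\<sigma>, face {x, y} j))"
      by (simp add: sum_distrib_left power_add mult.assoc)
    then show ?thesis
      unfolding coboundary_def using sum_face_indices_pair[OF that, of "\<lambda>\<tau>. u (\<sigma>, \<tau>)"] by simp
  qed
  have "eval_bd_bd u \<sigma> {a, b, c}
      = (\<Sum>j\<in>face_indices {a, b, c}. \<Sum>i\<in>face_indices \<sigma>. (-1) ^ (i + j) * u (face \<sigma> i, face {a, b, c} j))"
    unfolding eval_bd_bd_def by (rule sum.swap)
  also have "\<dots> = (\<Sum>j\<in>face_indices {a, b, c}. (-1) ^ j * ?G (face {a, b, c} j))"
    by (simp add: sum_distrib_left power_add mult_ac)
  also have "\<dots> = ?G {b, c} - ?G {a, c} + ?G {a, b}"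
    by (rule sum_face_indices_triple[OF assms, of ?G])
  finally show ?thesis
    unfolding cob[OF assms(1)] cob[OF assms(2)] cob[OF less_trans[OF assms]]
    by (simp add: algebra_simps)
qed

context generic_homotopy
begin

lemma homotopy_0: "homotopy E 0 = moment"
  by (simp add: homotopy_def fun_eq_iff)

definition target_cocycle :: "nat set \<times> nat set \<Rightarrow> int" where
  "target_cocycle = (\<lambda>(A, B). shuffle_sign (A, B) * split_sign (circuit (A \<union> B) 1) A B)"

definition crossing_cochain :: "nat \<Rightarrow> nat set \<times> nat set \<Rightarrow> int" where
  "crossing_cochain N = (\<lambda>(A, B). if (A, B) \<in> dp_cells (m - 1) (simplex_skeleton m N)
     then shuffle_sign (A, B) * crossing_number A B else 0)"

lemma crossing_cochain_cochains: "crossing_cochain N \<in> cochains (m - 1) (simplex_skeleton m N)"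
  by (auto simp: crossing_cochain_def cochains_def)

lemma crossing_cochain_cell:
  "(A, B) \<in> dp_cells (m - 1) (simplex_skeleton m N) \<Longrightarrow>
    crossing_cochain N (A, B) = shuffle_sign (A, B) * crossing_number A B"
  by (simp add: crossing_cochain_def)

lemma crossing_cochain_swap:
  assumes c: "(A, B) \<in> dp_cells (m - 1) (simplex_skeleton m N)"
  shows "crossing_cochain N (A, B) = (-1) ^ ((sdim A + 1) * (sdim B + 1)) * crossing_cochain N (B, A)"
proof -
  have c': "(B, A) \<in> dp_cells (m - 1) (simplex_skeleton m N)"
    using c by (auto simp: dp_cells_skeleton_iff)
  have AB: "finite A" "finite B" "A \<inter> B = {}" "A \<noteq> {}" "B \<noteq> {}"
    using c by (auto simp: dp_cells_skeleton_iff dest: finite_subset)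
  then have "sdim A + 1 = card A" "sdim B + 1 = card B"
    using card_gt_0_iff[of A] card_gt_0_iff[of B] by (auto simp: sdim_def)
  then show ?thesis
    unfolding crossing_cochain_cell[OF c] crossing_cochain_cell[OF c'] shuffle_sign_swap[OF AB(1-3)]
      crossing_number_swap[of B A]
    by (simp flip: power_add mult_2 mult.assoc)
qed

lemma coboundary_crossing_cochain:
  assumes c: "(A, B) \<in> dp_cells m (simplex_skeleton m N)" and N: "N < n"
  shows "coboundary (crossing_cochain N) (A, B) = target_cocycle (A, B) - cyclic_cocycle m (A, B)"
proof -
  have AB: "finite A" "finite B" "A \<inter> B = {}" "A \<noteq> {}" "B \<noteq> {}" "card A + card B = m + 2"
    and sub: "A \<subseteq> {0..N}" "B \<subseteq> {0..N}" and dims: "sdim A \<le> m" "sdim B \<le> m"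
    using c by (auto simp: dp_cells_skeleton_iff dest: finite_subset)
  have L: "circuit_support (A \<union> B)"
    using AB sub N by (auto simp: circuit_support_def card_Un_disjoint)
  have rem: "C - {v} \<noteq> {}" "card (C - {v}) = card C - 1" "sdim (C - {v}) \<le> sdim C"
    if "v \<in> C" "finite C" "card C \<noteq> 1" for v and C :: "nat set"
  proof -
    show "card (C - {v}) = card C - 1" using that by simp
    then have "card (C - {v}) \<noteq> 0" using that by (metis Suc_pred' card_gt_0_iff empty_iff One_nat_def)
    then show "C - {v} \<noteq> {}" by (metis card.empty)
    show "sdim (C - {v}) \<le> sdim C" using that by (simp add: sdim_def)
  qed
  have "coboundary (crossing_cochain N) (A, B) = shuffle_sign (A, B) *
    ((\<Sum>v\<in>A. (-1) ^ card {x\<in>A \<union> B. x < v} * crossing_number (A - {v}) B)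
      - (\<Sum>v\<in>B. (-1) ^ card {x\<in>A \<union> B. x < v} * crossing_number A (B - {v})))"
  proof (rule coboundary_shuffle[OF AB(1-5)])
    fix v assume v: "v \<in> A" "card A \<noteq> 1"
    have "card A > 0" using v(1) AB(1) by (auto simp: card_gt_0_iff)
    then have "(A - {v}, B) \<in> dp_cells (m - 1) (simplex_skeleton m N)"
      unfolding dp_cells_skeleton_iff
      using rem[OF v(1) AB(1) v(2)] AB sub dims v m by auto
    then show "crossing_cochain N (A - {v}, B) = shuffle_sign (A - {v}, B) * crossing_number (A - {v}) B"
      by (rule crossing_cochain_cell)
  next
    fix v assume v: "v \<in> B" "card B \<noteq> 1"
    have "card B > 0" using v(1) AB(2) by (auto simp: card_gt_0_iff)
    then have "(A, B - {v}) \<in> dp_cells (m - 1) (simplex_skeleton m N)"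
      unfolding dp_cells_skeleton_iff
      using rem[OF v(1) AB(2) v(2)] AB sub dims v m by auto
    then show "crossing_cochain N (A, B - {v}) = shuffle_sign (A, B - {v}) * crossing_number A (B - {v})"
      by (rule crossing_cochain_cell)
  qed (use AB crossing_number_empty in auto)
  also have "\<dots> = shuffle_sign (A, B) *
      (split_sign (circuit (A \<union> B) 1) A B - split_sign (circuit (A \<union> B) 0) A B)"
    unfolding split_sign_difference[OF L AB(3-5)] ..
  also have "\<dots> = target_cocycle (A, B) - cyclic_cocycle m (A, B)"
    unfolding cyclic_cocycle_split_sign[OF AB(1-3,6,4,5)]
    by (simp add: target_cocycle_def circuit_def homotopy_0 right_diff_distrib)
  finally show ?thesis .
qed

lemma target_cocycle_bounds:
  assumes "finite A" "finite B" "A \<inter> B = {}"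
  shows "target_cocycle (A, B) \<in> {-1, 0, 1}"
  using shuffle_sign_pm[OF assms] by (auto simp: target_cocycle_def split_sign_def)

lemma target_cocycle_separated:
  assumes sep: "separated m K (homotopy E 1)" and AB: "A \<in> K" "B \<in> K" "A \<inter> B = {}" "A \<noteq> {}"
    and L: "circuit_support (A \<union> B)"
  shows "target_cocycle (A, B) = 0"
proof -
  let ?a = "circuit (A \<union> B) 1"
  have fin: "finite A" "finite B" using circuit_support_finite[OF L] by auto
  have rel: "(\<Sum>v\<in>A. ?a v * conf 1 r v) = - (\<Sum>v\<in>B. ?a v * conf 1 r v)" if "r \<le> m" for r
    using circuit_relation[OF L that, of 1] fin AB(3)
    by (simp add: sum.union_disjoint eq_neg_iff_add_eq_0)
  have impossible: False
    if s: "\<forall>x\<in>A. s * ?a x > 0" "\<forall>x\<in>B. s * ?a x < 0" for s :: real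
  proof -
    define S where "S = (\<Sum>v\<in>A. s * ?a v)"
    have S: "S > 0" unfolding S_def using fin AB s by (intro sum_pos) auto
    define w where "w v = (if v \<in> A then s * ?a v / S else if v \<in> B then - s * ?a v / S else 0)" for v
    have wA: "w v = s / S * ?a v" if "v \<in> A" for v using that by (simp add: w_def)
    have wB: "w v = - (s / S * ?a v)" if "v \<in> B" for v using that AB by (auto simp: w_def)
    have nonneg: "\<forall>v. 0 \<le> w v"
      using s S by (auto simp: w_def less_imp_le divide_nonneg_pos divide_nonpos_pos)
    have eq: "(\<Sum>v\<in>A. w v * conf 1 r v) = (\<Sum>v\<in>B. w v * conf 1 r v)" if "r \<le> m" for r
    proof -
      have "(\<Sum>v\<in>A. w v * conf 1 r v) = s / S * (\<Sum>v\<in>A. ?a v * conf 1 r v)"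
        unfolding sum_distrib_left by (intro sum.cong refl) (simp add: wA)
      moreover have "(\<Sum>v\<in>B. w v * conf 1 r v) = - (s / S * (\<Sum>v\<in>B. ?a v * conf 1 r v))"
        unfolding sum_distrib_left sum_negf[symmetric] by (intro sum.cong refl) (simp add: wB)
      ultimately show ?thesis unfolding rel[OF that] by simp
    qed
    have "(\<Sum>v\<in>A. w v) = (\<Sum>v\<in>A. s * ?a v) / S"
      unfolding sum_divide_distrib by (intro sum.cong refl) (simp add: wA)
    then have sumA: "(\<Sum>v\<in>A. w v) = 1" using S by (simp add: S_def)
    then have "(\<Sum>v\<in>B. w v) = 1" using eq[of 0] by (simp add: conf_0)
    with sumA nonneg eq show False
      using sep AB unfolding separated_def by blast
  qed
  have no: "\<not> ((\<forall>x\<in>A. ?a x > 0) \<and> (\<forall>x\<in>B. ?a x < 0))" "\<not> ((\<forall>x\<in>A. ?a x < 0) \<and> (\<forall>x\<in>B. ?a x > 0))"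
    using impossible[of 1] impossible[of "-1"] by auto
  have "split_sign ?a A B = 0"
    by (simp only: split_sign_def if_not_P[OF no(1)] if_not_P[OF no(2)])
  then show ?thesis by (simp add: target_cocycle_def)
qed

text \<open>Up to a global sign, \<open>h\<close> records on which side of the hyperplane spanned by \<open>\<sigma>\<close>
  a vertex lies. A segment meeting \<open>\<sigma>\<close> has its end points on different sides.\<close>

lemma target_cocycle_edge:
  assumes L: "circuit_support (\<sigma> \<union> {x, y})" and xy: "x < y" "x \<notin> \<sigma>" "y \<notin> \<sigma>" and card: "card \<sigma> = m"
  defines "h \<equiv> \<lambda>v. of_int (shuffle_sign (\<sigma>, {v})) * sgn (chi (\<sigma> \<union> {v}) 1)"
  shows "target_cocycle (\<sigma>, {x, y}) \<noteq> 0 \<Longrightarrow>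
      of_int (target_cocycle (\<sigma>, {x, y})) = (-1) ^ m * h x \<and>
      of_int (target_cocycle (\<sigma>, {x, y})) = - ((-1) ^ m * h y)"
proof -
  assume nz: "target_cocycle (\<sigma>, {x, y}) \<noteq> 0"
  let ?L = "\<sigma> \<union> {x, y}"
  let ?a = "circuit ?L 1"
  have fin: "finite \<sigma>" using circuit_support_finite[OF L] by auto
  have disj: "\<sigma> \<inter> {x, y} = {}" using xy by auto
  have split: "split_sign ?a \<sigma> {x, y} \<noteq> 0" using nz by (auto simp: target_cocycle_def)
  then have sg: "of_int (split_sign ?a \<sigma> {x, y}) = - sgn (?a x)" "of_int (split_sign ?a \<sigma> {x, y}) = - sgn (?a y)"
    by (auto simp: split_sign_def split: if_splits)
  have cnt: "card {z\<in>{x, y}. z < x} = 0" "card {z\<in>{x, y}. z < y} = 1"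
  proof -
    have "{z\<in>{x, y}. z < x} = {}" "{z\<in>{x, y}. z < y} = {x}" using xy(1) by auto
    then show "card {z\<in>{x, y}. z < x} = 0" "card {z\<in>{x, y}. z < y} = 1" by simp_all
  qed
  have pos: "card {z\<in>?L. z < x} = card {z\<in>\<sigma>. z < x}" "card {z\<in>?L. z < y} = Suc (card {z\<in>\<sigma>. z < y})"
    using card_less_Un[OF fin _ disj, of x] card_less_Un[OF fin _ disj, of y] unfolding cnt by simp_all
  have rest: "?L - {x} = \<sigma> \<union> {y}" "?L - {y} = \<sigma> \<union> {x}" using xy by auto
  have a: "sgn (?a x) = (-1) ^ card {z\<in>\<sigma>. z < x} * sgn (chi (\<sigma> \<union> {y}) 1)"
    "sgn (?a y) = - ((-1) ^ card {z\<in>\<sigma>. z < y}) * sgn (chi (\<sigma> \<union> {x}) 1)"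
    unfolding circuit_eq pos rest by (simp_all add: sgn_mult)
  have s1: "shuffle_sign (\<sigma>, {v}) = (-1) ^ card {z\<in>\<sigma>. v < z}" if "v \<notin> \<sigma>" for v
    using prod_sgn_diff(1)[OF fin that] fin that by (subst shuffle_sign_eq) auto
  have s2: "shuffle_sign (\<sigma>, {x, y}) = shuffle_sign (\<sigma>, {x}) * shuffle_sign (\<sigma>, {y})"
    using fin xy disj by (subst (1 2 3) shuffle_sign_eq) (auto simp: prod.distrib)
  have total: "(-1 :: real) ^ card {z\<in>\<sigma>. v < z} * (-1) ^ card {z\<in>\<sigma>. z < v} = (-1) ^ m" if "v \<notin> \<sigma>" for v
    using prod_sgn_diff(3)[OF fin that] card by (simp flip: power_add)
  have "real_of_int (target_cocycle (\<sigma>, {x, y}))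
      = of_int (shuffle_sign (\<sigma>, {x})) * of_int (shuffle_sign (\<sigma>, {y})) * of_int (split_sign ?a \<sigma> {x, y})"
    by (simp add: target_cocycle_def s2)
  moreover have "of_int (shuffle_sign (\<sigma>, {x})) * of_int (shuffle_sign (\<sigma>, {y})) * - sgn (?a x)
      = - ((-1) ^ m * h y)"
    unfolding a h_def total[OF xy(2), symmetric] s1[OF xy(2)] by (simp add: mult_ac)
  moreover have "of_int (shuffle_sign (\<sigma>, {x})) * of_int (shuffle_sign (\<sigma>, {y})) * - sgn (?a y)
      = (-1) ^ m * h x"
    unfolding a h_def total[OF xy(3), symmetric] s1[OF xy(3)] by (simp add: mult_ac)
  ultimately show "of_int (target_cocycle (\<sigma>, {x, y})) = (-1) ^ m * h x \<and>
      of_int (target_cocycle (\<sigma>, {x, y})) = - ((-1) ^ m * h y)"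
    using sg by simp
qed

lemma target_cocycle_triangle:
  assumes abc: "a < b" "b < c" and \<sigma>: "\<sigma> \<inter> {a, b, c} = {}" "card \<sigma> = m" "\<sigma> \<union> {a, b, c} \<subseteq> {..<n}"
  shows "\<bar>target_cocycle (\<sigma>, {b, c}) - target_cocycle (\<sigma>, {a, c}) + target_cocycle (\<sigma>, {a, b})\<bar> \<le> 1"
proof -
  have fin: "finite \<sigma>" using \<sigma>(3) by (auto dest: finite_subset)
  have notin: "a \<notin> \<sigma>" "b \<notin> \<sigma>" "c \<notin> \<sigma>" using \<sigma>(1) by auto
  have L: "circuit_support (\<sigma> \<union> {x, y})" if "x \<in> {a, b, c}" "y \<in> {a, b, c}" "x < y" for x y
  proof -
    have "\<sigma> \<inter> {x, y} = {}" using that \<sigma>(1) by auto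
    then show ?thesis
      using that \<sigma>(2,3) fin by (auto simp: circuit_support_def card_Un_disjoint simp del: Un_insert_right)
  qed
  define h where "h v = (-1) ^ m * (of_int (shuffle_sign (\<sigma>, {v})) * sgn (chi (\<sigma> \<union> {v}) 1))" for v
  have edge: "target_cocycle (\<sigma>, {x, y}) = 0 \<or>
      of_int (target_cocycle (\<sigma>, {x, y})) = h x \<and> of_int (target_cocycle (\<sigma>, {x, y})) = - h y"
    if "x \<in> {a, b, c}" "y \<in> {a, b, c}" "x < y" for x y
    using target_cocycle_edge[OF L[OF that] that(3) _ _ \<sigma>(2)] that notin by (auto simp: h_def)
  have vals: "target_cocycle (\<sigma>, {x, y}) \<in> {-1, 0, 1}" if "x \<in> {a, b, c}" "y \<in> {a, b, c}" for x y
    using that \<sigma>(1) fin by (intro target_cocycle_bounds) auto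
  define p q r where "p = target_cocycle (\<sigma>, {b, c})" and "q = target_cocycle (\<sigma>, {a, c})"
    and "r = target_cocycle (\<sigma>, {a, b})"
  have "p = 0 \<or> of_int p = h b \<and> of_int p = - h c" "q = 0 \<or> of_int q = h a \<and> of_int q = - h c"
    "r = 0 \<or> of_int r = h a \<and> of_int r = - h b"
    using edge[of b c] edge[of a c] edge[of a b] abc unfolding p_def q_def r_def by auto
  moreover have "p \<in> {-1, 0, 1}" "q \<in> {-1, 0, 1}" "r \<in> {-1, 0, 1}"
    using vals unfolding p_def q_def r_def by blast+
  ultimately have "\<bar>p - q + r\<bar> \<le> 1"
    by (elim insertE emptyE) auto
  then show ?thesis by (simp add: p_def q_def r_def)
qed

lemma crossing_cochain_splittings:
  assumes J: "J \<subseteq> {0..N}" "card J = m + 1" and N: "N < n"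
  shows "(\<Sum>c\<in>splittings m N J. \<bar>crossing_cochain N c\<bar>) \<le> int m - int (ell m J)"
    and "- 1 \<le> (\<Sum>c\<in>splittings m N J. shuffle_sign c * crossing_cochain N c)"
    and "(\<Sum>c\<in>splittings m N J. shuffle_sign c * crossing_cochain N c) \<le> 0"
    and "c \<in> splittings m N J \<Longrightarrow>
      - \<lceil>(real m - real (ell m J)) / 2\<rceil> \<le> shuffle_sign c * crossing_cochain N c \<and>
      shuffle_sign c * crossing_cochain N c \<le> \<lfloor>(real m - real (ell m J)) / 2\<rfloor>"
proof -
  have Jmax: "J \<in> maximal" using J N by (auto simp: maximal_def)
  have finJ: "finite J" using J(1) by (rule finite_subset) simp
  have cell: "(A, B) \<in> dp_cells (m - 1) (simplex_skeleton m N)" if "(A, B) \<in> min_splittings J" for A B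
  proof -
    have AB: "A \<union> B = J" "A \<inter> B = {}" "A \<noteq> {}" "B \<noteq> {}" using that by (auto simp: min_splittings_def)
    then have "card A + card B = m + 1"
      using finJ J(2) by (metis card_Un_disjoint finite_Un)
    then show ?thesis
      unfolding dp_cells_skeleton_iff using AB J(1) m by (auto simp: sdim_def)
  qed
  have split: "splittings m N J = min_splittings J"
    using cell unfolding splittings_def min_splittings_def
    by (auto simp: dp_cells_skeleton_iff)
  have disj: "finite A" "finite B" "A \<inter> B = {}" if "(A, B) \<in> min_splittings J" for A B
    using that finJ by (auto simp: min_splittings_def)
  have signed: "shuffle_sign c * crossing_cochain N c = crossing_number (fst c) (snd c)"
    and unsigned: "\<bar>crossing_cochain N c\<bar> = \<bar>crossing_number (fst c) (snd c)\<bar>"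
    if "c \<in> min_splittings J" for c
  proof -
    obtain A B where c: "c = (A, B)" by (cases c)
    show "shuffle_sign c * crossing_cochain N c = crossing_number (fst c) (snd c)"
      "\<bar>crossing_cochain N c\<bar> = \<bar>crossing_number (fst c) (snd c)\<bar>"
      using shuffle_sign_pm[OF disj[of A B]] crossing_cochain_cell[OF cell[of A B]] that
      unfolding c by (auto simp: abs_mult)
  qed
  have sum1: "(\<Sum>c\<in>splittings m N J. shuffle_sign c * crossing_cochain N c)
      = (\<Sum>(A, B)\<in>min_splittings J. crossing_number A B)"
    unfolding split case_prod_beta by (intro sum.cong refl signed)
  have sum2: "(\<Sum>c\<in>splittings m N J. \<bar>crossing_cochain N c\<bar>)
      = (\<Sum>(A, B)\<in>min_splittings J. \<bar>crossing_number A B\<bar>)"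
    unfolding split case_prod_beta by (intro sum.cong refl unsigned)
  show abs: "(\<Sum>c\<in>splittings m N J. \<bar>crossing_cochain N c\<bar>) \<le> int m - int (ell m J)"
    unfolding sum2 by (rule sum_abs_crossing_number[OF Jmax])
  show low: "- 1 \<le> (\<Sum>c\<in>splittings m N J. shuffle_sign c * crossing_cochain N c)"
    and up: "(\<Sum>c\<in>splittings m N J. shuffle_sign c * crossing_cochain N c) \<le> 0"
    unfolding sum1 sum_crossing_number[OF Jmax] by (auto simp: of_bool_def)
  assume c: "c \<in> splittings m N J"
  have "(\<Sum>c\<in>splittings m N J. \<bar>shuffle_sign c * crossing_cochain N c\<bar>) \<le> int (m - ell m J)"
  proof -
    have "(\<Sum>c\<in>splittings m N J. \<bar>shuffle_sign c * crossing_cochain N c\<bar>)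
        = (\<Sum>c\<in>splittings m N J. \<bar>crossing_cochain N c\<bar>)"
      unfolding split by (intro sum.cong refl) (simp only: signed unsigned)
    then show ?thesis using abs ell_le[OF Jmax] by simp
  qed
  moreover have "finite (splittings m N J)"
    unfolding split by (rule finite_min_splittings[OF finJ])
  ultimately show "- \<lceil>(real m - real (ell m J)) / 2\<rceil> \<le> shuffle_sign c * crossing_cochain N c \<and>
      shuffle_sign c * crossing_cochain N c \<le> \<lfloor>(real m - real (ell m J)) / 2\<rfloor>"
    using pair_bounds[of "splittings m N J" c "\<lambda>c. shuffle_sign c * crossing_cochain N c" "m - ell m J"]
      c low up ell_le[OF Jmax] by (simp add: of_nat_diff)
qed

end

theorem theorem5p4:
  fixes m N :: nat and K :: "nat set set"
  assumes "m \<ge> 1"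
    and "complex_on N K"
    and "\<exists>f. geometric_realization m N K f"
  shows "\<exists>u \<in> cochains (m - 1) (simplex_skeleton m N).
    (\<forall>(\<tau>\<^sub>1, \<tau>\<^sub>2) \<in> dp_cells (m - 1) (simplex_skeleton m N).
       u (\<tau>\<^sub>1, \<tau>\<^sub>2) = (-1) ^ ((sdim \<tau>\<^sub>1 + 1) * (sdim \<tau>\<^sub>2 + 1)) * u (\<tau>\<^sub>2, \<tau>\<^sub>1)) \<and>
    (\<forall>J. J \<subseteq> {0..N} \<and> card J = m + 1 \<longrightarrow>
       (\<Sum>c\<in>splittings m N J. \<bar>u c\<bar>) \<le> int m - int (ell m J) \<and>
       - 1 \<le> (\<Sum>c\<in>splittings m N J. shuffle_sign c * u c) \<and>
       (\<Sum>c\<in>splittings m N J. shuffle_sign c * u c) \<le> 0 \<and>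
       (\<forall>c\<in>splittings m N J.
          - \<lceil>(real m - real (ell m J)) / 2\<rceil> \<le> shuffle_sign c * u c \<and>
          shuffle_sign c * u c \<le> \<lfloor>(real m - real (ell m J)) / 2\<rfloor>)) \<and>
    (\<forall>c \<in> dp_cells m (simplex_skeleton m N).
       - 1 - cyclic_cocycle m c \<le> coboundary u c \<and>
       coboundary u c \<le> 1 - cyclic_cocycle m c) \<and>
    (\<forall>(\<sigma>, \<tau>) \<in> deleted_product (simplex_skeleton m N).
       sdim \<sigma> = m - 1 \<and> sdim \<tau> = 2 \<longrightarrow>
       - 1 - eval_id_bd (cyclic_cocycle m) \<sigma> \<tau> \<le> eval_bd_bd u \<sigma> \<tau> \<and>
       eval_bd_bd u \<sigma> \<tau> \<le> 1 - eval_id_bd (cyclic_cocycle m) \<sigma> \<tau>) \<and>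
    (\<forall>c \<in> dp_cells m K. coboundary u c = - cyclic_cocycle m c)"
proof -
  \<comment> \<open>At least \<open>m + 2\<close> vertices: the Radon partition of a crossing \<open>J\<close> is read off an affine
      dependency supported on \<open>J\<close> and one more vertex.\<close>
  let ?n = "max (N + 1) (m + 2)"
  obtain E where E: "generic_homotopy m ?n E" "separated m K (homotopy E 1)"
    using generic_realization[OF assms(2) _ assms(1)] assms(3) by blast
  interpret generic_homotopy m ?n E by (rule E(1))
  have N: "N < ?n" by simp
  let ?u = "crossing_cochain N"
  have cocycle: "- 1 - cyclic_cocycle m c \<le> coboundary ?u c \<and> coboundary ?u c \<le> 1 - cyclic_cocycle m c"
    if c: "c \<in> dp_cells m (simplex_skeleton m N)" for c
  proof -
    obtain A B where AB: "c = (A, B)" by (cases c)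
    have "target_cocycle (A, B) \<in> {-1, 0, 1}"
      using c unfolding AB by (intro target_cocycle_bounds) (auto simp: dp_cells_skeleton_iff dest: finite_subset)
    then show ?thesis
      using coboundary_crossing_cochain[OF c[unfolded AB] N] unfolding AB by auto
  qed
  have triangle: "- 1 - eval_id_bd (cyclic_cocycle m) \<sigma> \<tau> \<le> eval_bd_bd ?u \<sigma> \<tau> \<and>
      eval_bd_bd ?u \<sigma> \<tau> \<le> 1 - eval_id_bd (cyclic_cocycle m) \<sigma> \<tau>"
    if \<sigma>\<tau>: "(\<sigma>, \<tau>) \<in> deleted_product (simplex_skeleton m N)" "sdim \<sigma> = m - 1" "sdim \<tau> = 2" for \<sigma> \<tau>
  proof -
    have sub: "\<sigma> \<subseteq> {0..N}" "\<tau> \<subseteq> {0..N}" "\<sigma> \<noteq> {}" "\<sigma> \<inter> \<tau> = {}" and m2: "m \<ge> 2"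
      using \<sigma>\<tau> by (auto simp: deleted_product_def simplex_skeleton_def)
    have "finite \<sigma>" using sub(1) by (rule finite_subset) simp
    then have card_\<sigma>: "card \<sigma> = m"
      using \<sigma>\<tau>(2) sub(3) m2 card_gt_0_iff[of \<sigma>] by (simp add: sdim_def)
    have "card \<tau> = 3" using \<sigma>\<tau>(3) by (simp add: sdim_def)
    then obtain a b c where abc: "a < b" "b < c" "\<tau> = {a, b, c}" by (rule obtain_triple)
    have cob: "coboundary ?u (\<sigma>, {x, y}) = target_cocycle (\<sigma>, {x, y}) - cyclic_cocycle m (\<sigma>, {x, y})"
      if "x \<in> {a, b, c}" "y \<in> {a, b, c}" "x \<noteq> y" for x y
      using that sub abc card_\<sigma> m2
      by (intro coboundary_crossing_cochain[OF _ N]) (auto simp: dp_cells_skeleton_iff sdim_def)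
    have "eval_id_bd (cyclic_cocycle m) \<sigma> \<tau>
        = cyclic_cocycle m (\<sigma>, {b, c}) - cyclic_cocycle m (\<sigma>, {a, c}) + cyclic_cocycle m (\<sigma>, {a, b})"
      unfolding eval_id_bd_def abc(3)
      by (rule sum_face_indices_triple[OF abc(1,2), of "\<lambda>\<tau>. cyclic_cocycle m (\<sigma>, \<tau>)"])
    moreover have "eval_bd_bd ?u \<sigma> \<tau>
        = coboundary ?u (\<sigma>, {b, c}) - coboundary ?u (\<sigma>, {a, c}) + coboundary ?u (\<sigma>, {a, b})"
      unfolding abc(3) by (rule eval_bd_bd_triangle[OF abc(1,2)])
    moreover have "\<bar>target_cocycle (\<sigma>, {b, c}) - target_cocycle (\<sigma>, {a, c}) + target_cocycle (\<sigma>, {a, b})\<bar> \<le> 1"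
      using sub abc by (intro target_cocycle_triangle[OF abc(1,2) _ card_\<sigma>]) auto
    ultimately show ?thesis
      using cob[of b c] cob[of a c] cob[of a b] abc(1,2) by auto
  qed
  have realized: "coboundary ?u c = - cyclic_cocycle m c" if c: "c \<in> dp_cells m K" for c
  proof -
    obtain A B where AB: "c = (A, B)" by (cases c)
    have K: "A \<in> K" "B \<in> K" "A \<inter> B = {}" "sdim A + sdim B = m"
      using c unfolding AB dp_cells_def deleted_product_def by auto
    note simplices = complex_on_finite(2-4)[OF assms(2) K(1)] complex_on_finite(2-4)[OF assms(2) K(2)]
    then have cards: "card A > 0" "card B > 0" by (auto simp: card_gt_0_iff)
    then have cell: "(A, B) \<in> dp_cells m (simplex_skeleton m N)"
      using K simplices unfolding dp_cells_skeleton_iff by (auto simp: sdim_def)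
    have "card (A \<union> B) = m + 2"
      using K(3) simplices(1,4) cell by (simp add: card_Un_disjoint dp_cells_skeleton_iff)
    moreover have "A \<union> B \<subseteq> {..<?n}" using simplices by auto
    ultimately have "circuit_support (A \<union> B)" by (simp only: circuit_support_def)
    then have "target_cocycle (A, B) = 0"
      using K simplices by (intro target_cocycle_separated[OF E(2)]) auto
    then show ?thesis
      using coboundary_crossing_cochain[OF cell N] unfolding AB by simp
  qed
  show ?thesis
    using crossing_cochain_cochains crossing_cochain_swap crossing_cochain_splittings[OF _ _ N]
      cocycle triangle realized
    by (intro bexI[of _ ?u]) auto
qed

end
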